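(* Let $B=\begin{pmatrix} b_1^1 & b_2^1\\ b_1^2 & b_2^2\end{pmatrix}$ be a $2\times 2$ integer matrix with $\det(B)>0$ such that the domain $$\mathcal{U}=\left\{(z_1,z_2)\in\mathbb{C}^2 : |z_1|^{b_1^1}|z_2|^{b_2^1}<1,\ |z_1|^{b_1^2}|z_2|^{b_2^2}<1\right\}$$ is bounded. Define the integer matrix $$A=\begin{pmatrix} a_1^1 & a_2^1\\ a_1^2 & a_2^2\end{pmatrix}=\begin{pmatrix} \dfrac{b_2^2}{\gcd(b_2^2,b_1^2)} & \dfrac{-b_2^1}{\gcd(b_2^1,b_1^1)}\\[2ex] \dfrac{-b_1^2}{\gcd(b_2^2,b_1^2)} & \dfrac{b_1^1}{\gcd(b_2^1,b_1^1)}\end{pmatrix},\qquad R=\begin{pmatrix}0&1\\1&0\end{pmatrix}.$$ Then the Bergman kernel of $\mathcal{U}$ is given, for all $z,w\in\mathcal{U}$ and with $t_j=z_j\overline{w_j}$, $j=1,2$, by $$K_{\mathcal{U}}(z,w)=\frac{1}{\pi^2\det(A)}\cdot\frac{g(t_1,t_2)}{\left(t_2^{a_2^1}-t_1^{a_2^2}\right)^2\left(t_1^{a_1^2}-t_2^{a_1^1}\right)^2},$$ where $$g(t_1,t_2)=\sum_{\gamma=(\gamma_1,\gamma_2)\in\mathbb{Z}_{\ge 0}^2} D_{\det(A)}\big(N(A,\gamma)\big)\,D_{\det(A)}\big(N(AR,\gamma)\big)\,t_1^{\gamma_1}t_2^{\gamma_2}.$$ Here the sum is finite; in fact, the coefficient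 of $t_1^{\gamma_1}t_2^{\gamma_2}$ in $g$ can be nonzero only if $$0\le\gamma_1\le 2a_1^2+2a_2^2-2,\qquad 0\le\gamma_2\le 2a_1^1+2a_2^1-2.$$
   Context: For an integer $2\times 2$ matrix, superscripts index rows and subscripts index columns: $p_j^i$ is the entry of $P$ in row $i$ and column $j$ (superscripts on matrix entries are not powers). The expression $0^0$ is read as $1$, and a point at which a zero coordinate carries a negative exponent in one of the defining inequalities is not in $\mathcal{U}$. The Bergman kernel $K_\Omega(z,w)$ of a domain $\Omega\subset\mathbb{C}^2$ is the reproducing kernel of the Hilbert space of holomorphic functions on $\Omega$ that are square integrable with respect to Lebesgue measure; it is holomorphic in $z$ and antiholomorphic in $w$. $\gcd$ denotes the positive greatest common divisor. For integers $k\ge 1$ and $r$, define $$D_k(r)=\begin{cases}1+r, & 0\le r\le k-1,\\ 2k-(1+r), & k\le r\le 2k-2,\\ 0, & r<0\text{ or } r>2k-2.\end{cases}$$ For a $2\times2$ integer matrix $P=\begin{pmatrix} p_1^1 & p_2^1 \\ p_1^2 & p_2^2 \end{pmatrix}$, its permanent is $\mathrm{perm}(P)=p_1^1p_2^2+p_2^1p_1^2$, and for $\gamma=(\gamma_1,\gamma_2)$ define $$N(P,\gamma)=p_1^1\gamma_1+p_1^2\gamma_2-2p_1^1p_1^2+p_1^1+p_1^2-1-\mathrm{perm}(P)+|\det(P)|.$$ *)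

theory Defs
  imports "HOL-Analysis.Analysis"
begin

section \<open>Bergman kernels of domains in \<open>\<complex>\<^sup>2\<close>\<close>

text \<open>
  Holomorphy in two variables is existence, at each point, of a complex-linear Frechet derivative.
\<close>

definition holomorphic2_on :: "(complex \<times> complex \<Rightarrow> complex) \<Rightarrow> (complex \<times> complex) set \<Rightarrow> bool" where
  "holomorphic2_on f \<Omega> \<longleftrightarrow>
     (\<forall>z\<in>\<Omega>. \<exists>a b. (f has_derivative (\<lambda>h. a * fst h + b * snd h)) (at z within \<Omega>))"

definition bergman_space :: "(complex \<times> complex) set \<Rightarrow> (complex \<times> complex \<Rightarrow> complex) set" where
  "bergman_space \<Omega> =
     {f. holomorphic2_on f \<Omega> \<and> set_integrable lborel \<Omega> (\<lambda>z. (norm (f z))\<^sup>2)}"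

definition reproducing_kernel ::
    "(complex \<times> complex) set \<Rightarrow> (complex \<times> complex \<Rightarrow> complex \<times> complex \<Rightarrow> complex) \<Rightarrow> bool" where
  "reproducing_kernel \<Omega> K \<longleftrightarrow>
     (\<forall>w\<in>\<Omega>. (\<lambda>z. K z w) \<in> bergman_space \<Omega> \<and>
        (\<forall>f\<in>bergman_space \<Omega>. f w = (LINT z:\<Omega>|lborel. f z * cnj (K z w))))"

text \<open>
  On a domain the reproducing kernel exists and its values on \<open>\<Omega> \<times> \<Omega>\<close> are unique; the choice
  below only concerns values outside \<open>\<Omega> \<times> \<Omega>\<close>.
\<close>

definition bergman_kernel ::
    "(complex \<times> complex) set \<Rightarrow> complex \<times> complex \<Rightarrow> complex \<times> complex \<Rightarrow> complex" where
  "bergman_kernel \<Omega> = (SOME K. reproducing_kernel \<Omega> K)"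


section \<open>Monomial polyhedra\<close>

text \<open>
  The matrix entry written \<open>p\<close> with superscript \<open>i\<close> and subscript \<open>j\<close> in the literature (row \<open>i\<close>,
  column \<open>j\<close>) is \<open>P $ i $ j\<close> throughout.
\<close>

text \<open>
  The expression \<open>x powi n\<close> has \<open>0 powi 0 = 1\<close>, as wanted, but \<open>0 powi n = 0\<close> for \<open>n < 0\<close>; points where a
  zero coordinate carries a negative exponent therefore have to be excluded explicitly.
\<close>

definition monomial_less_one :: "int \<Rightarrow> int \<Rightarrow> complex \<times> complex \<Rightarrow> bool" where
  "monomial_less_one m n z \<longleftrightarrow>
     \<not> (fst z = 0 \<and> m < 0) \<and> \<not> (snd z = 0 \<and> n < 0) \<and>
     norm (fst z) powi m * norm (snd z) powi n < 1"

definition monomial_polyhedron :: "int^2^2 \<Rightarrow> (complex \<times> complex) set" where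
  "monomial_polyhedron B =
     {z. monomial_less_one (B $ 1 $ 1) (B $ 1 $ 2) z \<and> monomial_less_one (B $ 2 $ 1) (B $ 2 $ 2) z}"

definition matA :: "int^2^2 \<Rightarrow> int^2^2" where
  "matA B = vector
     [vector [(B $ 2 $ 2) div gcd (B $ 2 $ 2) (B $ 2 $ 1), (- (B $ 1 $ 2)) div gcd (B $ 1 $ 2) (B $ 1 $ 1)],
      vector [(- (B $ 2 $ 1)) div gcd (B $ 2 $ 2) (B $ 2 $ 1), (B $ 1 $ 1) div gcd (B $ 1 $ 2) (B $ 1 $ 1)]]"

definition matR :: "int^2^2" where
  "matR = vector [vector [0, 1], vector [1, 0]]"

definition perm2 :: "int^2^2 \<Rightarrow> int" where
  "perm2 P = P $ 1 $ 1 * P $ 2 $ 2 + P $ 1 $ 2 * P $ 2 $ 1"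

definition coeffD :: "int \<Rightarrow> int \<Rightarrow> int" where
  "coeffD k r =
     (if 0 \<le> r \<and> r \<le> k - 1 then 1 + r
      else if k \<le> r \<and> r \<le> 2 * k - 2 then 2 * k - (1 + r)
      else 0)"

definition indexN :: "int^2^2 \<Rightarrow> nat \<times> nat \<Rightarrow> int" where
  "indexN P \<gamma> =
     P $ 1 $ 1 * int (fst \<gamma>) + P $ 2 $ 1 * int (snd \<gamma>) - 2 * P $ 1 $ 1 * P $ 2 $ 1
       + P $ 1 $ 1 + P $ 2 $ 1 - 1 - perm2 P + \<bar>det P\<bar>"

definition coeff_g :: "int^2^2 \<Rightarrow> nat \<times> nat \<Rightarrow> int" where
  "coeff_g A \<gamma> = coeffD (det A) (indexN A \<gamma>) * coeffD (det A) (indexN (A ** matR) \<gamma>)"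

definition poly_g :: "int^2^2 \<Rightarrow> complex \<Rightarrow> complex \<Rightarrow> complex" where
  "poly_g A t1 t2 = (\<Sum>\<^sub>\<infinity>\<gamma>\<in>UNIV. of_int (coeff_g A \<gamma>) * t1 ^ fst \<gamma> * t2 ^ snd \<gamma>)"

end

theory Submission
  imports Defs "HOL-Complex_Analysis.Cauchy_Integral_Theorem" "HOL-Real_Asymp.Real_Asymp"
begin

text \<open>
  Write \<open>A\<close> as the matrix with rows \<open>(p, q)\<close> and \<open>(r, s)\<close>, and \<open>d\<close> for its determinant. Boundedness of the
  polyhedron forces the entries of \<open>A\<close> to be nonnegative, and the polyhedron is the set \<open>U\<close> given by
  \<open>\<bar>z\<^sub>1\<bar>\<^sup>s < \<bar>z\<^sub>2\<bar>\<^sup>q\<close> and \<open>\<bar>z\<^sub>2\<bar>\<^sup>p < \<bar>z\<^sub>1\<bar>\<^sup>r\<close>. In the coordinates \<open>- ln \<bar>z\<^sub>j\<bar>\<close> it becomes the cone spanned by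
  the columns of \<open>A\<close>.

  Since \<open>U\<close> is invariant under rotations of both coordinates, Laurent monomials with different exponents
  are orthogonal. For an exponent \<open>\<alpha>\<close> put \<open>(m, n) = (\<alpha> + (1, 1)) A\<close>. Integration over the cone shows that
  the monomial has squared norm \<open>\<pi>\<^sup>2 d / (m n)\<close> if \<open>m, n > 0\<close>, and infinite norm otherwise
  (\<open>nn_integral_zmonom\<close>). This suggests the kernel as the sum of \<open>m n t\<^sup>\<alpha> / (\<pi>\<^sup>2 d)\<close> over these exponents.

  That the series reproduces amounts to completeness: every \<open>f\<close> in the Bergman space is the sum of its
  Laurent series (\<open>expansion\<close>). The Fourier coefficient of \<open>f\<close> on the torus through \<open>w\<close> has the form
  \<open>c w\<^sup>\<alpha>\<close> with \<open>c\<close> independent of \<open>w\<close> (\<open>torus_mean_twist\<close>). Indeed, along the curves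
  \<open>x \<mapsto> (x\<^sup>p w\<^sub>1, x\<^sup>r w\<^sub>2)\<close> and \<open>x \<mapsto> (x\<^sup>q w\<^sub>1, x\<^sup>s w\<^sub>2)\<close>, which run parallel to the edges of the cone, \<open>f\<close> is a
  holomorphic function of one variable on a punctured disc, and its averages over circles do not depend
  on the radius. Bessel's inequality (\<open>coeff_energy\<close>) removes the exponents of infinite norm and makes the
  series converge absolutely; by the Stone-Weierstrass theorem its sum is \<open>f\<close>, because both have the same
  Fourier coefficients on each torus (\<open>torus_fourier_unique\<close>).

  The closed form comes from reading multiplication by \<open>t\<^sub>2\<^sup>q - t\<^sub>1\<^sup>s\<close> as a difference operator on
  coefficients: it changes \<open>m\<close> in steps of \<open>d\<close> and leaves \<open>n\<close> alone, while \<open>t\<^sub>1\<^sup>r - t\<^sub>2\<^sup>p\<close> does the opposite. The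
  second difference of the positive part is the tent function \<open>coeffD\<close>, so multiplication by the squares
  of both factors turns the series into the polynomial \<open>g\<close> (\<open>weighted_series_closed_form\<close>).
\<close>

section \<open>Lebesgue measure on \<open>\<complex>\<^sup>2\<close>: rotations and logarithms of moduli\<close>

text \<open>
  Two one-dimensional affine substitutions with an exchange of the order of integration in between:
  first \<open>y\<close> is replaced for fixed \<open>x\<close>, which uses up the factor \<open>(a e - b c) / a\<close>, then \<open>x\<close>, which
  contributes the factor \<open>a\<close>. The same statement serves rotations of \<open>\<complex>\<close> and the passage to cone
  coordinates.
\<close>

lemma nn_integral_linear_plane:
  fixes a b c e :: real and F :: "real \<times> real \<Rightarrow> ennreal"
  assumes [measurable]: "F \<in> borel_measurable borel" and a: "a \<noteq> 0" and D: "a * e - b * c \<noteq> 0"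
  shows "(\<integral>\<^sup>+x. \<integral>\<^sup>+y. F (x, y) \<partial>lborel \<partial>lborel) =
    ennreal \<bar>a * e - b * c\<bar> * (\<integral>\<^sup>+u. \<integral>\<^sup>+v. F (a * u + b * v, c * u + e * v) \<partial>lborel \<partial>lborel)"
proof -
  let ?D = "a * e - b * c"
  have 1: "(\<integral>\<^sup>+y. F (x, y) \<partial>lborel) = ennreal \<bar>?D / a\<bar> * (\<integral>\<^sup>+v. F (x, (c / a) * x + (?D / a) * v) \<partial>lborel)" for x
    by (rule nn_integral_real_affine) (use a D in auto)
  have "(\<integral>\<^sup>+x. \<integral>\<^sup>+y. F (x, y) \<partial>lborel \<partial>lborel)
     = ennreal \<bar>?D / a\<bar> * (\<integral>\<^sup>+x. \<integral>\<^sup>+v. F (x, (c / a) * x + (?D / a) * v) \<partial>lborel \<partial>lborel)"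
    unfolding 1 by (rule nn_integral_cmult) measurable
  also have "(\<integral>\<^sup>+x. \<integral>\<^sup>+v. F (x, (c / a) * x + (?D / a) * v) \<partial>lborel \<partial>lborel)
     = (\<integral>\<^sup>+v. \<integral>\<^sup>+x. F (x, (c / a) * x + (?D / a) * v) \<partial>lborel \<partial>lborel)"
    by (rule lborel_pair.Fubini'[symmetric]) measurable
  also have "\<dots> = (\<integral>\<^sup>+v. ennreal \<bar>a\<bar> * (\<integral>\<^sup>+u. F (b * v + a * u, (c / a) * (b * v + a * u) + (?D / a) * v) \<partial>lborel) \<partial>lborel)"
    by (intro nn_integral_cong nn_integral_real_affine) (use a in auto)
  also have "\<dots> = (\<integral>\<^sup>+v. ennreal \<bar>a\<bar> * (\<integral>\<^sup>+u. F (a * u + b * v, c * u + e * v) \<partial>lborel) \<partial>lborel)"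
  proof -
    have "(b * v + a * u, (c / a) * (b * v + a * u) + (?D / a) * v) = (a * u + b * v, c * u + e * v)" for u v
      using a by (simp add: field_simps)
    then show ?thesis by (simp only:)
  qed
  also have "\<dots> = ennreal \<bar>a\<bar> * (\<integral>\<^sup>+v. \<integral>\<^sup>+u. F (a * u + b * v, c * u + e * v) \<partial>lborel \<partial>lborel)"
    by (rule nn_integral_cmult) measurable
  also have "(\<integral>\<^sup>+v. \<integral>\<^sup>+u. F (a * u + b * v, c * u + e * v) \<partial>lborel \<partial>lborel)
      = (\<integral>\<^sup>+u. \<integral>\<^sup>+v. F (a * u + b * v, c * u + e * v) \<partial>lborel \<partial>lborel)"
    by (rule lborel_pair.Fubini') measurable
  finally show ?thesis
    using a by (simp add: mult.assoc[symmetric] ennreal_mult'[symmetric] abs_mult abs_divide)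
qed

lemma measurable_Complex [measurable]: "(\<lambda>x. Complex (fst x) (snd x)) \<in> borel_measurable borel"
  unfolding Complex_eq by (intro borel_measurable_continuous_onI continuous_intros)

lemma lborel_complex_eq: "lborel = distr (lborel \<Otimes>\<^sub>M lborel) borel (\<lambda>x. Complex (fst x) (snd x))" (is "_ = ?D")
proof (rule lborel_eqI)
  fix l u :: complex assume le: "\<And>b. b \<in> Basis \<Longrightarrow> l \<bullet> b \<le> u \<bullet> b"
  have *: "Re l \<le> Re u" "Im l \<le> Im u" using le[of 1] le[of \<i>] by (auto simp: Basis_complex_def)
  have "emeasure ?D (box l u)
     = emeasure (lborel \<Otimes>\<^sub>M lborel) ({Re l<..<Re u} \<times> {Im l<..<Im u})"
    by (subst emeasure_distr)
       (auto simp: borel_prod lborel_prod box_def Basis_complex_def intro!: arg_cong[where f="emeasure lborel"])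
  also have "\<dots> = ennreal (Re u - Re l) * ennreal (Im u - Im l)"
    using * by (subst lborel.emeasure_pair_measure_Times) auto
  finally show "emeasure ?D (box l u)
     = ennreal (\<Prod>b\<in>Basis. (u - l) \<bullet> b)"
    using * by (simp add: Basis_complex_def ennreal_mult')
qed simp

lemma nn_integral_complex_plane:
  assumes [measurable]: "F \<in> borel_measurable borel"
  shows "(\<integral>\<^sup>+z. F z \<partial>lborel) = (\<integral>\<^sup>+x. \<integral>\<^sup>+y. F (Complex x y) \<partial>lborel \<partial>lborel)"
proof -
  have "(\<integral>\<^sup>+z. F z \<partial>lborel) = (\<integral>\<^sup>+x. F (Complex (fst x) (snd x)) \<partial>(lborel \<Otimes>\<^sub>M lborel))"
    by (subst lborel_complex_eq, subst nn_integral_distr) (auto simp: borel_prod lborel_prod)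
  also have "\<dots> = (\<integral>\<^sup>+x. \<integral>\<^sup>+y. F (Complex x y) \<partial>lborel \<partial>lborel)"
    by (subst lborel.nn_integral_fst[symmetric]) (auto simp: borel_prod lborel_prod)
  finally show ?thesis .
qed

text \<open>
  Multiplication by \<open>w\<close> is a linear map of the plane with determinant \<open>\<bar>w\<bar>\<^sup>2 = 1\<close>. The substitution needs
  \<open>Re w \<noteq> 0\<close>; otherwise the rotation is performed as two rotations by a square root of \<open>w\<close>.
\<close>

lemma nn_integral_rotate:
  assumes [measurable]: "F \<in> borel_measurable borel" and w: "norm (w :: complex) = 1"
  shows "(\<integral>\<^sup>+z. F (w * z) \<partial>lborel) = (\<integral>\<^sup>+z. F z \<partial>lborel)"
proof -
  have base: "(\<integral>\<^sup>+z. G (v * z) \<partial>lborel) = (\<integral>\<^sup>+z. G z \<partial>lborel)"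
    if [measurable]: "G \<in> borel_measurable borel" and v: "norm v = 1" "Re v \<noteq> 0" for G :: "complex \<Rightarrow> ennreal" and v
  proof -
    have D: "Re v * Re v - (- Im v) * Im v = 1"
      using v(1) by (simp add: cmod_def power2_eq_square)
    have "(\<integral>\<^sup>+z. G z \<partial>lborel) = (\<integral>\<^sup>+x. \<integral>\<^sup>+y. (\<lambda>x. G (Complex (fst x) (snd x))) (x, y) \<partial>lborel \<partial>lborel)"
      by (simp add: nn_integral_complex_plane)
    also have "\<dots> = (\<integral>\<^sup>+x. \<integral>\<^sup>+y. G (Complex (Re v * x + (- Im v) * y) (Im v * x + Re v * y)) \<partial>lborel \<partial>lborel)"
      using nn_integral_linear_plane[of "\<lambda>x. G (Complex (fst x) (snd x))" "Re v" "Re v" "- Im v" "Im v"] v(2)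
      unfolding D by simp
    also have "\<dots> = (\<integral>\<^sup>+x. \<integral>\<^sup>+y. G (v * Complex x y) \<partial>lborel \<partial>lborel)"
      by (intro nn_integral_cong arg_cong[where f=G]) (simp add: complex_eq_iff)
    also have "\<dots> = (\<integral>\<^sup>+z. G (v * z) \<partial>lborel)"
      by (simp add: nn_integral_complex_plane)
    finally show ?thesis by simp
  qed
  show ?thesis
  proof (cases "Re w = 0")
    case False then show ?thesis using base[of F w] w by simp
  next
    case True
    define v where "v = csqrt w"
    have vv: "v * v = w" by (simp add: v_def flip: power2_eq_square)
    then have nv: "norm v = 1" using w by (metis norm_ge_zero norm_mult power2_eq_1_iff power2_eq_square one_neq_neg_one neg_0_le_iff_le not_one_le_zero)
    have "Re v \<noteq> 0"
    proof
      assume "Re v = 0"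
      then have "Re w = - (Im v)\<^sup>2" using vv[symmetric] by (simp add: power2_eq_square)
      moreover have "(Im v)\<^sup>2 = 1" using cmod_power2[of v] nv \<open>Re v = 0\<close> by simp
      ultimately show False using True by simp
    qed
    then have "(\<integral>\<^sup>+z. F z \<partial>lborel) = (\<integral>\<^sup>+z. F (v * (v * z)) \<partial>lborel)"
      using base[of F v] base[of "\<lambda>z. F (v * z)" v] nv by simp
    then show ?thesis by (simp add: vv mult.assoc[symmetric])
  qed
qed

lemma distr_rotate_lborel:
  assumes "norm (w :: complex) = 1"
  shows "distr lborel lborel (\<lambda>z. w * z) = lborel"
proof (rule measure_eqI)
  fix X assume "X \<in> sets (distr lborel lborel (\<lambda>z. w * z))"
  then have [measurable]: "X \<in> sets borel" by simp
  show "emeasure (distr lborel lborel (\<lambda>z. w * z)) X = emeasure lborel X"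
    using nn_integral_rotate[of "indicator X" w] assms
      nn_integral_distr[of "\<lambda>z. w * z" lborel lborel "indicator X"] by simp
qed simp

lemma distr_rotate_pair:
  fixes M N :: "complex measure"
  assumes [measurable_cong]: "sets M = sets borel" "sets N = sets borel"
    and "sigma_finite_measure N"
    and M: "distr M M (\<lambda>z. w1 * z) = M" and N: "distr N N (\<lambda>z. w2 * z) = N"
  shows "distr (M \<Otimes>\<^sub>M N) (M \<Otimes>\<^sub>M N) (\<lambda>z. (w1 * fst z, w2 * snd z)) = M \<Otimes>\<^sub>M N"
proof -
  have "distr M M (\<lambda>z. w1 * z) \<Otimes>\<^sub>M distr N N (\<lambda>z. w2 * z)
      = distr (M \<Otimes>\<^sub>M N) (M \<Otimes>\<^sub>M N) (\<lambda>(x, y). (w1 * x, w2 * y))"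
    by (rule pair_measure_distr) (use assms in auto)
  then show ?thesis by (simp add: M N case_prod_unfold)
qed

lemma distr_rotate_lborel2:
  assumes "norm (w1::complex) = 1" "norm (w2::complex) = 1"
  shows "distr lborel lborel (\<lambda>z. (w1 * fst z, w2 * snd z)) = lborel"
  using distr_rotate_pair[of lborel lborel w1 w2] distr_rotate_lborel assms
  by (simp add: lborel_prod sigma_finite_lborel)

lemma nn_integral_exp_Ioi:
  assumes "0 < (c::real)"
  shows "(\<integral>\<^sup>+x. ennreal (exp (- c * x)) * indicator {a<..} x \<partial>lborel) = ennreal (exp (- c * a) / c)"
proof -
  have "(\<integral>\<^sup>+x. ennreal (exp (- c * x)) * indicator {a<..} x \<partial>lborel) =
     (\<integral>\<^sup>+x. ennreal (exp (- c * x)) * indicator {a..} x \<partial>lborel)"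
    by (intro nn_integral_cong_AE)
       (use AE_lborel_singleton[of a] in eventually_elim, auto simp: indicator_def)
  also have "\<dots> = ennreal (0 - (- exp (- c * a) / c))"
  proof (rule nn_integral_FTC_atLeast)
    show "((\<lambda>x. - exp (- c * x) / c) has_real_derivative exp (- c * x)) (at x)" for x
      using assms by (auto intro!: derivative_eq_intros)
    show "((\<lambda>x. - exp (- c * x) / c) \<longlongrightarrow> 0) at_top"
      using assms by real_asymp
  qed auto
  finally show ?thesis by simp
qed

text \<open>
  Polar coordinates without angles: the half lines \<open>{x<..}\<close> pull back, up to the origin, to discs of
  radius \<open>exp (- x)\<close>, whose area is \<open>\<pi> exp (- 2 x)\<close>.
\<close>

lemma distr_neg_ln_norm:
  "distr lborel borel (\<lambda>z::complex. - ln (norm z)) = density lborel (\<lambda>x. ennreal (2 * pi * exp (- 2 * x)))"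
(is "?M = ?D")
proof (rule measure_eqI_lessThan)
  have e1: "emeasure ?M {x<..} = ennreal (pi * exp (- 2 * x))" for x
  proof -
    have "emeasure ?M {x<..} = emeasure lborel {z::complex. - ln (norm z) > x}"
      by (subst emeasure_distr) (auto intro!: arg_cong[where f="emeasure lborel"])
    also have "\<dots> = emeasure lborel (ball (0::complex) (exp (- x)))"
    proof (intro emeasure_eq_AE)
      have *: "x < - ln (norm z) \<longleftrightarrow> norm z < exp (- x)" if "z \<noteq> 0" for z :: complex
        using that ln_less_cancel_iff[of "norm z" "exp (- x)"] by auto
      show "AE z in lborel. (z \<in> {z::complex. - ln (norm z) > x}) = (z \<in> ball 0 (exp (- x)))"
        using AE_lborel_singleton[of "0::complex"] by eventually_elim (simp add: *)
    qed (auto)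
    also have "\<dots> = ennreal (pi * exp (- 2 * x))"
      using emeasure_ball[of "exp (- x)" "0::complex"] unit_ball_vol_2 by (simp flip: exp_double)
    finally show ?thesis .
  qed
  show "emeasure ?M {x<..} < \<infinity>" for x by (simp add: e1)
  show "emeasure ?M {x<..} =
    emeasure ?D {x<..}" for x
  proof -
    have "emeasure ?D {x<..} =
       (\<integral>\<^sup>+y. ennreal (2 * pi) * (ennreal (exp (- 2 * y)) * indicator {x<..} y) \<partial>lborel)"
      by (subst emeasure_density) (auto simp: ennreal_mult' mult.assoc)
    also have "\<dots> = ennreal (2 * pi) * ennreal (exp (- 2 * x) / 2)"
      by (subst nn_integral_cmult) (auto simp: nn_integral_exp_Ioi[of 2, simplified])
    also have "\<dots> = ennreal (pi * exp (- 2 * x))"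
      by (simp flip: ennreal_mult')
    finally show ?thesis by (simp add: e1)
  qed
qed auto

lemma nn_integral_neg_ln_norm:
  assumes [measurable]: "G \<in> borel_measurable borel"
  shows "(\<integral>\<^sup>+z. G (- ln (norm (z::complex))) \<partial>lborel) = (\<integral>\<^sup>+x. ennreal (2 * pi * exp (- 2 * x)) * G x \<partial>lborel)"
  using nn_integral_distr[of "\<lambda>z::complex. - ln (norm z)" lborel borel G]
  by (simp add: distr_neg_ln_norm nn_integral_density)

lemma nn_integral_neg_ln_norm2:
  assumes [measurable]: "G \<in> borel_measurable (borel :: (real \<times> real) measure)"
  shows "(\<integral>\<^sup>+z. G (- ln (norm (fst (z::complex\<times>complex))), - ln (norm (snd z))) \<partial>lborel) =
    ennreal (4 * pi\<^sup>2) * (\<integral>\<^sup>+x. \<integral>\<^sup>+y. ennreal (exp (- 2 * x - 2 * y)) * G (x, y) \<partial>lborel \<partial>lborel)"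
proof -
  have [measurable]: "G \<in> borel_measurable (borel \<Otimes>\<^sub>M borel)" using assms by (simp add: borel_prod)
  have [measurable]: "(\<lambda>z. G (- ln (norm (fst (z::complex \<times> complex))), - ln (norm (snd z)))) \<in> borel_measurable borel"
    unfolding borel_prod[symmetric] by measurable
  have "(\<integral>\<^sup>+z. G (- ln (norm (fst (z::complex\<times>complex))), - ln (norm (snd z))) \<partial>lborel)
     = (\<integral>\<^sup>+z. \<integral>\<^sup>+w. G (- ln (norm (z::complex)), - ln (norm (w::complex))) \<partial>lborel \<partial>lborel)"
    by (subst lborel_prod[symmetric], subst lborel.nn_integral_fst[symmetric]) (auto simp: lborel_prod borel_prod)
  also have "\<dots> = (\<integral>\<^sup>+z. \<integral>\<^sup>+y. ennreal (2 * pi * exp (- 2 * y)) * G (- ln (norm (z::complex)), y) \<partial>lborel \<partial>lborel)"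
    by (subst nn_integral_neg_ln_norm[where G="\<lambda>y. G (_, y)"]) auto
  also have "\<dots> = (\<integral>\<^sup>+x. ennreal (2 * pi * exp (- 2 * x)) * (\<integral>\<^sup>+y. ennreal (2 * pi * exp (- 2 * y)) * G (x, y) \<partial>lborel) \<partial>lborel)"
    by (rule nn_integral_neg_ln_norm) measurable
  also have "\<dots> = (\<integral>\<^sup>+x. \<integral>\<^sup>+y. ennreal (4 * pi\<^sup>2) * (ennreal (exp (- 2 * x - 2 * y)) * G (x, y)) \<partial>lborel \<partial>lborel)"
  proof -
    have "ennreal (2 * pi * exp (- 2 * x)) * (ennreal (2 * pi * exp (- 2 * y)) * g)
        = ennreal (4 * pi\<^sup>2) * (ennreal (exp (- 2 * x - 2 * y)) * g)" for x y and g :: ennreal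
    proof -
      have "2 * pi * exp (- 2 * x) * (2 * pi * exp (- 2 * y)) = 4 * pi\<^sup>2 * exp (- 2 * x - 2 * y)"
        by (simp add: power2_eq_square exp_diff exp_minus field_simps)
      then have "ennreal (2 * pi * exp (- 2 * x)) * ennreal (2 * pi * exp (- 2 * y))
        = ennreal (4 * pi\<^sup>2) * ennreal (exp (- 2 * x - 2 * y))"
        by (metis ennreal_mult' exp_ge_zero mult_nonneg_nonneg pi_ge_zero zero_le_numeral zero_le_power2)
      then show ?thesis by (simp only: mult.assoc[symmetric])
    qed
    then show ?thesis by (subst nn_integral_cmult[symmetric]) auto
  qed
  also have "\<dots> = (\<integral>\<^sup>+x. ennreal (4 * pi\<^sup>2) * (\<integral>\<^sup>+y. ennreal (exp (- 2 * x - 2 * y)) * G (x, y) \<partial>lborel) \<partial>lborel)"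
    by (subst nn_integral_cmult) auto
  also have "\<dots> = ennreal (4 * pi\<^sup>2) * (\<integral>\<^sup>+x. \<integral>\<^sup>+y. ennreal (exp (- 2 * x - 2 * y)) * G (x, y) \<partial>lborel \<partial>lborel)"
    by (rule nn_integral_cmult) measurable
  finally show ?thesis .
qed

section \<open>Fourier coefficients on the torus\<close>

text \<open>
  Normalised arc length on the unit circle, as a measure on the whole plane, so that its measurable
  sets are simply the Borel sets.
\<close>

definition circle_measure :: "complex measure" where
  "circle_measure = distr (density lborel (indicator {0..<1})) borel (\<lambda>t. cis (2 * pi * t))"

lemma measurable_cis_scaled [measurable]: "(\<lambda>t::real. cis (c * t)) \<in> borel_measurable borel"
  by (intro borel_measurable_continuous_onI continuous_intros)

lemma sets_circle_measure [simp, measurable_cong]: "sets circle_measure = sets borel"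
  by (simp add: circle_measure_def)

lemma space_circle_measure [simp]: "space circle_measure = UNIV"
  by (simp add: circle_measure_def)

lemma nn_integral_circle_measure:
  assumes [measurable]: "F \<in> borel_measurable borel"
  shows "(\<integral>\<^sup>+z. F z \<partial>circle_measure) = (\<integral>\<^sup>+t. F (cis (2 * pi * t)) * indicator {0..<1} t \<partial>lborel)"
  unfolding circle_measure_def
  by (subst nn_integral_distr) (auto simp: nn_integral_density mult.commute[of "indicator _ _"])

lemma emeasure_circle_measure_UNIV: "emeasure circle_measure UNIV = 1"
  using nn_integral_circle_measure[of "\<lambda>_. 1"] by simp

lemma finite_measure_circle: "finite_measure circle_measure"
  by standard (simp add: emeasure_circle_measure_UNIV)

interpretation circ: finite_measure circle_measure by (rule finite_measure_circle)

interpretation circ_pair: pair_sigma_finite circle_measure circle_measure ..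

lemma AE_circle_measure: "AE z in circle_measure. norm z = 1"
  unfolding circle_measure_def by (subst AE_distr_iff) (auto simp: pred_def)

lemma AE_circle_cis:
  assumes "AE z in circle_measure. P z"
  shows "AE t in density lborel (indicator {0..<1}). P (cis (2 * pi * t))"
  by (rule AE_distrD[OF _ assms[unfolded circle_measure_def]]) simp

lemma nn_integral_circle_rotate:
  assumes [measurable]: "F \<in> borel_measurable borel" and w: "norm w = 1"
  shows "(\<integral>\<^sup>+z. F (w * z) \<partial>circle_measure) = (\<integral>\<^sup>+z. F z \<partial>circle_measure)"
proof -
  define a where "a = Arg2pi w / (2 * pi)"
  have a: "0 \<le> a" "a < 1" using Arg2pi_ge_0[of w] Arg2pi_lt_2pi[of w] by (auto simp: a_def)
  have wa: "w = cis (2 * pi * a)" using Arg2pi_eq[of w] w by (simp add: a_def cis_conv_exp)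
  let ?F = "\<lambda>t. F (cis (2 * pi * t))"
  have per: "cis (2 * pi * (1 + t)) = cis (2 * pi * t)" for t
    by (simp add: distrib_left flip: cis_mult)
  have "(\<integral>\<^sup>+z. F (w * z) \<partial>circle_measure) = (\<integral>\<^sup>+t. ?F (a + t) * indicator {0..<1} t \<partial>lborel)"
    by (subst nn_integral_circle_measure) (auto simp: wa cis_mult distrib_left)
  also have "\<dots> = (\<integral>\<^sup>+t. ?F t * indicator {a..<1 + a} t \<partial>lborel)"
    by (subst (2) nn_integral_real_affine[where c=1 and t=a]) (auto intro!: nn_integral_cong split: split_indicator)
  also have "\<dots> = (\<integral>\<^sup>+t. ?F t * indicator {a..<1} t + ?F t * indicator {1..<1 + a} t \<partial>lborel)"
    using a by (intro nn_integral_cong) (auto split: split_indicator)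
  also have "\<dots> = (\<integral>\<^sup>+t. ?F t * indicator {a..<1} t \<partial>lborel) + (\<integral>\<^sup>+t. ?F t * indicator {1..<1 + a} t \<partial>lborel)"
    by (rule nn_integral_add) auto
  also have "(\<integral>\<^sup>+t. ?F t * indicator {1..<1 + a} t \<partial>lborel) = (\<integral>\<^sup>+t. ?F t * indicator {0..<a} t \<partial>lborel)"
    by (subst nn_integral_real_affine[where c=1 and t=1])
       (auto intro!: nn_integral_cong split: split_indicator simp: per)
  also have "(\<integral>\<^sup>+t. ?F t * indicator {a..<1} t \<partial>lborel) + (\<integral>\<^sup>+t. ?F t * indicator {0..<a} t \<partial>lborel)
     = (\<integral>\<^sup>+t. ?F t * indicator {a..<1} t + ?F t * indicator {0..<a} t \<partial>lborel)"
    by (rule nn_integral_add[symmetric]) auto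
  also have "\<dots> = (\<integral>\<^sup>+t. ?F t * indicator {0..<1} t \<partial>lborel)"
    using a by (intro nn_integral_cong) (auto split: split_indicator)
  also have "\<dots> = (\<integral>\<^sup>+z. F z \<partial>circle_measure)"
    by (simp add: nn_integral_circle_measure)
  finally show ?thesis .
qed

lemma distr_rotate_circle:
  assumes "norm w = 1"
  shows "distr circle_measure circle_measure (\<lambda>z. w * z) = circle_measure"
proof (rule measure_eqI)
  fix X assume "X \<in> sets (distr circle_measure circle_measure (\<lambda>z. w * z))"
  then have [measurable]: "X \<in> sets borel" by simp
  show "emeasure (distr circle_measure circle_measure (\<lambda>z. w * z)) X = emeasure circle_measure X"
    using nn_integral_circle_rotate[of "indicator X" w] assms
      nn_integral_distr[of "\<lambda>z. w * z" circle_measure circle_measure "indicator X"] by simp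
qed simp

definition torus_measure :: "(complex \<times> complex) measure" where
  "torus_measure = circle_measure \<Otimes>\<^sub>M circle_measure"

definition torus :: "(complex \<times> complex) set" where
  "torus = sphere 0 1 \<times> sphere 0 1"

lemma mem_torus: "z \<in> torus \<longleftrightarrow> norm (fst z) = 1 \<and> norm (snd z) = 1"
  by (cases z) (auto simp: torus_def)

lemma compact_torus: "compact torus"
  unfolding torus_def by (intro compact_Times compact_sphere)

lemma sets_torus_measure [simp, measurable_cong]: "sets torus_measure = sets borel"
proof -
  have "sets torus_measure = sets (borel \<Otimes>\<^sub>M borel :: (complex \<times> complex) measure)"
    unfolding torus_measure_def by (rule sets_pair_measure_cong) simp_all
  then show ?thesis by (simp only: borel_prod)
qed

lemma space_torus_measure [simp]: "space torus_measure = UNIV"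
  by (simp add: torus_measure_def space_pair_measure)

lemma emeasure_torus_measure_UNIV: "emeasure torus_measure UNIV = 1"
  using circ.emeasure_pair_measure_Times[of UNIV circle_measure UNIV]
  by (simp add: torus_measure_def emeasure_circle_measure_UNIV)

lemma finite_measure_torus: "finite_measure torus_measure"
  by standard (simp add: emeasure_torus_measure_UNIV)

interpretation tor: finite_measure torus_measure by (rule finite_measure_torus)

lemma measure_torus_UNIV [simp]: "measure torus_measure UNIV = 1"
  by (simp add: measure_def emeasure_torus_measure_UNIV)

lemma torus_sets [measurable]: "torus \<in> sets borel"
  by (simp add: compact_torus borel_compact)

lemma AE_torus: "AE z in torus_measure. z \<in> torus"
proof -
  have "AE x in circle_measure. AE y in circle_measure. (x, y) \<in> torus"
    using AE_circle_measure by eventually_elim (use AE_circle_measure in \<open>auto simp: mem_torus\<close>)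
  moreover have "torus \<in> sets torus_measure" by simp
  ultimately show ?thesis
    unfolding torus_measure_def by (intro circ_pair.AE_pair_measure) (auto simp: space_pair_measure)
qed

lemma distr_rotate_torus:
  assumes "norm w1 = 1" "norm w2 = 1"
  shows "distr torus_measure torus_measure (\<lambda>z. (w1 * fst z, w2 * snd z)) = torus_measure"
  unfolding torus_measure_def
  by (rule distr_rotate_pair) (use assms distr_rotate_circle in \<open>auto intro: circ.sigma_finite_measure_axioms\<close>)

lemma measurable_rotate [measurable]: "(\<lambda>z. (w1 * fst z, w2 * snd z :: complex)) \<in> borel \<rightarrow>\<^sub>M borel" for w1 :: complex
  by (intro borel_measurable_continuous_onI continuous_intros)

lemma integral_torus_rotate:
  fixes F :: "complex \<times> complex \<Rightarrow> complex"
  assumes [measurable]: "F \<in> borel_measurable borel" and "norm w1 = 1" "norm w2 = 1"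
  shows "(\<integral>z. F (w1 * fst z, w2 * snd z) \<partial>torus_measure) = (\<integral>z. F z \<partial>torus_measure)"
  using integral_distr[of "\<lambda>z. (w1 * fst z, w2 * snd z)" torus_measure torus_measure F]
    distr_rotate_torus[OF assms(2,3)] by (simp)

lemma integrable_torus_bounded:
  fixes F :: "complex \<times> complex \<Rightarrow> 'a :: {banach, second_countable_topology}"
  assumes [measurable]: "F \<in> borel_measurable borel" and "\<And>z. z \<in> torus \<Longrightarrow> norm (F z) \<le> C"
  shows "integrable torus_measure F"
  by (rule tor.integrable_const_bound[where B=C])
     (use AE_torus assms in \<open>auto elim!: eventually_mono\<close>)

lemma borel_measurable_powi [measurable]: "(\<lambda>z::complex. z powi k) \<in> borel_measurable borel"
  by (simp add: power_int_def)

definition zmonom :: "int \<times> int \<Rightarrow> complex \<times> complex \<Rightarrow> complex" where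
  "zmonom \<alpha> z = fst z powi fst \<alpha> * snd z powi snd \<alpha>"

lemma zmonom_measurable [measurable]: "zmonom \<alpha> \<in> borel_measurable borel"
  unfolding zmonom_def borel_prod[symmetric] by measurable

lemma norm_zmonom_torus: "z \<in> torus \<Longrightarrow> norm (zmonom \<alpha> z) = 1"
  by (simp add: zmonom_def mem_torus norm_mult norm_power_int)

lemma zmonom_mult: "zmonom \<alpha> (z1 * w1, z2 * w2) = zmonom \<alpha> (z1, z2) * zmonom \<alpha> (w1, w2)"
  by (simp add: zmonom_def power_int_mult_distrib)

text \<open>
  A rotation by \<open>w\<close> multiplies the integral by \<open>w\<close> to the power \<open>\<alpha>\<close>, and for \<open>\<alpha> \<noteq> 0\<close> some \<open>w\<close> makes this
  factor different from 1.
\<close>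

lemma integral_torus_zmonom:
  "(\<integral>z. zmonom \<alpha> z \<partial>torus_measure) = (if \<alpha> = (0, 0) then 1 else 0)"
proof (cases "\<alpha> = (0, 0)")
  case True
  then show ?thesis by (simp add: zmonom_def)
next
  case False
  have ex: "\<exists>w::complex. norm w = 1 \<and> w powi k \<noteq> 1" if "k \<noteq> 0" for k :: int
  proof (intro exI conjI)
    have "cis (pi / of_int k) powi k = cis (of_int k * (pi / of_int k))"
      by (simp add: cis_power_int)
    then show "cis (pi / of_int k) powi k \<noteq> 1" using that by simp
  qed simp
  have "\<exists>w. w \<in> torus \<and> zmonom \<alpha> w \<noteq> 1"
  proof (cases "fst \<alpha> = 0")
    case True
    then obtain w :: complex where "norm w = 1" "w powi snd \<alpha> \<noteq> 1" using ex[of "snd \<alpha>"] False by (cases \<alpha>) auto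
    then show ?thesis using True by (intro exI[of _ "(1, w)"]) (auto simp: mem_torus zmonom_def)
  next
    case False
    then obtain w :: complex where "norm w = 1" "w powi fst \<alpha> \<noteq> 1" using ex[of "fst \<alpha>"] by (cases \<alpha>) auto
    then show ?thesis by (intro exI[of _ "(w, 1)"]) (auto simp: mem_torus zmonom_def)
  qed
  then obtain w where w: "w \<in> torus" "zmonom \<alpha> w \<noteq> 1" by blast
  have "(\<integral>z. zmonom \<alpha> z \<partial>torus_measure) = (\<integral>z. zmonom \<alpha> (fst w * fst z, snd w * snd z) \<partial>torus_measure)"
    using w by (subst integral_torus_rotate) (auto simp: mem_torus)
  also have "\<dots> = zmonom \<alpha> w * (\<integral>z. zmonom \<alpha> z \<partial>torus_measure)"
    by (simp add: zmonom_mult)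
  finally show ?thesis using w False by simp
qed

lemma zmonom_add: "z \<in> torus \<Longrightarrow> zmonom (\<alpha> + \<beta>) z = zmonom \<alpha> z * zmonom \<beta> z"
  by (cases "fst z = 0 \<or> snd z = 0") (auto simp: mem_torus zmonom_def power_int_add)

lemma integral_torus_cong:
  fixes F :: "complex \<times> complex \<Rightarrow> complex"
  assumes "\<And>z. z \<in> torus \<Longrightarrow> F z = G z"
    and "F \<in> borel_measurable borel" "G \<in> borel_measurable borel"
  shows "(\<integral>z. F z \<partial>torus_measure) = (\<integral>z. G z \<partial>torus_measure)"
  by (rule integral_cong_AE) (use AE_torus assms in \<open>auto elim!: eventually_mono\<close>)

text \<open>
  Only the values on the torus matter, so that a real polynomial in the real and imaginary parts of
  the coordinates counts as a Laurent polynomial.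
\<close>

definition laurent_poly :: "(complex \<times> complex \<Rightarrow> complex) \<Rightarrow> bool" where
  "laurent_poly P \<longleftrightarrow> (\<exists>A c. finite A \<and> (\<forall>z\<in>torus. P z = (\<Sum>\<alpha>\<in>A. c \<alpha> * zmonom \<alpha> z)))"

lemma laurent_polyE:
  assumes "laurent_poly P"
  obtains A c where "finite A" "\<And>z. z \<in> torus \<Longrightarrow> P z = (\<Sum>\<alpha>\<in>A. c \<alpha> * zmonom \<alpha> z)"
  using assms unfolding laurent_poly_def by (elim exE conjE) (rule that, auto)

lemma laurent_polyI:
  assumes "finite A" "\<And>z. z \<in> torus \<Longrightarrow> P z = (\<Sum>\<alpha>\<in>A. c \<alpha> * zmonom \<alpha> z)"
  shows "laurent_poly P"
  unfolding laurent_poly_def by (intro exI[of _ A] exI[of _ c] conjI ballI assms)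

lemma laurent_poly_zmonom: "laurent_poly (\<lambda>z. c * zmonom \<alpha> z)"
  by (rule laurent_polyI[of "{\<alpha>}" _ "\<lambda>_. c"]) auto

lemma laurent_poly_add:
  assumes "laurent_poly P" "laurent_poly Q"
  shows "laurent_poly (\<lambda>z. P z + Q z)"
proof -
  obtain A c where A: "finite A" "\<And>z. z \<in> torus \<Longrightarrow> P z = (\<Sum>\<alpha>\<in>A. c \<alpha> * zmonom \<alpha> z)"
    by (rule laurent_polyE[OF assms(1)]) (rule that, auto)
  obtain B e where B: "finite B" "\<And>z. z \<in> torus \<Longrightarrow> Q z = (\<Sum>\<alpha>\<in>B. e \<alpha> * zmonom \<alpha> z)"
    by (rule laurent_polyE[OF assms(2)]) (rule that, auto)
  have "P z + Q z = (\<Sum>\<alpha>\<in>A \<union> B. ((if \<alpha> \<in> A then c \<alpha> else 0) + (if \<alpha> \<in> B then e \<alpha> else 0)) * zmonom \<alpha> z)"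
    if "z \<in> torus" for z
  proof -
    have "(\<Sum>\<alpha>\<in>A \<union> B. (if \<alpha> \<in> A then c \<alpha> else 0) * zmonom \<alpha> z) = (\<Sum>\<alpha>\<in>A. c \<alpha> * zmonom \<alpha> z)"
      using A(1) B(1) by (intro sum.mono_neutral_cong_right) auto
    moreover have "(\<Sum>\<alpha>\<in>A \<union> B. (if \<alpha> \<in> B then e \<alpha> else 0) * zmonom \<alpha> z) = (\<Sum>\<alpha>\<in>B. e \<alpha> * zmonom \<alpha> z)"
      using A(1) B(1) by (intro sum.mono_neutral_cong_right) auto
    ultimately show ?thesis using A B that by (simp add: distrib_right sum.distrib)
  qed
  then show ?thesis using A(1) B(1) by (intro laurent_polyI[of "A \<union> B"]) auto
qed

lemma laurent_poly_sum:
  assumes "finite X" "\<And>x. x \<in> X \<Longrightarrow> laurent_poly (P x)"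
  shows "laurent_poly (\<lambda>z. \<Sum>x\<in>X. P x z)"
  using assms
proof (induction X rule: finite_induct)
  case empty
  then show ?case using laurent_poly_zmonom[of 0 "(0,0)"] by simp
next
  case (insert x X)
  then show ?case by (simp add: laurent_poly_add)
qed

lemma laurent_poly_cong: "laurent_poly P \<Longrightarrow> (\<And>z. z \<in> torus \<Longrightarrow> Q z = P z) \<Longrightarrow> laurent_poly Q"
  by (erule laurent_polyE, rule laurent_polyI) auto

lemma laurent_poly_mult:
  assumes "laurent_poly P" "laurent_poly Q"
  shows "laurent_poly (\<lambda>z. P z * Q z)"
proof -
  obtain A c where A: "finite A" "\<And>z. z \<in> torus \<Longrightarrow> P z = (\<Sum>\<alpha>\<in>A. c \<alpha> * zmonom \<alpha> z)"
    by (rule laurent_polyE[OF assms(1)]) (rule that, auto)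
  obtain B e where B: "finite B" "\<And>z. z \<in> torus \<Longrightarrow> Q z = (\<Sum>\<alpha>\<in>B. e \<alpha> * zmonom \<alpha> z)"
    by (rule laurent_polyE[OF assms(2)]) (rule that, auto)
  have "laurent_poly (\<lambda>z. \<Sum>\<alpha>\<in>A. \<Sum>\<beta>\<in>B. (c \<alpha> * e \<beta>) * zmonom (\<alpha> + \<beta>) z)"
    by (intro laurent_poly_sum A B laurent_poly_zmonom)
  then show ?thesis
    by (rule laurent_poly_cong) (use A B in \<open>auto simp: sum_product zmonom_add mult_ac\<close>)
qed

text \<open>
  On the unit circle \<open>cnj z = inverse z\<close>, hence real and imaginary parts are combinations of \<open>z\<close> and
  \<open>inverse z\<close>.
\<close>

lemma laurent_poly_real_polynomial:
  assumes "real_polynomial_function P"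
  shows "laurent_poly (\<lambda>z. of_real (P z))"
  using assms
proof (induction rule: real_polynomial_function.induct)
  case (linear f)
  have base: "laurent_poly (\<lambda>z. ((of_real (f (1, 0)) * of_real (Re (fst z)) + of_real (f (\<i>, 0)) * of_real (Im (fst z)))
       + (of_real (f (0, 1)) * of_real (Re (snd z)) + of_real (f (0, \<i>)) * of_real (Im (snd z)))))"
  proof -
    have R: "laurent_poly (\<lambda>z. c * of_real (Re (fst z)))" "laurent_poly (\<lambda>z. c * of_real (Im (fst z)))"
            "laurent_poly (\<lambda>z. c * of_real (Re (snd z)))" "laurent_poly (\<lambda>z. c * of_real (Im (snd z)))" for c
    proof -
      have inv: "inverse w = cnj w" if "norm w = 1" for w :: complex
        using that complex_div_cnj[of 1 w] by (simp add: divide_inverse)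
      have m: "zmonom (-1, 0) z = cnj (fst z)" "zmonom (0, -1) z = cnj (snd z)"
        "zmonom (1, 0) z = fst z" "zmonom (0, 1) z = snd z" if "z \<in> torus" for z
        using that by (simp_all add: zmonom_def mem_torus inv power_int_minus)
      note lp = laurent_poly_add[OF laurent_poly_zmonom laurent_poly_zmonom]
      show "laurent_poly (\<lambda>z. c * of_real (Re (fst z)))"
        by (rule laurent_poly_cong[OF lp[of "c/2" "(1,0)" "c/2" "(-1,0)"]])
           (auto simp: m complex_eq_iff field_simps)
      show "laurent_poly (\<lambda>z. c * of_real (Re (snd z)))"
        by (rule laurent_poly_cong[OF lp[of "c/2" "(0,1)" "c/2" "(0,-1)"]])
           (auto simp: m complex_eq_iff field_simps)
      show "laurent_poly (\<lambda>z. c * of_real (Im (fst z)))"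
        by (rule laurent_poly_cong[OF lp[of "-\<i>*c/2" "(1,0)" "\<i>*c/2" "(-1,0)"]])
           (auto simp: m complex_eq_iff field_simps)
      show "laurent_poly (\<lambda>z. c * of_real (Im (snd z)))"
        by (rule laurent_poly_cong[OF lp[of "-\<i>*c/2" "(0,1)" "\<i>*c/2" "(0,-1)"]])
           (auto simp: m complex_eq_iff field_simps)
    qed
    show ?thesis by (intro laurent_poly_add R)
  qed
  have eq: "f z = (f (1, 0) * Re (fst z) + f (\<i>, 0) * Im (fst z)) + (f (0, 1) * Re (snd z) + f (0, \<i>) * Im (snd z))" for z
  proof -
    interpret bounded_linear f by (rule linear)
    have "z = (Re (fst z) *\<^sub>R (1, 0) + Im (fst z) *\<^sub>R (\<i>, 0)) + (Re (snd z) *\<^sub>R (0, 1) + Im (snd z) *\<^sub>R (0, \<i>))"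
      by (cases z) (auto simp: complex_eq_iff)
    then have "f z = f \<dots>" by simp
    then show ?thesis by (simp add: add scaleR del: scaleR_Pair)
  qed
  from base show ?case
    by (rule laurent_poly_cong) (subst eq, simp only: of_real_add of_real_mult)
next
  case (const c)
  then show ?case using laurent_poly_zmonom[of "of_real c" "(0,0)"] by (simp add: zmonom_def)
next
  case (add f g)
  then show ?case by (simp add: laurent_poly_add)
next
  case (mult f g)
  then show ?case by (simp add: laurent_poly_mult)
qed

lemma measurable_cnj [measurable]: "cnj \<in> borel_measurable borel"
  by (intro borel_measurable_continuous_onI continuous_intros)

text \<open>
  \<open>F\<close> is orthogonal to all Laurent polynomials, and these approximate \<open>cnj F\<close> uniformly by the
  Stone-Weierstrass theorem, so \<open>F\<close> is orthogonal to itself and vanishes almost everywhere. As the torus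
  measure charges every neighbourhood of a point of the torus, continuity gives \<open>F = 0\<close> there.
\<close>

lemma torus_fourier_unique:
  assumes [measurable]: "F \<in> borel_measurable borel" and cont: "continuous_on torus F"
    and zero: "\<And>\<alpha>. (\<integral>z. F z * zmonom \<alpha> z \<partial>torus_measure) = 0" and w: "w \<in> torus"
  shows "F w = 0"
proof -
  have cF: "compact (F ` torus)" by (intro compact_continuous_image cont compact_torus)
  then obtain C where C: "\<And>z. z \<in> torus \<Longrightarrow> norm (F z) \<le> C" "C > 0"
    using compact_imp_bounded[OF cF] bounded_pos[of "F ` torus"] by auto
  have poly0: "(\<integral>z. F z * P z \<partial>torus_measure) = 0" if lp: "laurent_poly P" and [measurable]: "P \<in> borel_measurable borel" for P
  proof -
    obtain A c where A: "finite A" "\<And>z. z \<in> torus \<Longrightarrow> P z = (\<Sum>\<alpha>\<in>A. c \<alpha> * zmonom \<alpha> z)"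
      by (rule laurent_polyE[OF lp]) (rule that, auto)
    have int: "integrable torus_measure (\<lambda>z. F z * zmonom \<alpha> z)" for \<alpha>
      by (rule integrable_torus_bounded[where C=C]) (auto simp: norm_mult norm_zmonom_torus C)
    have "(\<integral>z. F z * P z \<partial>torus_measure) = (\<integral>z. (\<Sum>\<alpha>\<in>A. c \<alpha> * (F z * zmonom \<alpha> z)) \<partial>torus_measure)"
      by (rule integral_torus_cong) (auto simp: A sum_distrib_left mult_ac)
    also have "\<dots> = (\<Sum>\<alpha>\<in>A. (\<integral>z. c \<alpha> * (F z * zmonom \<alpha> z) \<partial>torus_measure))"
      by (rule Bochner_Integration.integral_sum) (auto intro: int)
    also have "\<dots> = 0" by (simp add: zero)
    finally show ?thesis .
  qed
  have small: "(\<integral>z. (norm (F z))\<^sup>2 \<partial>torus_measure) \<le> e" if "e > 0" for e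
  proof -
    \<comment> \<open>Real and imaginary part each contribute an error of at most this size, and F is bounded by C.\<close>
    define \<delta> where "\<delta> = e / (2 * C)"
    have "\<delta> > 0" using that C by (simp add: \<delta>_def)
    obtain p where p: "real_polynomial_function p" "\<And>x. x \<in> torus \<Longrightarrow> \<bar>Re (F x) - p x\<bar> < \<delta>"
      using Stone_Weierstrass_real_polynomial_function[OF compact_torus, of "\<lambda>z. Re (F z)" \<delta>] cont \<open>\<delta> > 0\<close>
      by (auto intro: continuous_intros)
    obtain q where q: "real_polynomial_function q" "\<And>x. x \<in> torus \<Longrightarrow> \<bar>Im (F x) - q x\<bar> < \<delta>"
      using Stone_Weierstrass_real_polynomial_function[OF compact_torus, of "\<lambda>z. Im (F z)" \<delta>] cont \<open>\<delta> > 0\<close>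
      by (auto intro: continuous_intros)
    have [measurable]: "p \<in> borel_measurable borel" "q \<in> borel_measurable borel"
      using p(1) q(1) by (auto intro!: borel_measurable_continuous_onI continuous_on_polymonial_function simp flip: real_polynomial_function_eq)
    define P where "P z = of_real (p z) - \<i> * of_real (q z)" for z
    have [measurable]: "P \<in> borel_measurable borel" unfolding P_def by measurable
    have lp: "laurent_poly P"
    proof -
      have "laurent_poly (\<lambda>z. of_real (p z) + (\<lambda>z. - \<i> * zmonom (0,0) z) z * of_real (q z))"
        by (intro laurent_poly_add laurent_poly_mult laurent_poly_zmonom laurent_poly_real_polynomial p q)
      then show ?thesis by (rule laurent_poly_cong) (simp add: P_def zmonom_def)
    qed
    have near: "norm (cnj (F z) - P z) \<le> 2 * \<delta>" if "z \<in> torus" for z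
    proof -
      have "cnj (F z) - P z = Complex (Re (F z) - p z) (- (Im (F z) - q z))"
        by (simp add: P_def complex_eq_iff)
      also have "norm \<dots> \<le> \<bar>Re (F z) - p z\<bar> + \<bar>- (Im (F z) - q z)\<bar>"
        using cmod_le[of "Complex (Re (F z) - p z) (- (Im (F z) - q z))"] by simp
      finally show ?thesis using p(2)[OF that] q(2)[OF that] by simp
    qed
    have b: "norm (F z * (cnj (F z) - P z)) \<le> e" if "z \<in> torus" for z
    proof -
      have "norm (F z) * norm (cnj (F z) - P z) \<le> C * (2 * \<delta>)"
        using that C near by (intro mult_mono) auto
      then show ?thesis using C by (simp add: norm_mult \<delta>_def)
    qed
    have CP: "norm (P z) \<le> C + 2 * \<delta>" if "z \<in> torus" for z
      using near[OF that] C(1)[OF that] norm_triangle_ineq2[of "P z" "cnj (F z)"]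
      by (simp add: norm_minus_commute)
    have "(\<integral>z. complex_of_real ((norm (F z))\<^sup>2) \<partial>torus_measure) = (\<integral>z. F z * (cnj (F z) - P z) + F z * P z \<partial>torus_measure)"
      by (rule Bochner_Integration.integral_cong) (simp_all only: complex_norm_square right_diff_distrib diff_add_cancel)
    also have "\<dots> = (\<integral>z. F z * (cnj (F z) - P z) \<partial>torus_measure) + (\<integral>z. F z * P z \<partial>torus_measure)"
    proof (rule Bochner_Integration.integral_add)
      show "integrable torus_measure (\<lambda>z. F z * (cnj (F z) - P z))"
        by (rule integrable_torus_bounded[where C=e]) (use b in auto)
      show "integrable torus_measure (\<lambda>z. F z * P z)"
        by (rule integrable_torus_bounded[where C="C * (C + 2 * \<delta>)"]) (use C CP in \<open>auto simp: norm_mult intro!: mult_mono\<close>)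
    qed
    also have "\<dots> = (\<integral>z. F z * (cnj (F z) - P z) \<partial>torus_measure)"
      using poly0[OF lp] by simp
    finally have "complex_of_real (\<integral>z. (norm (F z))\<^sup>2 \<partial>torus_measure) = (\<integral>z. F z * (cnj (F z) - P z) \<partial>torus_measure)"
      unfolding integral_complex_of_real .
    then have "norm (complex_of_real (\<integral>z. (norm (F z))\<^sup>2 \<partial>torus_measure)) = norm (\<integral>z. F z * (cnj (F z) - P z) \<partial>torus_measure)"
      by (simp only:)
    also have "\<dots> \<le> (\<integral>z. norm (F z * (cnj (F z) - P z)) \<partial>torus_measure)" by (rule integral_norm_bound)
    also have "\<dots> \<le> (\<integral>z. e \<partial>torus_measure)"
      by (rule integral_mono_AE)
         (use AE_torus b in \<open>auto intro!: integrable_torus_bounded[where C=e] elim!: eventually_mono\<close>)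
    finally show ?thesis by (simp add: abs_le_iff)
  qed
  have int2: "integrable torus_measure (\<lambda>z. (norm (F z))\<^sup>2)"
    by (rule integrable_torus_bounded[where C="C\<^sup>2"]) (use C in \<open>auto intro: power_mono\<close>)
  have "(\<integral>z. (norm (F z))\<^sup>2 \<partial>torus_measure) = 0"
  proof (rule antisym)
    show "(\<integral>z. (norm (F z))\<^sup>2 \<partial>torus_measure) \<le> 0"
      by (rule field_le_epsilon) (use small in auto)
  qed simp
  then have "AE z in torus_measure. F z = 0"
    using integral_nonneg_eq_0_iff_AE[OF int2] by simp
  then have ae: "AE z in torus_measure. F (fst w * fst z, snd w * snd z) = 0"
  proof -
    have d: "distr torus_measure torus_measure (\<lambda>z. (fst w * fst z, snd w * snd z)) = torus_measure"
      using w by (intro distr_rotate_torus) (auto simp: mem_torus)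
    show ?thesis
      by (rule AE_distrD[where M'=torus_measure]) (simp, subst d, fact)
  qed
  show ?thesis
  proof (rule ccontr)
    assume nz: "F w \<noteq> 0"
    \<comment> \<open>Angular coordinates based at the point of interest; the origin is a corner of the parameter square.\<close>
    define G where "G s = F (fst w * cis (2 * pi * fst s), snd w * cis (2 * pi * snd s))" for s :: "real \<times> real"
    have cG: "continuous_on UNIV G"
      unfolding G_def
      by (rule continuous_on_compose2[OF cont])
         (use w in \<open>auto intro!: continuous_intros simp: mem_torus norm_mult\<close>)
    have "open (G -` (- {0}))" using cG by (intro open_vimage) auto
    moreover have "(0, 0) \<in> G -` (- {0})" using nz by (simp add: G_def)
    ultimately obtain V W where VW: "open V" "open W" "(0,0) \<in> V \<times> W" "V \<times> W \<subseteq> G -` (- {0})"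
      by (rule open_prod_elim)
    let ?C = "density lborel (indicator {0..<1}) :: real measure"
    have [measurable_cong]: "sets ?C = sets borel" by simp
    have pos: "emeasure ?C V > 0" if oV: "open V" "0 \<in> V" for V :: "real set"
    proof -
      obtain e where e: "e > 0" "ball 0 e \<subseteq> V" using openE[OF oV] by blast
      have "ennreal (min e 1) = emeasure lborel {0..<min e 1}" using e by simp
      also have "\<dots> = (\<integral>\<^sup>+x. indicator {0..<min e 1} x \<partial>lborel)" by simp
      also have "\<dots> \<le> (\<integral>\<^sup>+x. indicator {0..<1} x * indicator V x \<partial>lborel)"
        using e by (intro nn_integral_mono) (auto split: split_indicator simp: subset_iff dist_real_def)
      also have "\<dots> = emeasure ?C V" using that by (subst emeasure_density) auto
      finally show ?thesis using e by (metis ennreal_le_epsilon ennreal_less_zero_iff less_le_trans min_less_iff_conj zero_less_one)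
    qed
    have "AE x in circle_measure. AE y in circle_measure. F (fst w * x, snd w * y) = 0"
      using circ_pair.AE_pair[of "\<lambda>z. F (fst w * fst z, snd w * snd z) = 0"] ae[unfolded torus_measure_def]
      by simp
    then have "AE x in circle_measure. AE y in ?C. F (fst w * x, snd w * cis (2 * pi * y)) = 0"
      by eventually_elim (rule AE_circle_cis)
    then have "AE x in ?C. AE y in ?C. F (fst w * cis (2 * pi * x), snd w * cis (2 * pi * y)) = 0"
      by (rule AE_circle_cis)
    then have "AE x in ?C. AE y in ?C. G (x, y) = 0"
      by (simp add: G_def)
    moreover have "emeasure ?C W > 0" using pos VW by auto
    then have "\<not> (AE y in ?C. G (x, y) = 0)" if "x \<in> V" for x
    proof -
      have "\<not> (AE y in ?C. y \<notin> W)"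
        using \<open>emeasure ?C W > 0\<close> VW(2) by (subst AE_iff_measurable[of W]) auto
      then show ?thesis using VW(4) that by (auto elim!: eventually_mono contrapos_nn)
    qed
    ultimately have "AE x in ?C. x \<notin> V" by (auto elim!: eventually_mono)
    then show False
      using pos[of V] VW by (subst (asm) AE_iff_measurable[of V]) auto
  qed
qed

text \<open>
  The average of \<open>h\<close> over the circle of radius \<open>r\<close> is the contour integral of \<open>h z / z\<close> up to a constant,
  and concentric circles are homotopic in the punctured disc. \<open>H\<close> is a globally Borel measurable
  function that agrees with \<open>h\<close> where it matters.
\<close>

lemma circle_average_radius:
  assumes hol: "h holomorphic_on (ball 0 R - {0})" and R: "1 < R" and \<rho>: "0 < \<rho>" "\<rho> < R"
    and [measurable]: "H \<in> borel_measurable borel" and H: "\<And>z. z \<in> ball 0 R - {0} \<Longrightarrow> H z = h z"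
  shows "(\<integral>z. H (of_real \<rho> * z) \<partial>circle_measure) = (\<integral>z. H z \<partial>circle_measure)"
proof -
  have main: "(\<integral>z. H (of_real r * z) \<partial>circle_measure)
      = contour_integral (circlepath 0 r) (\<lambda>z. h z / z) / (2 * of_real pi * \<i>)" if r: "0 < r" "r < R" for r
  proof -
    have cont: "continuous_on {0..1} (\<lambda>t. h (of_real r * cis (2 * pi * t)))"
      by (rule continuous_on_compose2[OF holomorphic_on_imp_continuous_on[OF hol]])
         (use r in \<open>auto intro!: continuous_intros simp: norm_mult\<close>)
    have "(\<integral>z. H (of_real r * z) \<partial>circle_measure) = (\<integral>t. indicator {0..<1} t *\<^sub>R H (of_real r * cis (2 * pi * t)) \<partial>lborel)"
    proof -
      have "(\<integral>z. H (of_real r * z) \<partial>circle_measure) = (\<integral>t. H (of_real r * cis (2 * pi * t)) \<partial>density lborel (\<lambda>t. ennreal (indicator {0..<1} t)))"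
        unfolding circle_measure_def ennreal_indicator by (rule integral_distr) auto
      also have "\<dots> = (\<integral>t. indicator {0..<1} t *\<^sub>R H (of_real r * cis (2 * pi * t)) \<partial>lborel)"
        by (rule integral_density) auto
      finally show ?thesis .
    qed
    also have "\<dots> = (\<integral>t. indicator {0..1} t *\<^sub>R h (of_real r * cis (2 * pi * t)) \<partial>lborel)"
    proof (rule integral_cong_AE)
      show "AE t in lborel. indicator {0..<1} t *\<^sub>R H (of_real r * cis (2 * pi * t)) = indicator {0..1} t *\<^sub>R h (of_real r * cis (2 * pi * t))"
        using AE_lborel_singleton[of "1::real"] by eventually_elim (use r in \<open>auto simp: H norm_mult split: split_indicator\<close>)
      show "(\<lambda>t. indicator {0..1} t *\<^sub>R h (of_real r * cis (2 * pi * t))) \<in> borel_measurable lborel"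
        using borel_measurable_continuous_on_indicator[OF _ cont] by simp
    qed simp
    also have "\<dots> = integral {0..1} (\<lambda>t. h (of_real r * cis (2 * pi * t)))"
      using set_borel_integral_eq_integral(2)[OF borel_integrable_atLeastAtMost'[OF cont]]
      by (simp add: set_lebesgue_integral_def)
    finally have 1: "(\<integral>z. H (of_real r * z) \<partial>circle_measure) = integral {0..1} (\<lambda>t. h (of_real r * cis (2 * pi * t)))" .
    have "contour_integral (circlepath 0 r) (\<lambda>z. h z / z) = integral {0..1} (\<lambda>t. 2 * of_real pi * \<i> * h (of_real r * cis (2 * pi * t)))"
      unfolding contour_integral_integral
      by (rule integral_cong)
         (simp only: vector_derivative_circlepath, use r in \<open>simp add: circlepath cis_conv_exp mult_ac\<close>)
    also have "\<dots> = 2 * of_real pi * \<i> * integral {0..1} (\<lambda>t. h (of_real r * cis (2 * pi * t)))"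
      by simp
    finally show ?thesis using 1 by simp
  qed
  have "contour_integral (circlepath 0 \<rho>) (\<lambda>z. h z / z) = contour_integral (circlepath 0 1) (\<lambda>z. h z / z)"
  proof (rule Cauchy_theorem_homotopic_loops)
    show "homotopic_loops (ball 0 R - {0}) (circlepath 0 \<rho>) (circlepath 0 1)"
    proof (rule homotopic_loops_linear)
      fix t :: real
      have e: "circlepath 0 r t = of_real r * cis (2 * pi * t)" for r
        by (simp add: circlepath cis_conv_exp mult_ac)
      show "closed_segment (circlepath 0 \<rho> t) (circlepath 0 1 t) \<subseteq> ball 0 R - {0}"
      proof
        fix x assume "x \<in> closed_segment (circlepath 0 \<rho> t) (circlepath 0 1 t)"
        then obtain u where u: "0 \<le> u" "u \<le> 1" "x = (1 - u) *\<^sub>R (of_real \<rho> * cis (2 * pi * t)) + u *\<^sub>R (1 * cis (2 * pi * t))"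
          by (auto simp: closed_segment_def e)
        then have x: "x = of_real ((1 - u) * \<rho> + u) * cis (2 * pi * t)"
          by (simp add: scaleR_conv_of_real algebra_simps)
        have "0 < (1 - u) * \<rho> + u" "(1 - u) * \<rho> + u < R"
          using u \<rho> R convex_bound_lt[of \<rho> R 1 "1 - u" u]
          by (auto intro: add_nonneg_pos add_pos_nonneg simp: le_less)
        then show "x \<in> ball 0 R - {0}" by (simp add: x norm_mult del: of_real_add of_real_mult)
      qed
    qed auto
    show "(\<lambda>z. h z / z) holomorphic_on (ball 0 R - {0})"
      by (intro holomorphic_intros hol) auto
  qed auto
  then show ?thesis using main[OF \<rho>] main[of 1] R by simp
qed

section \<open>The weighted lattice sum in closed form\<close>

text \<open>
  The domain attached to the matrix \<open>A\<close> with rows \<open>(p, q)\<close> and \<open>(r, s)\<close>. Its defining inequalities are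
  written with natural exponents on both sides, which takes care of the points with a vanishing
  coordinate: if \<open>q > 0\<close>, then \<open>snd z = 0\<close> violates the first inequality.
\<close>

locale monomial_domain =
  fixes p q r s :: nat
  assumes det_pos: "q * r < p * s"
begin

definition d :: int where "d = int p * int s - int q * int r"

definition U :: "(complex \<times> complex) set" where
  "U = {z. norm (fst z) ^ s < norm (snd z) ^ q \<and> norm (snd z) ^ p < norm (fst z) ^ r}"

text \<open>
  The pair \<open>(deg1 \<alpha>, deg2 \<alpha>)\<close> is the row vector \<open>\<alpha> + (1, 1)\<close> multiplied by \<open>A\<close>; the shift by \<open>(1, 1)\<close> comes
  from the area element.
\<close>

definition deg1 :: "int \<times> int \<Rightarrow> int" where "deg1 \<alpha> = (fst \<alpha> + 1) * int p + (snd \<alpha> + 1) * int r"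
definition deg2 :: "int \<times> int \<Rightarrow> int" where "deg2 \<alpha> = (fst \<alpha> + 1) * int q + (snd \<alpha> + 1) * int s"

text \<open>
  These will turn out to be the exponents of the square integrable monomials.
\<close>

definition I :: "(int \<times> int) set" where "I = {\<alpha>. 0 < deg1 \<alpha> \<and> 0 < deg2 \<alpha>}"

lemma d_pos: "d > 0"
  using det_pos unfolding d_def by (simp flip: of_nat_mult)

lemma p_pos: "p > 0" and s_pos: "s > 0"
  using det_pos by (auto intro: Nat.gr0I)

lemma open_U: "open U"
  unfolding U_def by (intro open_Collect_conj open_Collect_less continuous_intros)

lemma U_borel [measurable]: "U \<in> sets borel"
  using open_U by simp

lemma torus_U_iff: "\<zeta> \<in> torus \<Longrightarrow> (fst \<zeta> * fst z, snd \<zeta> * snd z) \<in> U \<longleftrightarrow> z \<in> U"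
  by (auto simp: U_def mem_torus norm_mult)

lemma torus_U: "\<zeta> \<in> torus \<Longrightarrow> z \<in> U \<Longrightarrow> (fst \<zeta> * fst z, snd \<zeta> * snd z) \<in> U"
  by (simp add: torus_U_iff)

lemma zero_U1: "z \<in> U \<Longrightarrow> fst z = 0 \<Longrightarrow> r = 0"
  using zero_le_power[of "norm (snd z)" p] by (cases "r = 0") (auto simp: U_def zero_power simp del: zero_le_power)

lemma zero_U2: "z \<in> U \<Longrightarrow> snd z = 0 \<Longrightarrow> q = 0"
  using zero_le_power[of "norm (fst z)" s] by (cases "q = 0") (auto simp: U_def zero_power simp del: zero_le_power)

lemma deg1_pos_nonneg: "r = 0 \<Longrightarrow> 0 < deg1 \<alpha> \<Longrightarrow> 0 \<le> fst \<alpha>"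
  using zero_less_mult_pos2[of "fst \<alpha> + 1" "int p"] p_pos unfolding deg1_def by simp

lemma deg2_pos_nonneg: "q = 0 \<Longrightarrow> 0 < deg2 \<alpha> \<Longrightarrow> 0 \<le> snd \<alpha>"
  using zero_less_mult_pos2[of "snd \<alpha> + 1" "int s"] s_pos unfolding deg2_def by simp

lemma I_nonneg1: "z \<in> U \<Longrightarrow> fst z = 0 \<Longrightarrow> \<alpha> \<in> I \<Longrightarrow> 0 \<le> fst \<alpha>"
  by (rule deg1_pos_nonneg[OF zero_U1]) (simp_all add: I_def)

lemma I_nonneg2: "z \<in> U \<Longrightarrow> snd z = 0 \<Longrightarrow> \<alpha> \<in> I \<Longrightarrow> 0 \<le> snd \<alpha>"
  by (rule deg2_pos_nonneg[OF zero_U2]) (simp_all add: I_def)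

lemma inj_deg: "inj (\<lambda>\<alpha>. (deg1 \<alpha>, deg2 \<alpha>))"
proof (rule injI)
  fix \<alpha> \<beta> assume "(deg1 \<alpha>, deg2 \<alpha>) = (deg1 \<beta>, deg2 \<beta>)"
  then have e: "(fst \<alpha> - fst \<beta>) * int p + (snd \<alpha> - snd \<beta>) * int r = 0"
               "(fst \<alpha> - fst \<beta>) * int q + (snd \<alpha> - snd \<beta>) * int s = 0"
    by (auto simp: deg1_def deg2_def algebra_simps)
  let ?x = "fst \<alpha> - fst \<beta>" and ?y = "snd \<alpha> - snd \<beta>"
  have "?x * d = (?x * int p + ?y * int r) * int s - (?x * int q + ?y * int s) * int r"
       "?y * d = (?x * int q + ?y * int s) * int p - (?x * int p + ?y * int r) * int q"
    unfolding d_def by (simp_all add: algebra_simps)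
  then have "?x * d = 0" "?y * d = 0" unfolding e by simp_all
  then show "\<alpha> = \<beta>" using d_pos by (auto simp: prod_eq_iff)
qed

text \<open>
  Negative powers of a vanishing coordinate do not behave like powers (\<open>0 powi - 1 = 0\<close>), so where a
  coordinate of \<open>t\<close> vanishes only coefficient families without negative exponents may be shifted.
\<close>

definition supp_ok :: "complex \<times> complex \<Rightarrow> (int \<times> int \<Rightarrow> int) \<Rightarrow> bool" where
  "supp_ok t a \<longleftrightarrow> (\<forall>\<alpha>. a \<alpha> \<noteq> 0 \<longrightarrow> (fst t = 0 \<longrightarrow> 0 \<le> fst \<alpha>) \<and> (snd t = 0 \<longrightarrow> 0 \<le> snd \<alpha>))"

lemma powi_add_nat: "z \<noteq> 0 \<or> 0 \<le> k \<Longrightarrow> z powi (k + int n) = z powi k * (z :: complex) ^ n"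
  by (cases "z = 0") (auto simp: power_int_add power_int_0_left_if)

lemma has_sum_shift:
  assumes S: "((\<lambda>\<alpha>. of_int (a \<alpha>) * zmonom \<alpha> t) has_sum S) UNIV" and ok: "supp_ok t a"
  shows "((\<lambda>\<alpha>. of_int (a (\<alpha> - (int k, int l))) * zmonom \<alpha> t) has_sum (fst t ^ k * snd t ^ l * S)) UNIV"
proof -
  have "((\<lambda>\<alpha>. fst t ^ k * snd t ^ l * (of_int (a \<alpha>) * zmonom \<alpha> t)) has_sum (fst t ^ k * snd t ^ l * S)) UNIV"
    by (rule has_sum_cmult_right[OF S])
  also have "(\<lambda>\<alpha>. fst t ^ k * snd t ^ l * (of_int (a \<alpha>) * zmonom \<alpha> t))
      = (\<lambda>\<alpha>. of_int (a \<alpha>) * zmonom (\<alpha> + (int k, int l)) t)"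
  proof
    fix \<alpha>
    show "fst t ^ k * snd t ^ l * (of_int (a \<alpha>) * zmonom \<alpha> t) = of_int (a \<alpha>) * zmonom (\<alpha> + (int k, int l)) t"
    proof (cases "a \<alpha> = 0")
      case False
      then have "fst t \<noteq> 0 \<or> 0 \<le> fst \<alpha>" "snd t \<noteq> 0 \<or> 0 \<le> snd \<alpha>" using ok unfolding supp_ok_def by blast+
      then show ?thesis by (simp add: zmonom_def powi_add_nat)
    qed simp
  qed
  finally show ?thesis
    by (subst has_sum_reindex_bij_witness[where i="\<lambda>\<alpha>. \<alpha> + (int k, int l)" and j="\<lambda>\<alpha>. \<alpha> - (int k, int l)"
         and h="\<lambda>\<alpha>. of_int (a \<alpha>) * zmonom (\<alpha> + (int k, int l)) t" and T=UNIV]) auto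
qed

definition diff_op :: "int \<times> int \<Rightarrow> int \<times> int \<Rightarrow> (int \<times> int \<Rightarrow> int) \<Rightarrow> int \<times> int \<Rightarrow> int" where
  "diff_op \<delta> \<delta>' a \<alpha> = a (\<alpha> - \<delta>) - a (\<alpha> - \<delta>')"

lemma supp_ok_diff: "supp_ok t a \<Longrightarrow> supp_ok t (diff_op (int k, int l) (int k', int l') a)"
  unfolding supp_ok_def diff_op_def
  by (smt (verit) fst_diff snd_diff fst_conv snd_conv of_nat_0_le_iff)

lemma has_sum_diff_op:
  assumes "((\<lambda>\<alpha>. of_int (a \<alpha>) * zmonom \<alpha> t) has_sum S) UNIV" and "supp_ok t a"
  shows "((\<lambda>\<alpha>. of_int (diff_op (int k, int l) (int k', int l') a \<alpha>) * zmonom \<alpha> t)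
     has_sum ((fst t ^ k * snd t ^ l - fst t ^ k' * snd t ^ l') * S)) UNIV"
proof -
  have "((\<lambda>\<alpha>. of_int (a (\<alpha> - (int k, int l))) * zmonom \<alpha> t - of_int (a (\<alpha> - (int k', int l'))) * zmonom \<alpha> t)
     has_sum (fst t ^ k * snd t ^ l * S - fst t ^ k' * snd t ^ l' * S)) UNIV"
    using has_sum_add[OF has_sum_shift[OF assms, of k l] has_sum_uminusI[OF has_sum_shift[OF assms, of k' l']]]
    by simp
  then show ?thesis by (simp add: diff_op_def algebra_simps)
qed

text \<open>
  The positive parts extend the numerators \<open>deg1 \<alpha> * deg2 \<alpha>\<close> from \<open>I\<close> to all of \<open>\<int>\<^sup>2\<close>, which makes the whole
  kernel series accessible to difference operators.
\<close>

definition weight :: "int \<times> int \<Rightarrow> int" where "weight \<alpha> = max 0 (deg1 \<alpha>) * max 0 (deg2 \<alpha>)"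

definition gcoef :: "int \<times> int \<Rightarrow> int" where
  "gcoef \<gamma> = coeffD d (deg1 \<gamma> - 2 * int q * int r - 2 * int p * int r - 1) *
            coeffD d (deg2 \<gamma> - 2 * int q * int r - 2 * int q * int s - 1)"

lemma tent: "max 0 x - 2 * max 0 (x - d) + max 0 (x - 2 * d) = coeffD d (x - 1)"
  using d_pos by (auto simp: coeffD_def max_def)

text \<open>
  The shifts by \<open>(0, q)\<close> and \<open>(s, 0)\<close> change \<open>deg2\<close> by the same amount and \<open>deg1\<close> by amounts that differ by
  \<open>d\<close>; for \<open>(r, 0)\<close> and \<open>(0, p)\<close> the roles are exchanged. The weight is a product of a function of \<open>deg1\<close>
  and one of \<open>deg2\<close>, so the four difference operators produce a product of two second differences with
  step \<open>d\<close> of the positive part, and such a second difference is the tent function \<open>coeffD d\<close>.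
\<close>

lemma diff_op_weight:
  "diff_op (int r, 0) (0, int p) (diff_op (int r, 0) (0, int p) (diff_op (0, int q) (int s, 0) (diff_op (0, int q) (int s, 0) weight))) \<gamma> = gcoef \<gamma>" (is "?L = _")
proof -
  let ?x = "deg1 \<gamma> - 2 * int q * int r - 2 * int p * int r"
  let ?y = "deg2 \<gamma> - 2 * int q * int r - 2 * int q * int s"
  have ps: "int p * int s = d + int q * int r" by (simp add: d_def)
  have 1: "deg1 (\<alpha> - (int s, 0)) = deg1 \<alpha> - int q * int r - d" "deg1 (\<alpha> - (0, int q)) = deg1 \<alpha> - int q * int r"
     "deg2 (\<alpha> - (int s, 0)) = deg2 \<alpha> - int q * int s" "deg2 (\<alpha> - (0, int q)) = deg2 \<alpha> - int q * int s"
     "deg1 (\<alpha> - (int r, 0)) = deg1 \<alpha> - int p * int r" "deg1 (\<alpha> - (0, int p)) = deg1 \<alpha> - int p * int r"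
     "deg2 (\<alpha> - (int r, 0)) = deg2 \<alpha> - int q * int r" "deg2 (\<alpha> - (0, int p)) = deg2 \<alpha> - int q * int r - d" for \<alpha>
    using ps by (auto simp: deg1_def deg2_def algebra_simps)
  have "?L
    = (max 0 ?x - 2 * max 0 (?x - d) + max 0 (?x - 2 * d)) * (max 0 ?y - 2 * max 0 (?y - d) + max 0 (?y - 2 * d))"
  proof -
    define X Y where "X = deg1 \<gamma>" and "Y = deg2 \<gamma>"
    define P :: "int \<Rightarrow> int" where "P = max 0"
    show ?thesis
      unfolding diff_op_def weight_def 1 X_def[symmetric] Y_def[symmetric] P_def[symmetric]
      by (simp add: algebra_simps)
  qed
  then show ?thesis by (simp add: tent gcoef_def)
qed

lemma supp_ok_weight: "t \<in> U \<Longrightarrow> supp_ok t weight"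
  unfolding supp_ok_def weight_def
  using zero_U1[of t] zero_U2[of t] deg1_pos_nonneg deg2_pos_nonneg
  by (metis max_def mult_zero_left mult_zero_right order.order_iff_strict not_le)

text \<open>
  A nonzero coefficient confines the degrees of the shifted exponent \<open>\<gamma> - (2 r, 2 q)\<close> to the open interval
  from 0 to \<open>2 d\<close>; inverting the
  matrix turns this into bounds for the exponents.
\<close>

lemma gcoef_nonzero:
  assumes "gcoef \<gamma> \<noteq> 0"
  shows "0 \<le> fst \<gamma>" "fst \<gamma> \<le> 2 * int r + 2 * int s - 2" "0 \<le> snd \<gamma>" "snd \<gamma> \<le> 2 * int p + 2 * int q - 2"
proof -
  define m where "m = deg1 \<gamma> - 2 * int q * int r - 2 * int p * int r"
  define n where "n = deg2 \<gamma> - 2 * int q * int r - 2 * int q * int s"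
  have "coeffD d (m - 1) \<noteq> 0" "coeffD d (n - 1) \<noteq> 0" using assms by (auto simp: gcoef_def m_def n_def)
  then have mn: "0 < m" "m < 2 * d" "0 < n" "n < 2 * d" using d_pos by (auto simp: coeffD_def split: if_splits)
  define x where "x = fst \<gamma> + 1 - 2 * int r"
  define y where "y = snd \<gamma> + 1 - 2 * int q"
  have m: "m = x * int p + y * int r" and n: "n = x * int q + y * int s"
    by (simp_all add: m_def n_def x_def y_def deg1_def deg2_def algebra_simps)
  have x: "x * d = m * int s - n * int r" and y: "y * d = n * int p - m * int q"
    by (simp_all add: m n d_def algebra_simps)
  have pos: "0 < int p" "0 < int s" using p_pos s_pos by auto
  have "x * d < (2 * int s) * d"
  proof -
    have "m * int s < 2 * d * int s" using mn pos by simp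
    moreover have "0 \<le> n * int r" using mn by simp
    ultimately show ?thesis by (simp add: x mult_ac)
  qed
  then have x1: "x < 2 * int s" by (rule mult_right_less_imp_less) (use d_pos in simp)
  have "y * d < (2 * int p) * d"
  proof -
    have "n * int p < 2 * d * int p" using mn pos by simp
    moreover have "0 \<le> m * int q" using mn by simp
    ultimately show ?thesis by (simp add: y mult_ac)
  qed
  then have y1: "y < 2 * int p" by (rule mult_right_less_imp_less) (use d_pos in simp)
  have "(- 2 * int r) * d < x * d"
  proof -
    have "n * int r \<le> 2 * d * int r" using mn by (intro mult_right_mono) auto
    moreover have "0 < m * int s" using mn pos by simp
    ultimately show ?thesis by (simp add: x mult_ac)
  qed
  then have x2: "- 2 * int r < x" by (rule mult_right_less_imp_less) (use d_pos in simp)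
  have "(- 2 * int q) * d < y * d"
  proof -
    have "m * int q \<le> 2 * d * int q" using mn by (intro mult_right_mono) auto
    moreover have "0 < n * int p" using mn pos by simp
    ultimately show ?thesis by (simp add: y mult_ac)
  qed
  then have y2: "- 2 * int q < y" by (rule mult_right_less_imp_less) (use d_pos in simp)
  show "0 \<le> fst \<gamma>" "fst \<gamma> \<le> 2 * int r + 2 * int s - 2" "0 \<le> snd \<gamma>" "snd \<gamma> \<le> 2 * int p + 2 * int q - 2"
    using x1 x2 y1 y2 unfolding x_def y_def by linarith+
qed

definition gpoly :: "complex \<times> complex \<Rightarrow> complex" where
  "gpoly t = (\<Sum>\<gamma>\<in>{0..2 * int r + 2 * int s - 2} \<times> {0..2 * int p + 2 * int q - 2}. of_int (gcoef \<gamma>) * zmonom \<gamma> t)"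

lemma denominators_nonzero:
  assumes "t \<in> U"
  shows "snd t ^ q - fst t ^ s \<noteq> 0" "fst t ^ r - snd t ^ p \<noteq> 0"
  using assms by (auto simp: U_def simp flip: norm_power)

text \<open>
  Multiplication of the series by \<open>t\<^sub>2\<^sup>q - t\<^sub>1\<^sup>s\<close> acts on its coefficients as a difference operator, and
  likewise for the other factor; after both have been applied twice only finitely many coefficients
  are left.
\<close>

lemma weighted_series_closed_form:
  assumes S: "((\<lambda>\<alpha>. of_int (weight \<alpha>) * zmonom \<alpha> t) has_sum S) UNIV" and t: "t \<in> U"
  shows "S = gpoly t / ((snd t ^ q - fst t ^ s)\<^sup>2 * (fst t ^ r - snd t ^ p)\<^sup>2)"
proof -
  note ok = supp_ok_weight[OF t]
  note st = has_sum_diff_op[where k=0 and l=q and k'=s and l'=0] supp_ok_diff[where k=0 and l=q and k'=s and l'=0]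
  note st' = has_sum_diff_op[where k=r and l=0 and k'=0 and l'=p]
  have "((\<lambda>\<alpha>. of_int (gcoef \<alpha>) * zmonom \<alpha> t) has_sum
     ((fst t ^ r - snd t ^ p) * ((fst t ^ r - snd t ^ p) * ((snd t ^ q - fst t ^ s) * ((snd t ^ q - fst t ^ s) * S))))) UNIV"
    using st'[OF st'[OF st(1)[OF st(1)[OF S ok] st(2)[OF ok]] st(2)[OF st(2)[OF ok]]]
         supp_ok_diff[where k=r and l=0 and k'=0 and l'=p, OF st(2)[OF st(2)[OF ok]]]]
    by (simp add: diff_op_weight)
  moreover have "((\<lambda>\<alpha>. of_int (gcoef \<alpha>) * zmonom \<alpha> t) has_sum gpoly t) UNIV"
    unfolding gpoly_def
  proof (rule has_sum_finite_neutralI)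
    fix \<gamma> assume "\<gamma> \<in> UNIV - {0..2 * int r + 2 * int s - 2} \<times> {0..2 * int p + 2 * int q - 2}"
    then have "gcoef \<gamma> = 0" using gcoef_nonzero[of \<gamma>] by (auto simp: mem_Times_iff)
    then show "of_int (gcoef \<gamma>) * zmonom \<gamma> t = 0" by simp
  qed auto
  ultimately have "gpoly t = (fst t ^ r - snd t ^ p) * ((fst t ^ r - snd t ^ p) * ((snd t ^ q - fst t ^ s) * ((snd t ^ q - fst t ^ s) * S)))"
    by (rule has_sum_unique[rotated])
  then have "gpoly t = S * ((snd t ^ q - fst t ^ s)\<^sup>2 * (fst t ^ r - snd t ^ p)\<^sup>2)"
    by (simp add: power2_eq_square mult_ac)
  then show ?thesis using denominators_nonzero[OF t] by simp
qed

section \<open>Norms of monomials and convergence of Laurent series\<close>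

text \<open>
  In the coordinates \<open>- ln \<bar>z\<^sub>j\<bar>\<close> the domain is the open cone spanned by the columns of \<open>A\<close>.
\<close>

lemma U_iff_ln:
  assumes "fst z \<noteq> 0" "snd z \<noteq> 0"
  shows "z \<in> U \<longleftrightarrow> real q * (- ln (norm (snd z))) < real s * (- ln (norm (fst z))) \<and>
                  real r * (- ln (norm (fst z))) < real p * (- ln (norm (snd z)))"
proof -
  have pos: "norm (fst z) > 0" "norm (snd z) > 0" using assms by auto
  have "norm (fst z) ^ s < norm (snd z) ^ q \<longleftrightarrow> ln (norm (fst z) ^ s) < ln (norm (snd z) ^ q)"
       "norm (snd z) ^ p < norm (fst z) ^ r \<longleftrightarrow> ln (norm (snd z) ^ p) < ln (norm (fst z) ^ r)"
    using pos by (auto intro!: ln_less_cancel_iff[symmetric])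
  then show ?thesis using pos by (simp add: U_def ln_realpow)
qed

definition U' :: "(complex \<times> complex) set" where "U' = {z \<in> U. fst z \<noteq> 0 \<and> snd z \<noteq> 0}"

lemma log_coordinates:
  assumes "w \<in> U'"
  obtains u1 u2 :: real where "0 < u1" "0 < u2"
    "- ln (norm (fst w)) = real p * u1 + real q * u2" "- ln (norm (snd w)) = real r * u1 + real s * u2"
proof -
  define x1 x2 where "x1 = - ln (norm (fst w))" and "x2 = - ln (norm (snd w))"
  define u1 u2 where "u1 = (s * x1 - q * x2) / of_int d" and "u2 = (p * x2 - r * x1) / of_int d"
  have u: "u1 > 0" "u2 > 0"
    using U_iff_ln[of w] assms d_pos by (auto simp: u1_def u2_def x1_def x2_def U'_def)
  have dd: "of_int d = real p * real s - real q * real r" by (simp add: d_def)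
  have dn: "of_int d \<noteq> (0::real)" using d_pos by simp
  have "of_int d * (real p * u1 + real q * u2) = of_int d * x1" "of_int d * (real r * u1 + real s * u2) = of_int d * x2"
    using dn by (simp_all add: u1_def u2_def distrib_left) (simp_all add: dd algebra_simps)
  then have "x1 = real p * u1 + real q * u2" "x2 = real r * u1 + real s * u2" using dn by auto
  then show thesis using that u by (simp add: x1_def x2_def)
qed

lemma norm_zmonom_exp:
  assumes "fst z \<noteq> 0" "snd z \<noteq> 0"
  shows "norm (zmonom \<alpha> z) = exp (- (of_int (fst \<alpha>) * (- ln (norm (fst z))) + of_int (snd \<alpha>) * (- ln (norm (snd z)))))"
proof -
  have "norm (fst z) = exp (ln (norm (fst z)))" "norm (snd z) = exp (ln (norm (snd z)))" using assms by auto
  then have "norm (zmonom \<alpha> z) = exp (ln (norm (fst z))) powi fst \<alpha> * exp (ln (norm (snd z))) powi snd \<alpha>"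
    by (simp add: zmonom_def norm_mult norm_power_int)
  then show ?thesis by (simp add: exp_power_int exp_add[symmetric])
qed

lemma AE_nonzero: "AE z in lborel. fst z \<noteq> (0::complex) \<and> snd z \<noteq> (0::complex)"
proof -
  have "AE x in lborel. AE y in lborel. fst (x, y) \<noteq> (0::complex) \<and> snd (x, y) \<noteq> (0::complex)"
    using AE_lborel_singleton[of "0::complex"]
    by eventually_elim (use AE_lborel_singleton[of "0::complex"] in simp)
  moreover have "{z \<in> space (lborel \<Otimes>\<^sub>M lborel). fst z \<noteq> (0::complex) \<and> snd z \<noteq> (0::complex)} \<in> sets (lborel \<Otimes>\<^sub>M lborel)"
    by measurable
  ultimately have "AE z in lborel \<Otimes>\<^sub>M lborel. fst z \<noteq> (0::complex) \<and> snd z \<noteq> (0::complex)"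
    by (intro lborel_pair.AE_pair_measure)
  then show ?thesis by (simp only: lborel_prod)
qed

lemma nn_integral_exp_half_line:
  "(\<integral>\<^sup>+x. ennreal (exp (- (2 * of_int k) * x)) * indicator {0<..} x \<partial>lborel) =
     (if 0 < k then ennreal (1 / (2 * of_int k)) else \<infinity>)" for k :: int
proof (cases "0 < k")
  case True
  then show ?thesis using nn_integral_exp_Ioi[of "2 * of_int k" 0] by simp
next
  case False
  let ?J = "\<integral>\<^sup>+x. ennreal (exp (- (2 * of_int k) * x)) * indicator {0<..} x \<partial>lborel"
  have ge: "ennreal (1 / e) \<le> ?J" if "e > 0" for e :: real
  proof -
    have "ennreal (1 / e) = (\<integral>\<^sup>+x. ennreal (exp (- e * x)) * indicator {0<..} x \<partial>lborel)"
      using nn_integral_exp_Ioi[of e 0] that by simp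
    also have "\<dots> \<le> ?J"
    proof (rule nn_integral_mono)
      fix x :: real
      have "exp (- e * x) \<le> exp (- (2 * of_int k) * x)" if "0 < x"
        using that False \<open>e > 0\<close> by (simp add: mult_right_mono)
      then show "ennreal (exp (- e * x)) * indicator {0<..} x \<le> ennreal (exp (- (2 * of_int k) * x)) * indicator {0<..} x"
        by (auto split: split_indicator intro!: ennreal_leI)
    qed
    finally show ?thesis .
  qed
  have "?J = \<infinity>"
  proof (rule ccontr)
    assume "?J \<noteq> \<infinity>"
    then obtain c where c: "?J = ennreal c" "c \<ge> 0" by (cases ?J) auto
    have "ennreal (c + 1) \<le> ennreal c" using ge[of "1 / (c + 1)"] c by simp
    then show False using c by simp
  qed
  then show ?thesis using False by simp
qed

text \<open>
  The integrand depends on the moduli only and is exponential in \<open>- ln \<bar>z\<^sub>j\<bar>\<close>. In the coordinates \<open>u\<close>, \<open>v\<close>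
  along the edges of the cone the integral splits into those of \<open>exp (- 2 deg1 \<alpha> u)\<close> and
  \<open>exp (- 2 deg2 \<alpha> v)\<close> over half lines.
\<close>

lemma nn_integral_zmonom:
  "(\<integral>\<^sup>+z. indicator U z * ennreal ((norm (zmonom \<alpha> z))\<^sup>2) \<partial>lborel) =
     (if \<alpha> \<in> I then ennreal (pi\<^sup>2 * of_int d / (of_int (deg1 \<alpha>) * of_int (deg2 \<alpha>))) else \<infinity>)"
proof -
  let ?E = "\<lambda>k x. ennreal (exp (- (2 * of_int k) * x)) * indicator {0<..} x"
  define C where "C = {x :: real \<times> real. real q * snd x < real s * fst x \<and> real r * fst x < real p * snd x}"
  have [measurable]: "C \<in> sets borel"
    unfolding C_def by (intro borel_open open_Collect_conj open_Collect_less continuous_intros)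
  define G where "G x = indicator C x * ennreal (exp (- 2 * (of_int (fst \<alpha>) * fst x + of_int (snd \<alpha>) * snd x)))" for x :: "real \<times> real"
  have [measurable]: "(\<lambda>x. exp (- 2 * (of_int (fst \<alpha>) * fst x + of_int (snd \<alpha>) * snd x))) \<in> borel_measurable (borel :: (real \<times> real) measure)"
    by (intro borel_measurable_continuous_onI continuous_intros)
  have [measurable]: "G \<in> borel_measurable borel" unfolding G_def by measurable
  have "(\<integral>\<^sup>+z. indicator U z * ennreal ((norm (zmonom \<alpha> z))\<^sup>2) \<partial>lborel)
      = (\<integral>\<^sup>+z. G (- ln (norm (fst (z :: complex \<times> complex))), - ln (norm (snd z))) \<partial>lborel)"
  proof (rule nn_integral_cong_AE)
    show "AE z in lborel. indicator U z * ennreal ((norm (zmonom \<alpha> z))\<^sup>2) = G (- ln (norm (fst z)), - ln (norm (snd z)))"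
      using AE_nonzero
    proof eventually_elim
      case (elim z)
      then have "indicator U z = (indicator C (- ln (norm (fst z)), - ln (norm (snd z))) :: ennreal)"
        using U_iff_ln[of z] by (auto simp: C_def split: split_indicator)
      moreover have "(norm (zmonom \<alpha> z))\<^sup>2 = exp (- 2 * (of_int (fst \<alpha>) * (- ln (norm (fst z))) + of_int (snd \<alpha>) * (- ln (norm (snd z)))))"
        using elim by (subst norm_zmonom_exp) (auto simp: exp_double[symmetric])
      ultimately show ?case by (simp add: G_def)
    qed
  qed
  also have "\<dots> = ennreal (4 * pi\<^sup>2) * (\<integral>\<^sup>+x. \<integral>\<^sup>+y. ennreal (exp (- 2 * x - 2 * y)) * G (x, y) \<partial>lborel \<partial>lborel)"
    by (rule nn_integral_neg_ln_norm2) measurable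
  also have "(\<integral>\<^sup>+x. \<integral>\<^sup>+y. ennreal (exp (- 2 * x - 2 * y)) * G (x, y) \<partial>lborel \<partial>lborel)
     = ennreal (of_int d) * (\<integral>\<^sup>+u. \<integral>\<^sup>+v. ?E (deg1 \<alpha>) u *
            ?E (deg2 \<alpha>) v \<partial>lborel \<partial>lborel)"
  proof -
    let ?F = "\<lambda>x. ennreal (exp (- 2 * fst x - 2 * snd x)) * G x"
    have dd: "real p * real s - real q * real r = of_int d" by (simp add: d_def)
    have [measurable]: "(\<lambda>x. exp (- 2 * fst x - 2 * snd x)) \<in> borel_measurable (borel :: (real \<times> real) measure)"
      by (intro borel_measurable_continuous_onI continuous_intros)
    have F: "?F (p * u + q * v, r * u + s * v) = ?E (deg1 \<alpha>) u *
            ?E (deg2 \<alpha>) v" for u v :: real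
    proof -
      have "s * (p * u + q * v) - q * (r * u + s * v) = of_int d * u" "p * (r * u + s * v) - r * (p * u + q * v) = of_int d * v"
        unfolding dd[symmetric] by (simp_all add: algebra_simps)
      then have "(q * (r * u + s * v) < s * (p * u + q * v)) = (0 < of_int d * u)"
        "(r * (p * u + q * v) < p * (r * u + s * v)) = (0 < of_int d * v)"
        by linarith+
      then have "indicator C (p * u + q * v, r * u + s * v) = (indicator {0<..} u * indicator {0<..} v :: ennreal)"
        using d_pos zero_less_mult_iff[of "of_int d" u] zero_less_mult_iff[of "of_int d" v]
        by (auto simp: C_def split: split_indicator)
      moreover have "exp (- 2 * (p * u + q * v) - 2 * (r * u + s * v)) *
          exp (- 2 * (of_int (fst \<alpha>) * (p * u + q * v) + of_int (snd \<alpha>) * (r * u + s * v)))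
        = exp (- (2 * of_int (deg1 \<alpha>)) * u) * exp (- (2 * of_int (deg2 \<alpha>)) * v)"
        unfolding exp_add[symmetric] by (simp add: deg1_def deg2_def algebra_simps)
      then have "ennreal (exp (- 2 * (p * u + q * v) - 2 * (r * u + s * v))) *
          ennreal (exp (- 2 * (of_int (fst \<alpha>) * (p * u + q * v) + of_int (snd \<alpha>) * (r * u + s * v))))
        = ennreal (exp (- (2 * of_int (deg1 \<alpha>)) * u)) * ennreal (exp (- (2 * of_int (deg2 \<alpha>)) * v))"
        by (metis ennreal_mult' exp_ge_zero)
      moreover have "a * (i * b) = (a' * j) * (b' * k)" if "i = j * k" "a * b = a' * b'" for a b i a' b' j k :: ennreal
        using that by (metis mult.assoc mult.commute)
      ultimately show ?thesis unfolding G_def fst_conv snd_conv by (simp only:)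
    qed
    have m: "?F \<in> borel_measurable borel" by measurable
    show ?thesis
      using nn_integral_linear_plane[OF m, of "real p" "real s" "real q" "real r"] p_pos d_pos
      unfolding F dd by simp
  qed
  also have "(\<integral>\<^sup>+u. \<integral>\<^sup>+v. ?E (deg1 \<alpha>) u *
            ?E (deg2 \<alpha>) v \<partial>lborel \<partial>lborel)
     = (\<integral>\<^sup>+u. ennreal (exp (- (2 * of_int (deg1 \<alpha>)) * u)) * indicator {0<..} u \<partial>lborel) *
       (\<integral>\<^sup>+v. ennreal (exp (- (2 * of_int (deg2 \<alpha>)) * v)) * indicator {0<..} v \<partial>lborel)"
    by (subst nn_integral_cmult, measurable, subst nn_integral_multc, measurable)
  finally have eq: "(\<integral>\<^sup>+z. indicator U z * ennreal ((norm (zmonom \<alpha> z))\<^sup>2) \<partial>lborel) =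
    ennreal (4 * pi\<^sup>2) * (ennreal (of_int d) * ((if 0 < deg1 \<alpha> then ennreal (1 / (2 * of_int (deg1 \<alpha>))) else \<infinity>) *
      (if 0 < deg2 \<alpha> then ennreal (1 / (2 * of_int (deg2 \<alpha>))) else \<infinity>)))"
    unfolding nn_integral_exp_half_line .
  show ?thesis
  proof (cases "\<alpha> \<in> I")
    case True
    then have "0 < deg1 \<alpha>" "0 < deg2 \<alpha>" by (auto simp: I_def)
    then show ?thesis using True d_pos unfolding eq by (simp add: ennreal_mult'[symmetric] field_simps)
  next
    case False
    then have "(if 0 < deg1 \<alpha> then ennreal (1 / (2 * of_int (deg1 \<alpha>))) else \<infinity>) *
      (if 0 < deg2 \<alpha> then ennreal (1 / (2 * of_int (deg2 \<alpha>))) else \<infinity>) = \<infinity>"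
      by (auto simp: I_def ennreal_mult_eq_top_iff ennreal_top_mult ennreal_mult_top)
    then show ?thesis using False d_pos unfolding eq by (simp add: ennreal_mult_top)
  qed
qed

text \<open>
  A zero coordinate of \<open>z\<close> is replaced by a small positive number that decreases to zero. Exponents in \<open>I\<close>
  are nonnegative at such a coordinate, so the monomials decrease as well and the point \<open>w 0\<close> dominates
  all the others.
\<close>

lemma approach_nonzero:
  assumes z: "z \<in> U"
  obtains w :: "nat \<Rightarrow> complex \<times> complex" where
    "\<And>k. w k \<in> U" "\<And>k. fst (w k) \<noteq> 0" "\<And>k. snd (w k) \<noteq> 0" "w \<longlonglongrightarrow> z"
    "\<And>k \<alpha>. \<alpha> \<in> I \<Longrightarrow> norm (zmonom \<alpha> (w k)) \<le> norm (zmonom \<alpha> (w 0))"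
    "\<And>\<alpha>. \<alpha> \<in> I \<Longrightarrow> norm (zmonom \<alpha> z) \<le> norm (zmonom \<alpha> (w 0))"
proof -
  obtain e where e: "e > 0" "ball z e \<subseteq> U" using openE[OF open_U z] by blast
  \<comment> \<open>Both coordinates may have to be changed, and the sum of the changes has to stay below e.\<close>
  define \<delta> where "\<delta> k = e / 3 / real (Suc k)" for k
  have \<delta>: "0 < \<delta> k" "\<delta> k \<le> e / 3" "\<delta> k \<le> \<delta> 0" for k using e by (auto simp: \<delta>_def divide_simps)
  define w where "w k = (if fst z = 0 then of_real (\<delta> k) else fst z, if snd z = 0 then of_real (\<delta> k) else snd z)" for k
  have le: "norm (a powi m) \<le> norm (b powi m)" if "norm a \<le> norm b" "0 \<le> m" for a b :: complex and m
    using that by (auto simp: power_int_def norm_power intro: power_mono)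
  show thesis
  proof (rule that[of w])
    fix k
    have "norm (w k - z) \<le> norm (fst (w k - z)) + norm (snd (w k - z))"
      using norm_Pair_le[of "fst (w k - z)" "snd (w k - z)"] by (simp del: fst_diff snd_diff)
    also have "\<dots> \<le> \<delta> k + \<delta> k" using \<delta>(1)[of k] by (intro add_mono) (auto simp: w_def)
    also have "\<dots> < e" using \<delta>(2)[of k] e by simp
    finally have "w k \<in> ball z e" by (simp add: dist_norm norm_minus_commute)
    then show "w k \<in> U" using e by auto
    show "fst (w k) \<noteq> 0" "snd (w k) \<noteq> 0" using \<delta>(1)[of k] by (auto simp: w_def)
  next
    have "\<delta> \<longlonglongrightarrow> 0" unfolding \<delta>_def by real_asymp
    then have "(\<lambda>k. complex_of_real (\<delta> k)) \<longlonglongrightarrow> of_real 0" by (intro tendsto_intros)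
    then show "w \<longlonglongrightarrow> z" unfolding w_def
      by (cases z, cases "fst z = 0"; cases "snd z = 0") (auto intro!: tendsto_Pair)
  next
    fix \<alpha> assume "\<alpha> \<in> I"
    then have nn: "fst z = 0 \<Longrightarrow> 0 \<le> fst \<alpha>" "snd z = 0 \<Longrightarrow> 0 \<le> snd \<alpha>"
      using I_nonneg1[OF z] I_nonneg2[OF z] by auto
    show "norm (zmonom \<alpha> (w k)) \<le> norm (zmonom \<alpha> (w 0))" for k
      unfolding zmonom_def norm_mult
      by (intro mult_mono) (use nn \<delta>(1,3) in \<open>auto simp: w_def less_imp_le intro!: le\<close>)
    show "norm (zmonom \<alpha> z) \<le> norm (zmonom \<alpha> (w 0))"
      unfolding zmonom_def norm_mult
      by (intro mult_mono) (use nn \<delta>(1) in \<open>auto simp: w_def less_imp_le intro!: le\<close>)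
  qed
qed

lemma summable_n_powers: "summable (\<lambda>n. real n * x ^ n)" if "0 \<le> x" "x < 1" for x :: real
proof -
  have "summable (\<lambda>n. real (Suc n) * x ^ n)"
    using geometric_deriv_sums[of x] that by (auto simp: sums_iff)
  then show ?thesis
    by (rule summable_comparison_test'[where N=0]) (use that in \<open>auto intro!: mult_right_mono\<close>)
qed

text \<open>
  With \<open>u\<close> the position of \<open>z\<close> in the cone, the terms are constant multiples of
  \<open>m exp (- m u1) * n exp (- n u2)\<close> for \<open>m = deg1 \<alpha>\<close>, \<open>n = deg2 \<alpha>\<close>, and \<open>\<alpha> \<mapsto> (m, n)\<close> is injective. Points
  with a zero coordinate are handled by domination.
\<close>

lemma summable_weights:
  assumes "z \<in> U"
  shows "(\<lambda>\<alpha>. real_of_int (weight \<alpha>) * norm (zmonom \<alpha> z)) summable_on UNIV"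
proof -
  \<comment> \<open>All coordinates nonzero: a product of two series over the image of the degrees.\<close>
  have nz: "(\<lambda>\<alpha>. real_of_int (weight \<alpha>) * norm (zmonom \<alpha> z)) summable_on I"
    if z: "z \<in> U" "fst z \<noteq> 0" "snd z \<noteq> 0" for z
  proof -
    have "z \<in> U'" using z by (simp add: U'_def)
    then obtain u1 u2 where u: "0 < u1" "0 < u2"
      and x: "- ln (norm (fst z)) = real p * u1 + real q * u2" "- ln (norm (snd z)) = real r * u1 + real s * u2"
      by (rule log_coordinates) (rule that)
    define h where "h = (\<lambda>(i, j). (real i * exp (- u1) ^ i) * (real j * exp (- u2) ^ j))"
    have s1: "(\<lambda>i. real i * exp (- u1) ^ i) summable_on UNIV" "(\<lambda>i. real i * exp (- u2) ^ i) summable_on UNIV"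
      using u summable_n_powers by (auto intro!: summable_on_UNIV_nonneg_real_iff[THEN iffD2])
    have h: "h summable_on UNIV"
    proof -
      have "h summable_on (UNIV \<times> UNIV)"
        by (rule summable_on_SigmaI[where g="\<lambda>i. (real i * exp (- u1) ^ i) * (\<Sum>\<^sub>\<infinity>j. real j * exp (- u2) ^ j)"])
           (auto simp: h_def intro!: has_sum_cmult_right summable_on_cmult_left s1 has_sum_infsum)
      then show ?thesis by simp
    qed
    define C where "C = exp ((p + r) * u1 + (q + s) * u2)"
    have "(\<lambda>\<alpha>. h (nat (deg1 \<alpha>), nat (deg2 \<alpha>))) summable_on I"
    proof -
      have inj: "inj_on (\<lambda>\<alpha>. (nat (deg1 \<alpha>), nat (deg2 \<alpha>))) I"
      proof (rule inj_onI)
        fix \<alpha> \<beta> assume "\<alpha> \<in> I" "\<beta> \<in> I" "(nat (deg1 \<alpha>), nat (deg2 \<alpha>)) = (nat (deg1 \<beta>), nat (deg2 \<beta>))"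
        then have "(deg1 \<alpha>, deg2 \<alpha>) = (deg1 \<beta>, deg2 \<beta>)" by (simp add: I_def nat_eq_iff)
        then show "\<alpha> = \<beta>" by (rule injD[OF inj_deg])
      qed
      show ?thesis using summable_on_reindex[OF inj, of h] summable_on_subset[OF h] by (simp add: o_def)
    qed
    then have "(\<lambda>\<alpha>. C * h (nat (deg1 \<alpha>), nat (deg2 \<alpha>))) summable_on I"
      by (rule summable_on_cmult_right)
    also have "?this \<longleftrightarrow> ?thesis"
    proof (rule summable_on_cong)
      fix \<alpha> assume "\<alpha> \<in> I"
      then have p12: "0 < deg1 \<alpha>" "0 < deg2 \<alpha>" by (auto simp: I_def)
      have "norm (zmonom \<alpha> z) = exp (- (of_int (fst \<alpha>) * (p * u1 + q * u2) + of_int (snd \<alpha>) * (r * u1 + s * u2)))"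
        using norm_zmonom_exp[OF z(2,3), of \<alpha>] unfolding x .
      also have "\<dots> = exp ((p + r) * u1 + (q + s) * u2 - of_int (deg1 \<alpha>) * u1 - of_int (deg2 \<alpha>) * u2)"
        by (simp add: deg1_def deg2_def algebra_simps)
      also have "\<dots> = C * (exp (- u1) ^ nat (deg1 \<alpha>) * exp (- u2) ^ nat (deg2 \<alpha>))"
        using p12 by (simp add: C_def exp_of_nat_mult[symmetric] exp_add[symmetric])
      finally show "C * h (nat (deg1 \<alpha>), nat (deg2 \<alpha>)) = real_of_int (weight \<alpha>) * norm (zmonom \<alpha> z)"
        using p12 by (simp add: h_def weight_def max_def)
    qed
    finally show ?thesis .
  qed
  obtain w where w: "w \<in> U" "fst w \<noteq> 0" "snd w \<noteq> 0" "\<And>\<alpha>. \<alpha> \<in> I \<Longrightarrow> norm (zmonom \<alpha> z) \<le> norm (zmonom \<alpha> w)"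
    using approach_nonzero[OF assms] by metis
  have weight_nonneg: "0 \<le> weight \<alpha>" for \<alpha> by (simp add: weight_def)
  have "(\<lambda>\<alpha>. real_of_int (weight \<alpha>) * norm (zmonom \<alpha> z)) summable_on I"
    by (rule summable_on_comparison_test[OF nz[OF w(1-3)]]) (auto intro!: mult_left_mono w(4) simp: weight_nonneg)
  also have "?this \<longleftrightarrow> ?thesis"
    by (rule summable_on_cong_neutral) (auto simp: I_def weight_def)
  finally show ?thesis .
qed

end

section \<open>Laurent coefficients of holomorphic functions\<close>

abbreviation cmul :: "complex \<times> complex \<Rightarrow> complex \<times> complex \<Rightarrow> complex \<times> complex" (infixl "\<odot>" 70)
  where "a \<odot> b \<equiv> (fst a * fst b, snd a * snd b)"

lemma holomorphic2_continuous_on: "holomorphic2_on f \<Omega> \<Longrightarrow> continuous_on \<Omega> f"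
  unfolding holomorphic2_on_def continuous_on_eq_continuous_within
  using has_derivative_continuous by blast

lemma holomorphic2_compose_curve:
  assumes f: "holomorphic2_on f \<Omega>" and \<Omega>: "open \<Omega>" and S: "open S"
    and g1: "g1 holomorphic_on S" and g2: "g2 holomorphic_on S"
    and sub: "\<And>x. x \<in> S \<Longrightarrow> (g1 x, g2 x) \<in> \<Omega>"
  shows "(\<lambda>x. f (g1 x, g2 x)) holomorphic_on S"
  unfolding holomorphic_on_open[OF S]
proof (intro ballI)
  fix x assume x: "x \<in> S"
  obtain a b where "(f has_derivative (\<lambda>h. a * fst h + b * snd h)) (at (g1 x, g2 x) within \<Omega>)"
    using f sub[OF x] unfolding holomorphic2_on_def by blast
  then have fd: "(f has_derivative (\<lambda>h. a * fst h + b * snd h)) (at (g1 x, g2 x))"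
    using at_within_open[OF sub[OF x] \<Omega>] by simp
  obtain g1' g2' where "(g1 has_field_derivative g1') (at x)" "(g2 has_field_derivative g2') (at x)"
    using g1 g2 x S unfolding holomorphic_on_open[OF S] by blast
  then have "((\<lambda>x. (g1 x, g2 x)) has_derivative (\<lambda>h. (g1' * h, g2' * h))) (at x)"
    unfolding has_field_derivative_def by (rule has_derivative_Pair)
  from has_derivative_compose[OF this fd]
  have "((\<lambda>x. f (g1 x, g2 x)) has_derivative (\<lambda>h. (a * g1' + b * g2') * h)) (at x)"
    by (simp add: algebra_simps)
  then show "\<exists>f'. ((\<lambda>x. f (g1 x, g2 x)) has_field_derivative f') (at x)"
    unfolding has_field_derivative_def by blast
qed

definition torus_mean :: "(complex \<times> complex \<Rightarrow> complex) \<Rightarrow> complex \<times> complex \<Rightarrow> complex" where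
  "torus_mean G w = (\<integral>\<zeta>. G (\<zeta> \<odot> w) \<partial>torus_measure)"

lemma torus_mean_rotate:
  assumes G [measurable]: "G \<in> borel_measurable borel" and e: "\<eta> \<in> torus"
  shows "torus_mean G (\<eta> \<odot> w) = torus_mean G w"
proof -
  have m: "(\<lambda>\<zeta>. G (\<zeta> \<odot> w)) \<in> borel_measurable borel"
    using measurable_compose[OF measurable_rotate[of "fst w" "snd w"] G] by (simp add: mult.commute)
  have "torus_mean G (\<eta> \<odot> w) = (\<integral>\<zeta>. (\<lambda>\<zeta>. G (\<zeta> \<odot> w)) (fst \<eta> * fst \<zeta>, snd \<eta> * snd \<zeta>) \<partial>torus_measure)"
    by (simp add: torus_mean_def mult_ac)
  also have "\<dots> = torus_mean G w"
    using e unfolding torus_mean_def by (intro integral_torus_rotate m) (auto simp: mem_torus)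
  finally show ?thesis .
qed

lemma torus_mean_cong_norm:
  assumes "G \<in> borel_measurable borel" and n: "norm (fst w) = norm (fst w')" "norm (snd w) = norm (snd w')"
  shows "torus_mean G w = torus_mean G w'"
proof -
  have ex: "\<exists>e. norm e = 1 \<and> a = e * b" if "norm a = norm b" for a b :: complex
  proof (cases "b = 0")
    case True then show ?thesis using that by (intro exI[of _ 1]) auto
  next
    case False then show ?thesis using that by (intro exI[of _ "a / b"]) (auto simp: norm_divide)
  qed
  obtain e1 e2 where "norm e1 = 1" "fst w = e1 * fst w'" "norm e2 = 1" "snd w = e2 * snd w'"
    using ex[OF n(1)] ex[OF n(2)] by blast
  then show ?thesis
    using torus_mean_rotate[OF assms(1), of "(e1, e2)" w'] by (cases w) (simp add: mem_torus)
qed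

interpretation circ_torus: pair_sigma_finite circle_measure torus_measure ..

lemma sets_circ_torus: "sets (circle_measure \<Otimes>\<^sub>M torus_measure) = sets borel"
proof -
  have "sets (circle_measure \<Otimes>\<^sub>M torus_measure) = sets (borel \<Otimes>\<^sub>M borel :: (complex \<times> complex \<times> complex) measure)"
    by (rule sets_pair_measure_cong) simp_all
  then show ?thesis by (simp only: borel_prod)
qed

lemma finite_measure_circ_torus: "finite_measure (circle_measure \<Otimes>\<^sub>M torus_measure)"
proof
  have "emeasure (circle_measure \<Otimes>\<^sub>M torus_measure) (UNIV \<times> UNIV) = 1"
    by (subst tor.emeasure_pair_measure_Times) (auto simp: emeasure_circle_measure_UNIV emeasure_torus_measure_UNIV)
  then show "emeasure (circle_measure \<Otimes>\<^sub>M torus_measure) (space (circle_measure \<Otimes>\<^sub>M torus_measure)) \<noteq> \<infinity>"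
    by (simp add: space_pair_measure)
qed

text \<open>
  For every fixed \<open>x\<close> on the unit circle a rotation of the torus absorbs the factors \<open>x\<^sup>k\<close> and \<open>x\<^sup>l\<close>, so
  the torus mean may be averaged over \<open>x\<close> as well. After an exchange of the integrals the inner one is
  the average over a circle of radius \<open>\<rho>\<close> of a holomorphic function of one variable.
\<close>

lemma torus_mean_scale:
  fixes k l :: nat
  assumes G [measurable]: "G \<in> borel_measurable borel" and cont: "continuous_on V G"
    and R: "1 < R" and \<rho>: "0 < \<rho>" "\<rho> < R"
    and curve: "\<And>\<zeta> x. \<zeta> \<in> torus \<Longrightarrow> x \<in> ball 0 R - {0} \<Longrightarrow> \<zeta> \<odot> (x ^ k * fst w, x ^ l * snd w) \<in> V"
    and hol: "\<And>\<zeta>. \<zeta> \<in> torus \<Longrightarrow> (\<lambda>x. G (\<zeta> \<odot> (x ^ k * fst w, x ^ l * snd w))) holomorphic_on (ball 0 R - {0})"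
  shows "torus_mean G (of_real \<rho> ^ k * fst w, of_real \<rho> ^ l * snd w) = torus_mean G w"
proof -
  let ?P = "\<lambda>x. (x ^ k * fst w, x ^ l * snd w)"
  interpret ct: finite_measure "circle_measure \<Otimes>\<^sub>M torus_measure" by (rule finite_measure_circ_torus)
  have key: "torus_mean G (?P (of_real a))
     = (\<integral>\<zeta>. (\<integral>x. G (\<zeta> \<odot> (?P (of_real a * x))) \<partial>circle_measure) \<partial>torus_measure)"
    if a: "0 < a" "a < R" for a :: real
  proof -
    let ?T = "\<lambda>y. G (snd y \<odot> (?P (of_real a * fst y)))"
    have cm: "(\<lambda>y :: complex \<times> complex \<times> complex. snd y \<odot> (?P (of_real a * fst y))) \<in> borel \<rightarrow>\<^sub>M borel"
      by (intro borel_measurable_continuous_onI continuous_intros)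
    have Tm: "?T \<in> borel_measurable (circle_measure \<Otimes>\<^sub>M torus_measure)"
      by (subst measurable_cong_sets[OF sets_circ_torus refl]) (rule measurable_compose[OF cm G])
    have "compact ((\<lambda>y. ?T y) ` (sphere 0 1 \<times> torus))"
    proof (rule compact_continuous_image)
      show "continuous_on (sphere 0 1 \<times> torus) ?T"
      proof (rule continuous_on_compose2[OF cont])
        show "(\<lambda>y. snd y \<odot> (?P (of_real a * fst y))) ` (sphere 0 1 \<times> torus) \<subseteq> V"
        proof (rule image_subsetI)
          fix y :: "complex \<times> complex \<times> complex" assume "y \<in> sphere 0 1 \<times> torus"
          then have "snd y \<in> torus" "of_real a * fst y \<in> ball 0 R - {0}"
            using a by (auto simp: mem_Times_iff norm_mult)
          then show "snd y \<odot> (?P (of_real a * fst y)) \<in> V" by (rule curve)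
        qed
      qed (intro continuous_intros)
    qed (auto intro: compact_Times compact_torus)
    then obtain C where C: "\<And>y. y \<in> sphere 0 1 \<times> torus \<Longrightarrow> norm (?T y) \<le> C"
      using compact_imp_bounded bounded_iff by (metis (mono_tags, lifting) imageI)
    have "AE x in circle_measure. AE z in torus_measure. (x, z) \<in> sphere 0 1 \<times> torus"
      using AE_circle_measure by eventually_elim (use AE_torus in simp)
    moreover have "sphere 0 1 \<times> torus \<in> sets (circle_measure \<Otimes>\<^sub>M torus_measure)"
      unfolding sets_circ_torus by (intro borel_compact compact_Times compact_sphere compact_torus)
    ultimately have "AE y in circle_measure \<Otimes>\<^sub>M torus_measure. y \<in> sphere 0 1 \<times> torus"
      by (intro circ_torus.AE_pair_measure) (simp_all add: space_pair_measure)
    then have "AE y in circle_measure \<Otimes>\<^sub>M torus_measure. norm (?T y) \<le> C"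
      by eventually_elim (rule C)
    then have "integrable (circle_measure \<Otimes>\<^sub>M torus_measure) ?T"
      by (rule ct.integrable_const_bound[OF _ Tm])
    then have int: "integrable (circle_measure \<Otimes>\<^sub>M torus_measure)
       (case_prod (\<lambda>x \<zeta>. G (\<zeta> \<odot> (?P (of_real a * x)))))"
      by (simp add: case_prod_unfold)
    have "(\<integral>\<zeta>. (\<integral>x. G (\<zeta> \<odot> (?P (of_real a * x))) \<partial>circle_measure) \<partial>torus_measure)
       = (\<integral>x. torus_mean G (?P (of_real a * x)) \<partial>circle_measure)"
      unfolding torus_mean_def fst_conv snd_conv by (rule circ_torus.Fubini_integral[OF int, unfolded fst_conv snd_conv])
    also have "\<dots> = (\<integral>x. torus_mean G (?P (of_real a)) \<partial>circle_measure)"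
    proof (rule integral_cong_AE)
      have eq: "torus_mean G (?P (of_real a * x)) =
        torus_mean G (?P (of_real a))" if "norm x = 1" for x
        by (rule torus_mean_cong_norm[OF G]) (simp_all add: norm_mult norm_power that)
      show "AE x in circle_measure. torus_mean G (?P (of_real a * x)) =
        torus_mean G (?P (of_real a))"
        using AE_circle_measure by eventually_elim (rule eq)
      show "(\<lambda>x. torus_mean G (?P (of_real a * x))) \<in> borel_measurable circle_measure"
        unfolding torus_mean_def fst_conv snd_conv
        using int[unfolded fst_conv snd_conv] borel_measurable_integrable by measurable
    qed simp
    also have "\<dots> = torus_mean G (?P (of_real a))"
      by (simp add: measure_def emeasure_circle_measure_UNIV)
    finally show ?thesis by simp
  qed
  have "torus_mean G (of_real \<rho> ^ k * fst w, of_real \<rho> ^ l * snd w)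
     = (\<integral>\<zeta>. (\<integral>x. G (\<zeta> \<odot> (?P (of_real \<rho> * x))) \<partial>circle_measure) \<partial>torus_measure)"
    by (rule key[OF \<rho>])
  also have "\<dots> = (\<integral>\<zeta>. (\<integral>x. G (\<zeta> \<odot> (?P (of_real 1 * x))) \<partial>circle_measure) \<partial>torus_measure)"
  proof -
    have AE_eq: "(\<integral>x. G (\<zeta> \<odot> (?P (of_real \<rho> * x))) \<partial>circle_measure)
       = (\<integral>x. G (\<zeta> \<odot> (?P (of_real 1 * x))) \<partial>circle_measure)"
      if z: "\<zeta> \<in> torus" for \<zeta>
    proof -
      have cm: "(\<lambda>x. \<zeta> \<odot> (x ^ k * fst w, x ^ l * snd w)) \<in> borel \<rightarrow>\<^sub>M borel"
        by (intro borel_measurable_continuous_onI continuous_intros)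
      show ?thesis
        using circle_average_radius[OF hol[OF z] R \<rho> measurable_compose[OF cm G]] by simp
    qed
    have "AE \<zeta> in torus_measure. (\<integral>x. G (\<zeta> \<odot> (?P (of_real \<rho> * x))) \<partial>circle_measure)
       = (\<integral>x. G (\<zeta> \<odot> (?P (of_real 1 * x))) \<partial>circle_measure)"
      using AE_torus by eventually_elim (rule AE_eq)
    moreover have "(\<lambda>\<zeta>. (\<integral>x. G (\<zeta> \<odot> (?P (of_real a * x))) \<partial>circle_measure)) \<in> borel_measurable torus_measure" for a :: real
    proof -
      have cm: "(\<lambda>y :: complex \<times> complex \<times> complex. snd y \<odot> (?P (of_real a * fst y))) \<in> borel \<rightarrow>\<^sub>M borel"
        by (intro borel_measurable_continuous_onI continuous_intros)
      have "(\<lambda>y. G (snd y \<odot> (?P (of_real a * fst y)))) \<in> borel_measurable (circle_measure \<Otimes>\<^sub>M torus_measure)"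
        by (subst measurable_cong_sets[OF sets_circ_torus refl]) (rule measurable_compose[OF cm G])
      from measurable_compose[OF measurable_pair_swap' this]
      have "case_prod (\<lambda>\<zeta> x. G (\<zeta> \<odot> (?P (of_real a * x)))) \<in> borel_measurable (torus_measure \<Otimes>\<^sub>M circle_measure)"
        by (simp add: case_prod_unfold)
      then show ?thesis by (rule circ.borel_measurable_lebesgue_integral)
    qed
    ultimately show ?thesis by (intro integral_cong_AE)
  qed
  also have "\<dots> = torus_mean G (of_real 1 ^ k * fst w, of_real 1 ^ l * snd w)"
    by (rule key[symmetric]) (use R in auto)
  finally show ?thesis by simp
qed

context monomial_domain
begin

lemma U'_U: "z \<in> U' \<Longrightarrow> z \<in> U" by (simp add: U'_def)

lemma torus_U': "\<zeta> \<in> torus \<Longrightarrow> z \<in> U' \<Longrightarrow> \<zeta> \<odot> z \<in> U'"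
  using torus_U[of \<zeta> z] by (auto simp: U'_def mem_torus)

text \<open>
  This is what keeps the curves below inside the domain: the radius may be increased a little beyond 1
  since the inequality is strict, and decreased at will since \<open>q * r < p * s\<close>.
\<close>

lemma scaling_room:
  fixes a b :: real
  assumes "0 \<le> a" "a < b"
  obtains R where "1 < R"
    "\<And>x :: complex. x \<in> ball 0 R - {0} \<Longrightarrow> a * norm x ^ (p * s) < b * norm x ^ (q * r)"
proof -
  let ?n = "p * s - q * r"
  have "open {t::real. a * t ^ ?n < b}" by (intro open_Collect_less continuous_intros)
  moreover have "1 \<in> {t::real. a * t ^ ?n < b}" using assms by simp
  ultimately obtain e where e: "e > 0" "ball 1 e \<subseteq> {t. a * t ^ ?n < b}" by (meson openE)
  have "1 + e / 2 \<in> ball 1 e" using e by (simp add: dist_real_def)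
  then have R: "a * (1 + e / 2) ^ ?n < b" using e by auto
  have "a * norm x ^ (p * s) < b * norm x ^ (q * r)" if x: "x \<in> ball 0 (1 + e / 2) - {0}" for x :: complex
  proof -
    have "a * norm x ^ ?n \<le> a * (1 + e / 2) ^ ?n"
      using x \<open>0 \<le> a\<close> by (intro mult_left_mono power_mono) auto
    then have "a * norm x ^ ?n * norm x ^ (q * r) < b * norm x ^ (q * r)"
      using R x by (intro mult_strict_right_mono) auto
    moreover have "norm x ^ ?n * norm x ^ (q * r) = norm x ^ (p * s)"
      using det_pos by (simp flip: power_add)
    ultimately show ?thesis by (simp add: mult.assoc)
  qed
  then show thesis using that[of "1 + e / 2"] e by simp
qed

text \<open>
  Scaling by a column of \<open>A\<close> is a translation of the cone coordinates parallel to one of its edges: one of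
  the two defining inequalities is multiplied by equal powers on both sides, the other becomes stronger
  as the radius decreases.
\<close>

lemma curve_first_column:
  assumes "w \<in> U'"
  shows "\<exists>R>1. \<forall>x\<in>ball 0 R - {0}. (x ^ p * fst w, x ^ r * snd w) \<in> U'"
proof -
  have w: "norm (fst w) ^ s < norm (snd w) ^ q" "norm (snd w) ^ p < norm (fst w) ^ r" "fst w \<noteq> 0" "snd w \<noteq> 0"
    using assms by (auto simp: U'_def U_def)
  obtain R where R: "1 < R" "\<And>x :: complex. x \<in> ball 0 R - {0} \<Longrightarrow>
      norm (fst w) ^ s * norm x ^ (p * s) < norm (snd w) ^ q * norm x ^ (q * r)"
    using scaling_room[OF zero_le_power[OF norm_ge_zero] w(1)] by blast
  have "(x ^ p * fst w, x ^ r * snd w) \<in> U'" if x: "x \<in> ball 0 R - {0}" for x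
  proof -
    have "norm (snd w) ^ p * norm x ^ (p * r) < norm (fst w) ^ r * norm x ^ (p * r)"
      using w(2) x by (intro mult_strict_right_mono) auto
    then show ?thesis
      using R(2)[OF x] w(3,4) x by (simp add: U'_def U_def norm_mult norm_power power_mult_distrib mult_ac flip: power_mult)
  qed
  then show ?thesis using R(1) by blast
qed

lemma curve_second_column:
  assumes "w \<in> U'"
  shows "\<exists>R>1. \<forall>x\<in>ball 0 R - {0}. (x ^ q * fst w, x ^ s * snd w) \<in> U'"
proof -
  have w: "norm (fst w) ^ s < norm (snd w) ^ q" "norm (snd w) ^ p < norm (fst w) ^ r" "fst w \<noteq> 0" "snd w \<noteq> 0"
    using assms by (auto simp: U'_def U_def)
  obtain R where R: "1 < R" "\<And>x :: complex. x \<in> ball 0 R - {0} \<Longrightarrow>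
      norm (snd w) ^ p * norm x ^ (p * s) < norm (fst w) ^ r * norm x ^ (q * r)"
    using scaling_room[OF zero_le_power[OF norm_ge_zero] w(2)] by blast
  have "(x ^ q * fst w, x ^ s * snd w) \<in> U'" if x: "x \<in> ball 0 R - {0}" for x
  proof -
    have "norm (fst w) ^ s * norm x ^ (q * s) < norm (snd w) ^ q * norm x ^ (q * s)"
      using w(1) x by (intro mult_strict_right_mono) auto
    then show ?thesis
      using R(2)[OF x] w(3,4) x by (simp add: U'_def U_def norm_mult norm_power power_mult_distrib mult_ac flip: power_mult)
  qed
  then show ?thesis using R(1) by blast
qed

definition zero_ext :: "(complex \<times> complex \<Rightarrow> complex) \<Rightarrow> complex \<times> complex \<Rightarrow> complex" where
  "zero_ext f z = (if z \<in> U then f z else 0)"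

lemma zero_ext_measurable:
  assumes "holomorphic2_on f U" shows "zero_ext f \<in> borel_measurable borel"
proof -
  have "zero_ext f = (\<lambda>z. indicator U z *\<^sub>R f z)" by (auto simp: zero_ext_def)
  then show ?thesis
    using borel_measurable_continuous_on_indicator[OF U_borel holomorphic2_continuous_on[OF assms]] by simp
qed

text \<open>
  The torus mean of \<open>twist f \<alpha>\<close> picks out the Laurent coefficient of \<open>f\<close> with exponent \<open>\<alpha>\<close>.
\<close>

definition twist :: "(complex \<times> complex \<Rightarrow> complex) \<Rightarrow> int \<times> int \<Rightarrow> complex \<times> complex \<Rightarrow> complex" where
  "twist f \<alpha> z = zero_ext f z * zmonom (- \<alpha>) z"

lemma torus_mean_twist_step:
  fixes k l :: nat
  assumes f: "holomorphic2_on f U" and w: "w \<in> U'" and kl: "(k, l) = (p, r) \<or> (k, l) = (q, s)"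
    and \<rho>: "0 < \<rho>" "\<rho> \<le> 1"
  shows "torus_mean (twist f \<alpha>) (of_real \<rho> ^ k * fst w, of_real \<rho> ^ l * snd w) = torus_mean (twist f \<alpha>) w"
    and "(of_real \<rho> ^ k * fst w, of_real \<rho> ^ l * snd w) \<in> U'"
proof -
  obtain R where R: "R > 1" "\<And>x. x \<in> ball 0 R - {0} \<Longrightarrow> (x ^ k * fst w, x ^ l * snd w) \<in> U'"
    using curve_first_column[OF w] curve_second_column[OF w] kl by auto
  have [measurable]: "twist f \<alpha> \<in> borel_measurable borel"
    unfolding twist_def using zero_ext_measurable[OF f] by measurable
  have eq: "twist f \<alpha> z = f z * (fst z powi (- fst \<alpha>) * snd z powi (- snd \<alpha>))" if "z \<in> U'" for z
    using that by (auto simp: twist_def zero_ext_def U'_U zmonom_def)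
  have cont: "continuous_on U' (twist f \<alpha>)"
  proof -
    have "continuous_on U' (\<lambda>z. f z * (fst z powi (- fst \<alpha>) * snd z powi (- snd \<alpha>)))"
      using holomorphic2_continuous_on[OF f]
      by (intro continuous_intros) (auto simp: U'_def elim: continuous_on_subset)
    then show ?thesis by (rule continuous_on_eq) (simp add: eq)
  qed
  show "torus_mean (twist f \<alpha>) (of_real \<rho> ^ k * fst w, of_real \<rho> ^ l * snd w) = torus_mean (twist f \<alpha>) w"
  proof (rule torus_mean_scale[OF _ cont R(1)])
    fix \<zeta> assume z: "\<zeta> \<in> torus"
    show m: "\<zeta> \<odot> (x ^ k * fst w, x ^ l * snd w) \<in> U'" if "x \<in> ball 0 R - {0}" for x
      by (rule torus_U'[OF z R(2)[OF that]])
    have nz: "fst w \<noteq> 0" "snd w \<noteq> 0" "fst \<zeta> \<noteq> 0" "snd \<zeta> \<noteq> 0" using w z by (auto simp: U'_def mem_torus)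
    have op: "open (ball 0 R - {0::complex})" by (intro open_Diff) auto
    have "(\<lambda>x. f (fst \<zeta> * (x ^ k * fst w), snd \<zeta> * (x ^ l * snd w)) *
        ((fst \<zeta> * (x ^ k * fst w)) powi (- fst \<alpha>) * (snd \<zeta> * (x ^ l * snd w)) powi (- snd \<alpha>))) holomorphic_on (ball 0 R - {0})"
      by (intro holomorphic_on_mult holomorphic2_compose_curve[OF f open_U op] holomorphic_intros)
         (use m nz in \<open>auto simp: U'_def\<close>)
    then show "(\<lambda>x. twist f \<alpha> (\<zeta> \<odot> (x ^ k * fst w, x ^ l * snd w))) holomorphic_on (ball 0 R - {0})"
      by (rule holomorphic_transform) (use m in \<open>simp add: eq\<close>)
  qed (use \<rho> R in auto)
  show "(of_real \<rho> ^ k * fst w, of_real \<rho> ^ l * snd w) \<in> U'"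
    by (rule R(2)) (use \<rho> R in auto)
qed

end

interpretation lborel_torus: pair_sigma_finite "lborel :: (complex \<times> complex) measure" torus_measure ..

lemma sets_lborel_torus: "sets ((lborel :: (complex \<times> complex) measure) \<Otimes>\<^sub>M torus_measure) = sets borel"
proof -
  have "sets ((lborel :: (complex \<times> complex) measure) \<Otimes>\<^sub>M torus_measure) = sets (borel \<Otimes>\<^sub>M borel :: ((complex \<times> complex) \<times> complex \<times> complex) measure)"
    by (rule sets_pair_measure_cong) simp_all
  then show ?thesis by (simp only: borel_prod)
qed

lemma measurable_cmul_pair:
  assumes "H \<in> borel_measurable borel"
  shows "(\<lambda>y. H (snd y \<odot> fst y)) \<in> borel_measurable ((lborel :: (complex \<times> complex) measure) \<Otimes>\<^sub>M torus_measure)"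
proof -
  have cm: "(\<lambda>y :: (complex \<times> complex) \<times> complex \<times> complex. snd y \<odot> fst y) \<in> borel \<rightarrow>\<^sub>M borel"
    by (intro borel_measurable_continuous_onI continuous_intros)
  show ?thesis
    by (subst measurable_cong_sets[OF sets_lborel_torus refl]) (rule measurable_compose[OF cm assms])
qed

lemma nn_integral_rotate_torus:
  assumes [measurable]: "H \<in> borel_measurable borel" and z: "\<zeta> \<in> torus"
  shows "(\<integral>\<^sup>+z. H (\<zeta> \<odot> z) \<partial>lborel) = (\<integral>\<^sup>+z. H z \<partial>lborel)"
  using nn_integral_distr[of "\<lambda>z. \<zeta> \<odot> z" lborel lborel H] distr_rotate_lborel2[of "fst \<zeta>" "snd \<zeta>"] z
  by (simp add: mem_torus)

text \<open>
  Averaging over the torus does not change integrals over \<open>\<complex>\<^sup>2\<close>, by Fubini and the rotation invariance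
  of Lebesgue measure. This replaces integration in polar coordinates.
\<close>

lemma nn_integral_torus_average:
  fixes H :: "complex \<times> complex \<Rightarrow> ennreal"
  assumes H [measurable]: "H \<in> borel_measurable borel"
  shows "(\<integral>\<^sup>+z. \<integral>\<^sup>+\<zeta>. H (\<zeta> \<odot> z) \<partial>torus_measure \<partial>lborel) = (\<integral>\<^sup>+z. H z \<partial>lborel)"
proof -
  have "(\<integral>\<^sup>+z. \<integral>\<^sup>+\<zeta>. H (\<zeta> \<odot> z) \<partial>torus_measure \<partial>lborel) = (\<integral>\<^sup>+\<zeta>. \<integral>\<^sup>+z. H (\<zeta> \<odot> z) \<partial>lborel \<partial>torus_measure)"
    using lborel_torus.Fubini[OF measurable_cmul_pair[OF H]] by simp
  also have "\<dots> = (\<integral>\<^sup>+\<zeta>. (\<integral>\<^sup>+z. H z \<partial>lborel) \<partial>torus_measure)"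
    by (rule nn_integral_cong_AE) (use AE_torus nn_integral_rotate_torus[OF H] in \<open>auto elim!: eventually_mono\<close>)
  also have "\<dots> = (\<integral>\<^sup>+z. H z \<partial>lborel)"
    by (simp add: emeasure_torus_measure_UNIV)
  finally show ?thesis .
qed

lemma integral_torus_average:
  assumes H: "integrable lborel H"
  shows "(\<integral>z. torus_mean H z \<partial>lborel) = (\<integral>z. H z \<partial>lborel)"
proof -
  have Hm [measurable]: "H \<in> borel_measurable borel" using borel_measurable_integrable[OF H] by simp
  have "integrable (lborel \<Otimes>\<^sub>M torus_measure) (\<lambda>y. H (snd y \<odot> fst y))"
  proof (rule integrableI_bounded)
    show "(\<lambda>y. H (snd y \<odot> fst y)) \<in> borel_measurable (lborel \<Otimes>\<^sub>M torus_measure)"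
      by (rule measurable_cmul_pair) fact
    have "(\<integral>\<^sup>+ y. ennreal (norm (H (snd y \<odot> fst y))) \<partial>(lborel \<Otimes>\<^sub>M torus_measure))
       = (\<integral>\<^sup>+z. \<integral>\<^sup>+\<zeta>. ennreal (norm (H (\<zeta> \<odot> z))) \<partial>torus_measure \<partial>lborel)"
      using tor.nn_integral_fst[OF measurable_cmul_pair[of "\<lambda>z. ennreal (norm (H z))"]] by simp
    also have "\<dots> = (\<integral>\<^sup>+z. ennreal (norm (H z)) \<partial>lborel)"
      by (rule nn_integral_torus_average) measurable
    also have "\<dots> < \<infinity>" using H by (simp add: integrable_iff_bounded)
    finally show "(\<integral>\<^sup>+ y. ennreal (norm (H (snd y \<odot> fst y))) \<partial>(lborel \<Otimes>\<^sub>M torus_measure)) < \<infinity>" .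
  qed
  then have int: "integrable (lborel \<Otimes>\<^sub>M torus_measure) (case_prod (\<lambda>z \<zeta>. H (\<zeta> \<odot> z)))"
    by (simp add: case_prod_unfold)
  have "(\<integral>z. torus_mean H z \<partial>lborel) = (\<integral>\<zeta>. (\<integral>z. H (\<zeta> \<odot> z) \<partial>lborel) \<partial>torus_measure)"
    unfolding torus_mean_def by (rule lborel_torus.Fubini_integral[OF int, symmetric])
  also have "\<dots> = (\<integral>\<zeta>. (\<integral>z. H z \<partial>lborel) \<partial>torus_measure)"
  proof (rule integral_cong_AE)
    have "(\<integral>z. H (\<zeta> \<odot> z) \<partial>lborel) = (\<integral>z. H z \<partial>lborel)" if "\<zeta> \<in> torus" for \<zeta>
      using integral_distr[of "\<lambda>z. \<zeta> \<odot> z" lborel lborel H] distr_rotate_lborel2[of "fst \<zeta>" "snd \<zeta>"] that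
      by (simp add: mem_torus)
    then show "AE \<zeta> in torus_measure. (\<integral>z. H (\<zeta> \<odot> z) \<partial>lborel) = (\<integral>z. H z \<partial>lborel)"
      using AE_torus by (auto elim!: eventually_mono)
    have "case_prod (\<lambda>\<zeta> z. H (\<zeta> \<odot> z)) \<in> borel_measurable (torus_measure \<Otimes>\<^sub>M lborel)"
      using measurable_compose[OF measurable_pair_swap' borel_measurable_integrable[OF int]]
      by (simp add: case_prod_unfold)
    then show "(\<lambda>\<zeta>. (\<integral>z. H (\<zeta> \<odot> z) \<partial>lborel)) \<in> borel_measurable torus_measure"
      by (rule lborel.borel_measurable_lebesgue_integral)
  qed simp
  also have "\<dots> = (\<integral>z. H z \<partial>lborel)" by simp
  finally show ?thesis .
qed

lemma norm_integral_torus_squared_le: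
  fixes h :: "complex \<times> complex \<Rightarrow> complex"
  assumes [measurable]: "h \<in> borel_measurable borel" and C: "\<And>z. z \<in> torus \<Longrightarrow> norm (h z) \<le> C"
  shows "ennreal ((norm (\<integral>z. h z \<partial>torus_measure))\<^sup>2) \<le> (\<integral>\<^sup>+z. ennreal ((norm (h z))\<^sup>2) \<partial>torus_measure)"
proof -
  define a where "a = (\<integral>z. norm (h z) \<partial>torus_measure)"
  have i1: "integrable torus_measure (\<lambda>z. norm (h z))"
    by (rule integrable_torus_bounded[where C=C]) (use C in auto)
  have i2: "integrable torus_measure (\<lambda>z. (norm (h z))\<^sup>2)"
    by (rule integrable_torus_bounded[where C="C\<^sup>2"]) (use C in \<open>auto intro: power_mono\<close>)
  have "0 \<le> (\<integral>z. (norm (h z) - a)\<^sup>2 \<partial>torus_measure)" by simp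
  also have "\<dots> = (\<integral>z. (norm (h z))\<^sup>2 - 2 * a * norm (h z) + a\<^sup>2 \<partial>torus_measure)"
    by (simp add: power2_diff algebra_simps)
  also have "\<dots> = (\<integral>z. (norm (h z))\<^sup>2 \<partial>torus_measure) - 2 * a * a + a\<^sup>2"
    using i1 i2 by (simp add: a_def)
  finally have "a\<^sup>2 \<le> (\<integral>z. (norm (h z))\<^sup>2 \<partial>torus_measure)" by (simp add: power2_eq_square)
  moreover have "(norm (\<integral>z. h z \<partial>torus_measure))\<^sup>2 \<le> a\<^sup>2"
    unfolding a_def by (intro power_mono integral_norm_bound) auto
  ultimately show ?thesis
    using nn_integral_eq_integral[OF i2] by (simp add: ennreal_leI)
qed

lemma zmonom_minus: "zmonom (- \<alpha>) z = inverse (zmonom \<alpha> z)"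
  by (simp add: zmonom_def power_int_minus)

lemma cnj_zmonom: "cnj (zmonom \<alpha> z) = zmonom \<alpha> (cnj (fst z), cnj (snd z))"
  by (simp add: zmonom_def power_int_def)

lemma cnj_zmonom_torus: "z \<in> torus \<Longrightarrow> cnj (zmonom \<alpha> z) = zmonom (- \<alpha>) z"
  using norm_zmonom_torus[of z \<alpha>] complex_div_cnj[of 1 "zmonom \<alpha> z"]
  by (simp add: zmonom_minus divide_inverse)

lemma zmonom_cmul: "zmonom \<alpha> (a \<odot> b) = zmonom \<alpha> a * zmonom \<alpha> b"
  using zmonom_mult[of \<alpha> "fst a" "fst b" "snd a" "snd b"] by simp

text \<open>
  An enumeration of the exponents, so that the theorems on termwise integration of ordinary series
  apply to double Laurent series.
\<close>

definition lattice_enum :: "nat \<Rightarrow> int \<times> int" where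
  "lattice_enum = (SOME e. bij e)"

lemma bij_lattice_enum: "bij lattice_enum"
proof -
  have "infinite (UNIV :: (int \<times> int) set)"
    by (simp add: finite_prod infinite_UNIV_int)
  then obtain g :: "nat \<Rightarrow> int \<times> int" where "bij_betw g UNIV UNIV"
    by (rule countable_infiniteE'[OF countableI_type])
  then have "\<exists>e :: nat \<Rightarrow> int \<times> int. bij e" by blast
  then show ?thesis unfolding lattice_enum_def by (rule someI_ex)
qed

lemma has_sum_lattice_sums:
  fixes g :: "int \<times> int \<Rightarrow> 'a :: banach"
  assumes "(g has_sum S) UNIV" shows "(\<lambda>n. g (lattice_enum n)) sums S"
  using assms has_sum_reindex_bij_betw[OF bij_lattice_enum, of g S] by (intro has_sum_imp_sums) simp

lemma summable_on_lattice_summable: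
  fixes g :: "int \<times> int \<Rightarrow> 'a :: banach"
  assumes "g summable_on UNIV" shows "summable (\<lambda>n. g (lattice_enum n))"
  using has_sum_lattice_sums[OF has_sum_infsum[OF assms]] by (rule sums_summable)

context monomial_domain
begin

definition log_point :: "real \<Rightarrow> real \<Rightarrow> complex \<times> complex" where
  "log_point v1 v2 = (of_real (exp (- (real p * v1 + real q * v2))), of_real (exp (- (real r * v1 + real s * v2))))"

lemma twist_measurable: "holomorphic2_on f U \<Longrightarrow> twist f \<alpha> \<in> borel_measurable borel"
  unfolding twist_def using zero_ext_measurable by measurable

text \<open>
  Moving \<open>w\<close> parallel to the two edges of the cone, one after the other, reaches the point with cone
  coordinates \<open>(v1, v2)\<close> up to rotations of the coordinates.
\<close>

lemma torus_mean_twist_log_point: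
  assumes f: "holomorphic2_on f U" and w: "w \<in> U'"
    and u: "- ln (norm (fst w)) = real p * u1 + real q * u2" "- ln (norm (snd w)) = real r * u1 + real s * u2"
    and v: "u1 \<le> v1" "u2 \<le> v2"
  shows "torus_mean (twist f \<alpha>) w = torus_mean (twist f \<alpha>) (log_point v1 v2)"
proof -
  define \<rho>1 \<rho>2 where "\<rho>1 = exp (- (v1 - u1))" and "\<rho>2 = exp (- (v2 - u2))"
  define w1 where "w1 = (of_real \<rho>1 ^ p * fst w, of_real \<rho>1 ^ r * snd w)"
  define w2 where "w2 = (of_real \<rho>2 ^ q * fst w1, of_real \<rho>2 ^ s * snd w1)"
  have \<rho>: "0 < \<rho>1" "\<rho>1 \<le> 1" "0 < \<rho>2" "\<rho>2 \<le> 1" using v by (auto simp: \<rho>1_def \<rho>2_def)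
  have "torus_mean (twist f \<alpha>) w1 = torus_mean (twist f \<alpha>) w" and w1: "w1 \<in> U'"
    unfolding w1_def by (rule torus_mean_twist_step[OF f w], use \<rho> in auto)+
  moreover have "torus_mean (twist f \<alpha>) w2 = torus_mean (twist f \<alpha>) w1"
    unfolding w2_def by (rule torus_mean_twist_step(1)[OF f w1]) (use \<rho> in auto)
  moreover have "torus_mean (twist f \<alpha>) w2 = torus_mean (twist f \<alpha>) (log_point v1 v2)"
  proof (rule torus_mean_cong_norm[OF twist_measurable[OF f]])
    have nz: "fst w \<noteq> 0" "snd w \<noteq> 0" using w by (auto simp: U'_def)
    have n: "norm (fst w) = exp (- (real p * u1 + real q * u2))" "norm (snd w) = exp (- (real r * u1 + real s * u2))"
      using nz by (simp_all flip: u)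
    show "norm (fst w2) = norm (fst (log_point v1 v2))" "norm (snd w2) = norm (snd (log_point v1 v2))"
      by (simp_all add: w2_def w1_def log_point_def \<rho>1_def \<rho>2_def norm_mult norm_power n
            exp_of_nat_mult[symmetric] exp_add[symmetric] algebra_simps)
  qed
  ultimately show ?thesis by simp
qed

definition coeff :: "(complex \<times> complex \<Rightarrow> complex) \<Rightarrow> int \<times> int \<Rightarrow> complex" where
  "coeff f \<alpha> = torus_mean (twist f \<alpha>) (log_point 1 1)"

text \<open>
  Two points of the cone have a common point that is further inside in both edge directions, so the torus mean
  is the same everywhere; \<open>log_point 1 1\<close> is an arbitrary base point.
\<close>

lemma torus_mean_twist:
  assumes f: "holomorphic2_on f U" and w: "w \<in> U'"
  shows "torus_mean (twist f \<alpha>) w = coeff f \<alpha>"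
proof -
  obtain u1 u2 where u: "0 < u1" "0 < u2"
    "- ln (norm (fst w)) = real p * u1 + real q * u2" "- ln (norm (snd w)) = real r * u1 + real s * u2"
    by (rule log_coordinates[OF w])
  have lp: "log_point 1 1 \<in> U'"
  proof -
    have "fst (log_point 1 1) \<noteq> 0" "snd (log_point 1 1) \<noteq> 0" by (simp_all add: log_point_def)
    then show ?thesis
      using U_iff_ln[of "log_point 1 1"] det_pos
      by (simp add: U'_def log_point_def algebra_simps flip: of_nat_mult of_nat_add)
  qed
  have "torus_mean (twist f \<alpha>) w = torus_mean (twist f \<alpha>) (log_point (max u1 1) (max u2 1))"
    by (rule torus_mean_twist_log_point[OF f w u(3,4)]) auto
  also have "\<dots> = torus_mean (twist f \<alpha>) (log_point 1 1)"
    by (rule torus_mean_twist_log_point[OF f lp, symmetric, of 1 1]) (auto simp: log_point_def)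
  finally show ?thesis by (simp add: coeff_def)
qed

lemma fourier_coeff:
  assumes f: "holomorphic2_on f U" and w: "w \<in> U'"
  shows "(\<integral>\<zeta>. zero_ext f (\<zeta> \<odot> w) * zmonom (- \<alpha>) \<zeta> \<partial>torus_measure) = coeff f \<alpha> * zmonom \<alpha> w"
proof -
  have nz: "zmonom \<alpha> w \<noteq> 0" using w by (simp add: U'_def zmonom_def)
  have "coeff f \<alpha> = (\<integral>\<zeta>. inverse (zmonom \<alpha> w) * (zero_ext f (\<zeta> \<odot> w) * zmonom (- \<alpha>) \<zeta>) \<partial>torus_measure)"
    unfolding torus_mean_twist[OF f w, symmetric] torus_mean_def twist_def
    by (simp add: zmonom_cmul zmonom_minus mult_ac)
  also have "\<dots> = inverse (zmonom \<alpha> w) * (\<integral>\<zeta>. zero_ext f (\<zeta> \<odot> w) * zmonom (- \<alpha>) \<zeta> \<partial>torus_measure)"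
    by (rule integral_mult_right_zero)
  finally show ?thesis using nz by simp
qed

lemma zero_ext_rotate_measurable:
  assumes "holomorphic2_on f U" shows "(\<lambda>\<zeta>. zero_ext f (\<zeta> \<odot> w)) \<in> borel_measurable borel"
proof -
  have "(\<lambda>\<zeta>. \<zeta> \<odot> w) \<in> borel \<rightarrow>\<^sub>M borel" by (intro borel_measurable_continuous_onI continuous_intros)
  from measurable_compose[OF this zero_ext_measurable[OF assms]] show ?thesis .
qed

lemma zero_ext_rotate_continuous:
  assumes f: "holomorphic2_on f U" and w: "w \<in> U"
  shows "continuous_on torus (\<lambda>\<zeta>. zero_ext f (\<zeta> \<odot> w))"
proof -
  have "continuous_on torus (\<lambda>\<zeta>. f (\<zeta> \<odot> w))"
    by (rule continuous_on_compose2[OF holomorphic2_continuous_on[OF f]])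
       (use torus_U w in \<open>auto intro!: continuous_intros\<close>)
  then show ?thesis
    by (rule continuous_on_eq) (use torus_U w in \<open>auto simp: zero_ext_def\<close>)
qed

lemma zero_ext_rotate_bounded:
  assumes f: "holomorphic2_on f U" and w: "w \<in> U"
  obtains C where "\<And>\<zeta>. \<zeta> \<in> torus \<Longrightarrow> norm (zero_ext f (\<zeta> \<odot> w)) \<le> C"
proof -
  have "compact ((\<lambda>\<zeta>. zero_ext f (\<zeta> \<odot> w)) ` torus)"
    by (rule compact_continuous_image[OF zero_ext_rotate_continuous[OF f w] compact_torus])
  from compact_imp_bounded[OF this] show thesis
    using that by (auto simp: bounded_iff)
qed

section \<open>Laurent expansion in the Bergman space\<close>

definition energy :: "(complex \<times> complex \<Rightarrow> complex) \<Rightarrow> real" where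
  "energy f = (\<integral>z. (norm (zero_ext f z))\<^sup>2 \<partial>lborel)"

lemma bergman_integrable: "f \<in> bergman_space U \<Longrightarrow> integrable lborel (\<lambda>z. (norm (zero_ext f z))\<^sup>2)"
proof -
  assume "f \<in> bergman_space U"
  then have "integrable lborel (\<lambda>z. indicator U z *\<^sub>R (norm (f z))\<^sup>2)"
    by (simp add: bergman_space_def set_integrable_def)
  also have "(\<lambda>z. indicator U z *\<^sub>R (norm (f z))\<^sup>2) = (\<lambda>z. (norm (zero_ext f z))\<^sup>2)"
    by (auto simp: zero_ext_def)
  finally show ?thesis .
qed

lemma bergman_holomorphic: "f \<in> bergman_space U \<Longrightarrow> holomorphic2_on f U"
  by (simp add: bergman_space_def)

lemma AE_U': "AE z in lborel. z \<in> U \<longrightarrow> z \<in> U'"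
  using AE_nonzero by eventually_elim (simp add: U'_def)

text \<open>
  Bessel's inequality for a single monomial: on each torus the Fourier coefficient is bounded by the
  quadratic mean of \<open>f\<close>, and this is integrated over the domain.
\<close>

lemma coeff_energy:
  assumes fb: "f \<in> bergman_space U"
  shows "ennreal ((norm (coeff f \<alpha>))\<^sup>2) * (\<integral>\<^sup>+z. indicator U z * ennreal ((norm (zmonom \<alpha> z))\<^sup>2) \<partial>lborel) \<le> ennreal (energy f)"
proof -
  let ?A = "\<lambda>z. \<integral>\<^sup>+\<zeta>. ennreal ((norm (zero_ext f (\<zeta> \<odot> z)))\<^sup>2) \<partial>torus_measure"
  note f = bergman_holomorphic[OF fb]
  note [measurable] = zero_ext_measurable[OF f]
  have "ennreal ((norm (coeff f \<alpha>))\<^sup>2) * (\<integral>\<^sup>+z. indicator U z * ennreal ((norm (zmonom \<alpha> z))\<^sup>2) \<partial>lborel)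
     = (\<integral>\<^sup>+z. ennreal ((norm (coeff f \<alpha>))\<^sup>2) * (indicator U z * ennreal ((norm (zmonom \<alpha> z))\<^sup>2)) \<partial>lborel)"
    by (rule nn_integral_cmult[symmetric]) measurable
  also have "\<dots> \<le> (\<integral>\<^sup>+z. ?A z \<partial>lborel)"
  proof (rule nn_integral_mono_AE)
    show "AE z in lborel. ennreal ((norm (coeff f \<alpha>))\<^sup>2) * (indicator U z * ennreal ((norm (zmonom \<alpha> z))\<^sup>2)) \<le>
       ?A z"
      using AE_U'
    proof eventually_elim
      case (elim z)
      show ?case
      proof (cases "z \<in> U")
        case True
        then have z: "z \<in> U'" using elim by simp
        obtain C where C: "\<And>\<zeta>. \<zeta> \<in> torus \<Longrightarrow> norm (zero_ext f (\<zeta> \<odot> z)) \<le> C"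
          by (rule zero_ext_rotate_bounded[OF f True]) (rule that)
        note [measurable] = zero_ext_rotate_measurable[OF f, of z]
        have "ennreal ((norm (coeff f \<alpha>))\<^sup>2) * (indicator U z * ennreal ((norm (zmonom \<alpha> z))\<^sup>2))
           = ennreal ((norm (\<integral>\<zeta>. zero_ext f (\<zeta> \<odot> z) * zmonom (- \<alpha>) \<zeta> \<partial>torus_measure))\<^sup>2)"
          using True by (simp add: fourier_coeff[OF f z] norm_mult power_mult_distrib ennreal_mult')
        also have "\<dots> \<le> (\<integral>\<^sup>+\<zeta>. ennreal ((norm (zero_ext f (\<zeta> \<odot> z) * zmonom (- \<alpha>) \<zeta>))\<^sup>2) \<partial>torus_measure)"
          by (rule norm_integral_torus_squared_le[where C=C]) (auto simp: norm_mult norm_zmonom_torus C)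
        also have "\<dots> = ?A z"
          by (rule nn_integral_cong_AE) (use AE_torus in \<open>auto elim!: eventually_mono simp: norm_mult norm_zmonom_torus\<close>)
        finally show ?thesis .
      qed simp
    qed
  qed
  also have "\<dots> = (\<integral>\<^sup>+z. ennreal ((norm (zero_ext f z))\<^sup>2) \<partial>lborel)"
    by (rule nn_integral_torus_average) measurable
  also have "\<dots> = ennreal (energy f)"
    unfolding energy_def by (rule nn_integral_eq_integral[OF bergman_integrable[OF fb]]) simp
  finally show ?thesis .
qed

lemma coeff_zero:
  assumes "f \<in> bergman_space U" "\<alpha> \<notin> I" shows "coeff f \<alpha> = 0"
proof (rule ccontr)
  assume "coeff f \<alpha> \<noteq> 0"
  then have "ennreal ((norm (coeff f \<alpha>))\<^sup>2) * \<infinity> = \<infinity>" by (simp add: ennreal_mult_top)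
  then show False using coeff_energy[OF assms(1), of \<alpha>] assms(2) by (simp add: nn_integral_zmonom top_unique)
qed

definition sqnorm :: "int \<times> int \<Rightarrow> real" where
  "sqnorm \<alpha> = pi\<^sup>2 * of_int d / (of_int (deg1 \<alpha>) * of_int (deg2 \<alpha>))"

definition kcoef :: "int \<times> int \<Rightarrow> real" where
  "kcoef \<alpha> = of_int (weight \<alpha>) / (pi\<^sup>2 * of_int d)"

lemma kcoef_I: "\<alpha> \<in> I \<Longrightarrow> kcoef \<alpha> = 1 / sqnorm \<alpha> \<and> sqnorm \<alpha> > 0"
  using d_pos by (simp add: kcoef_def sqnorm_def weight_def I_def max_def)

lemma kcoef_not_I: "\<alpha> \<notin> I \<Longrightarrow> kcoef \<alpha> = 0"
  by (auto simp: kcoef_def weight_def I_def)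

lemma kcoef_nonneg: "kcoef \<alpha> \<ge> 0"
  using d_pos by (simp add: kcoef_def weight_def)

text \<open>
  The energy bound gives \<open>\<bar>coeff f \<alpha>\<bar>\<^sup>2 \<le> E * weight \<alpha>\<close> with a constant \<open>E\<close>; as nonzero weights are at least
  1, \<open>x \<le> 1 + x\<^sup>2\<close> gives a bound by the weight itself, which suffices for summability.
\<close>

lemma coeff_bound:
  assumes fb: "f \<in> bergman_space U"
  obtains M where "\<And>\<alpha>. norm (coeff f \<alpha>) \<le> M * of_int (weight \<alpha>)"
proof (rule that)
  let ?M = "1 + energy f / (pi\<^sup>2 * of_int d)"
  have E0: "energy f \<ge> 0" by (simp add: energy_def)
  show "norm (coeff f \<alpha>) \<le> ?M * of_int (weight \<alpha>)" for \<alpha>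
  proof (cases "\<alpha> \<in> I")
    case False
    then show ?thesis using coeff_zero[OF fb False] by (auto simp: I_def weight_def)
  next
    case True
    have "ennreal ((norm (coeff f \<alpha>))\<^sup>2 * sqnorm \<alpha>) \<le> ennreal (energy f)"
      using coeff_energy[OF fb, of \<alpha>] True
      by (simp only: nn_integral_zmonom if_True sqnorm_def[symmetric] ennreal_mult'[OF zero_le_power2])
    then have "(norm (coeff f \<alpha>))\<^sup>2 * sqnorm \<alpha> \<le> energy f" using E0 by simp
    then have "(norm (coeff f \<alpha>))\<^sup>2 \<le> energy f * kcoef \<alpha>"
      using kcoef_I[OF True] by (simp add: field_simps)
    also have "\<dots> = energy f / (pi\<^sup>2 * of_int d) * of_int (weight \<alpha>)" by (simp add: kcoef_def)
    finally have c2: "(norm (coeff f \<alpha>))\<^sup>2 \<le> energy f / (pi\<^sup>2 * of_int d) * of_int (weight \<alpha>)" .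
    have "1 \<le> weight \<alpha>" using True by (simp add: weight_def I_def max_def) (smt (verit) mult_pos_pos)
    then have w1: "1 \<le> real_of_int (weight \<alpha>)" by simp
    have "0 \<le> (norm (coeff f \<alpha>) - 1)\<^sup>2" by simp
    then have "2 * norm (coeff f \<alpha>) \<le> 1 + (norm (coeff f \<alpha>))\<^sup>2" by (simp add: power2_diff)
    then have "norm (coeff f \<alpha>) \<le> 1 + (norm (coeff f \<alpha>))\<^sup>2"
      using norm_ge_zero[of "coeff f \<alpha>"] by linarith
    then show ?thesis using c2 w1 by (simp add: distrib_right)
  qed
qed

lemma summable_weight: "z \<in> U \<Longrightarrow> summable (\<lambda>n. of_int (weight (lattice_enum n)) * norm (zmonom (lattice_enum n) z))"
  using summable_on_lattice_summable[OF summable_weights] by simp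

lemma summable_coeff:
  assumes "f \<in> bergman_space U" "z \<in> U"
  shows "summable (\<lambda>n. norm (coeff f (lattice_enum n) * zmonom (lattice_enum n) z))"
proof -
  obtain M where M: "\<And>\<alpha>. norm (coeff f \<alpha>) \<le> M * of_int (weight \<alpha>)"
    by (rule coeff_bound[OF assms(1)]) (rule that)
  show ?thesis
    by (rule summable_comparison_test'[OF summable_mult[OF summable_weight[OF assms(2)], of M], of 0])
       (auto simp: norm_mult mult.assoc[symmetric] simp del: split_paired_All intro!: mult_right_mono M)
qed

text \<open>
  On the torus through \<open>w\<close> both \<open>f\<close> and the absolutely convergent Laurent series are continuous with the
  same Fourier coefficients.
\<close>

lemma expansion_nonzero:
  assumes fb: "f \<in> bergman_space U" and w: "w \<in> U'"
  shows "(\<Sum>n. coeff f (lattice_enum n) * zmonom (lattice_enum n) w) = f w"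
proof -
  note f = bergman_holomorphic[OF fb]
  note [measurable] = zero_ext_rotate_measurable[OF f, of w]
  let ?a = "\<lambda>n. coeff f (lattice_enum n) * zmonom (lattice_enum n) w"
  let ?b = "\<lambda>n \<zeta>. ?a n * zmonom (lattice_enum n) \<zeta>"
  define S where "S \<zeta> = (\<Sum>n. ?b n \<zeta>)" for \<zeta>
  have sm: "summable (\<lambda>n. norm (?a n))" by (rule summable_coeff[OF fb U'_U[OF w]])
  have nt: "norm (?b n \<zeta>) \<le> norm (?a n)" if "\<zeta> \<in> torus" for n \<zeta>
    using that by (simp add: norm_mult norm_zmonom_torus)
  have [measurable]: "S \<in> borel_measurable borel" unfolding S_def by measurable
  have contS: "continuous_on torus S"
  proof (rule uniform_limit_theorem)
    show "uniform_limit torus (\<lambda>n \<zeta>. \<Sum>i<n. ?a i * zmonom (lattice_enum i) \<zeta>) S sequentially"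
      unfolding S_def by (rule Weierstrass_m_test[OF nt sm])
    show "\<forall>\<^sub>F n in sequentially. continuous_on torus (\<lambda>\<zeta>. \<Sum>i<n. ?a i * zmonom (lattice_enum i) \<zeta>)"
      unfolding zmonom_def
      by (intro always_eventually allI continuous_intros) (auto simp: mem_torus)
  qed simp
  have "(\<integral>\<zeta>. (zero_ext f (\<zeta> \<odot> w) - S \<zeta>) * zmonom \<beta> \<zeta> \<partial>torus_measure) = 0" for \<beta>
  proof -
    obtain C where C: "\<And>\<zeta>. \<zeta> \<in> torus \<Longrightarrow> norm (zero_ext f (\<zeta> \<odot> w)) \<le> C"
      by (rule zero_ext_rotate_bounded[OF f U'_U[OF w]]) (rule that)
    have i1: "integrable torus_measure (\<lambda>\<zeta>. zero_ext f (\<zeta> \<odot> w) * zmonom \<beta> \<zeta>)"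
      by (rule integrable_torus_bounded[where C=C]) (auto simp: norm_mult norm_zmonom_torus C)
    have it: "integrable torus_measure (\<lambda>\<zeta>. ?b n \<zeta> * zmonom \<beta> \<zeta>)" for n
      by (rule integrable_torus_bounded[where C="norm (?a n)"]) (auto simp: norm_mult norm_zmonom_torus)
    have nrm: "norm (?b n \<zeta> * zmonom \<beta> \<zeta>) = norm (?a n)" if "\<zeta> \<in> torus" for n \<zeta>
      using that by (simp add: norm_mult norm_zmonom_torus)
    have sAE: "AE \<zeta> in torus_measure. summable (\<lambda>n. norm (?b n \<zeta> * zmonom \<beta> \<zeta>))"
      using AE_torus by eventually_elim (simp only: nrm sm)
    have "(\<integral>\<zeta>. norm (?b n \<zeta> * zmonom \<beta> \<zeta>) \<partial>torus_measure) = (\<integral>\<zeta>. norm (?a n) \<partial>torus_measure)" for n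
      by (rule integral_cong_AE) (use AE_torus nrm in \<open>auto elim!: eventually_mono\<close>)
    then have si: "summable (\<lambda>n. (\<integral>\<zeta>. norm (?b n \<zeta> * zmonom \<beta> \<zeta>) \<partial>torus_measure))"
      using sm by simp
    have eqS: "(\<integral>\<zeta>. (\<Sum>n. ?b n \<zeta> * zmonom \<beta> \<zeta>) \<partial>torus_measure) = (\<integral>\<zeta>. S \<zeta> * zmonom \<beta> \<zeta> \<partial>torus_measure)"
    proof (rule integral_torus_cong)
      fix \<zeta> assume "\<zeta> \<in> torus"
      then have "summable (\<lambda>n. ?b n \<zeta>)"
        using nt by (intro summable_comparison_test'[OF sm, of 0]) auto
      then show "(\<Sum>n. ?b n \<zeta> * zmonom \<beta> \<zeta>) = S \<zeta> * zmonom \<beta> \<zeta>"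
        unfolding S_def by (rule suminf_mult2[symmetric])
    qed measurable
    have i2: "integrable torus_measure (\<lambda>\<zeta>. S \<zeta> * zmonom \<beta> \<zeta>)"
    proof (rule integrable_torus_bounded[where C="\<Sum>n. norm (?a n)"])
      fix \<zeta> assume z: "\<zeta> \<in> torus"
      have "summable (\<lambda>n. norm (?b n \<zeta>))"
        using nt[OF z] by (intro summable_comparison_test'[OF sm, of 0]) auto
      then have "norm (S \<zeta>) \<le> (\<Sum>n. norm (?b n \<zeta>))"
        unfolding S_def by (rule summable_norm)
      also have "\<dots> = (\<Sum>n. norm (?a n))" using z by (simp add: norm_mult norm_zmonom_torus)
      finally show "norm (S \<zeta> * zmonom \<beta> \<zeta>) \<le> (\<Sum>n. norm (?a n))"
        using z by (simp add: norm_mult norm_zmonom_torus)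
    qed measurable
    obtain m where m: "lattice_enum m = - \<beta>" using bij_lattice_enum by (metis bij_pointE)
    have m': "lattice_enum n = - \<beta> \<longleftrightarrow> n = m" for n
      using m bij_lattice_enum by (metis bij_is_inj injD)
    have trm: "(\<integral>\<zeta>. ?b n \<zeta> * zmonom \<beta> \<zeta> \<partial>torus_measure) = (if n = m then ?a m else 0)" for n
    proof -
      have "(\<integral>\<zeta>. ?b n \<zeta> * zmonom \<beta> \<zeta> \<partial>torus_measure) = (\<integral>\<zeta>. ?a n * zmonom (lattice_enum n + \<beta>) \<zeta> \<partial>torus_measure)"
        by (rule integral_torus_cong) (auto simp: zmonom_add mult.assoc)
      also have "\<dots> = ?a n * (if lattice_enum n + \<beta> = (0, 0) then 1 else 0)"
        by (simp add: integral_torus_zmonom)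
      also have "lattice_enum n + \<beta> = (0, 0) \<longleftrightarrow> lattice_enum n = - \<beta>"
        by (simp add: eq_neg_iff_add_eq_0 zero_prod_def)
      finally show ?thesis by (simp add: m')
    qed
    have "(\<integral>\<zeta>. S \<zeta> * zmonom \<beta> \<zeta> \<partial>torus_measure) = (\<Sum>n. (\<integral>\<zeta>. ?b n \<zeta> * zmonom \<beta> \<zeta> \<partial>torus_measure))"
      unfolding eqS[symmetric] by (rule integral_suminf[OF it sAE si])
    also have "\<dots> = ?a m"
      unfolding trm using sums_If_finite_set[of "{m}" "\<lambda>_. ?a m"] by (simp add: sums_iff)
    also have "\<dots> = (\<integral>\<zeta>. zero_ext f (\<zeta> \<odot> w) * zmonom \<beta> \<zeta> \<partial>torus_measure)"
      using fourier_coeff[OF f w, of "- \<beta>"] by (simp add: m)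
    finally show ?thesis using i1 i2 by (simp add: left_diff_distrib)
  qed
  note zero = this
  have "continuous_on torus (\<lambda>\<zeta>. zero_ext f (\<zeta> \<odot> w) - S \<zeta>)"
    by (rule continuous_on_diff[OF zero_ext_rotate_continuous[OF f U'_U[OF w]] contS])
  moreover have "(1, 1) \<in> torus" by (simp add: mem_torus)
  moreover have "(\<lambda>\<zeta>. zero_ext f (\<zeta> \<odot> w) - S \<zeta>) \<in> borel_measurable borel" by measurable
  ultimately have "zero_ext f ((1, 1) \<odot> w) - S (1, 1) = 0"
    using torus_fourier_unique[where F="\<lambda>\<zeta>. zero_ext f (\<zeta> \<odot> w) - S \<zeta>" and w="(1, 1)"] zero by blast
  then show ?thesis using U'_U[OF w] by (simp add: zero_ext_def S_def zmonom_def)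
qed

text \<open>
  At points with a zero coordinate both sides are limits along nearby points without zero coordinates;
  for the series this is dominated convergence.
\<close>

lemma expansion:
  assumes fb: "f \<in> bergman_space U" and w: "w \<in> U"
  shows "(\<Sum>n. coeff f (lattice_enum n) * zmonom (lattice_enum n) w) = f w"
proof -
  obtain v where v: "\<And>k. v k \<in> U" "\<And>k. fst (v k) \<noteq> 0" "\<And>k. snd (v k) \<noteq> 0" "v \<longlonglongrightarrow> w"
    "\<And>k \<alpha>. \<alpha> \<in> I \<Longrightarrow> norm (zmonom \<alpha> (v k)) \<le> norm (zmonom \<alpha> (v 0))"
    "\<And>\<alpha>. \<alpha> \<in> I \<Longrightarrow> norm (zmonom \<alpha> w) \<le> norm (zmonom \<alpha> (v 0))"
    using approach_nonzero[OF w] by metis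
  let ?t = "\<lambda>n z. coeff f (lattice_enum n) * zmonom (lattice_enum n) z"
  have lim: "(\<lambda>k. ?t n (v k)) \<longlonglongrightarrow> ?t n w" for n
  proof (cases "lattice_enum n \<in> I")
    case True
    have "(\<lambda>k. zmonom (lattice_enum n) (v k)) \<longlonglongrightarrow> zmonom (lattice_enum n) w"
      unfolding zmonom_def
      using tendsto_fst[OF v(4)] tendsto_snd[OF v(4)] I_nonneg1[OF w _ True] I_nonneg2[OF w _ True]
      by (intro tendsto_mult tendsto_power_int') auto
    then show ?thesis by (intro tendsto_intros)
  qed (simp add: coeff_zero[OF fb])
  have bd: "norm (?t n (v k)) \<le> norm (?t n (v 0))" for n k
    using v(5)[of "lattice_enum n" k] coeff_zero[OF fb, of "lattice_enum n"]
    by (cases "lattice_enum n \<in> I") (auto simp: norm_mult intro!: mult_left_mono)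
  have "(\<lambda>k. \<Sum>n. ?t n (v k)) \<longlonglongrightarrow> (\<Sum>n. ?t n w)"
    using tannerys_theorem[where a="\<lambda>n k. ?t n (v k)" and b="\<lambda>n. ?t n w" and M="\<lambda>n. norm (?t n (v 0))" and F=sequentially]
      lim bd summable_coeff[OF fb v(1)] by (auto simp: case_prod_unfold)
  moreover have "(\<Sum>n. ?t n (v k)) = f (v k)" for k
    by (rule expansion_nonzero[OF fb]) (simp add: U'_def v)
  moreover have "(\<lambda>k. f (v k)) \<longlonglongrightarrow> f w"
    by (rule continuous_on_tendsto_compose[OF holomorphic2_continuous_on[OF bergman_holomorphic[OF fb]] v(4) w]) (simp add: v)
  ultimately show ?thesis using LIMSEQ_unique by simp
qed

end

section \<open>Tools for holomorphic functions and reproducing kernels\<close>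

lemma holomorphic2_on_const: "holomorphic2_on (\<lambda>z. c) \<Omega>"
  unfolding holomorphic2_on_def
  by (intro ballI exI[of _ 0]) (auto intro!: derivative_eq_intros)

lemma holomorphic2_on_fst: "holomorphic2_on fst \<Omega>"
  unfolding holomorphic2_on_def
  by (intro ballI exI[of _ 1] exI[of _ 0]) (auto intro!: derivative_eq_intros)

lemma holomorphic2_on_snd: "holomorphic2_on snd \<Omega>"
  unfolding holomorphic2_on_def
  by (intro ballI exI[of _ 0] exI[of _ 1]) (auto intro!: derivative_eq_intros)

lemma holomorphic2_on_add:
  assumes "holomorphic2_on f \<Omega>" "holomorphic2_on g \<Omega>"
  shows "holomorphic2_on (\<lambda>z. f z + g z) \<Omega>"
  unfolding holomorphic2_on_def
proof
  fix z assume z: "z \<in> \<Omega>"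
  obtain a b where f: "(f has_derivative (\<lambda>h. a * fst h + b * snd h)) (at z within \<Omega>)"
    using assms(1) z unfolding holomorphic2_on_def by blast
  obtain a' b' where g: "(g has_derivative (\<lambda>h. a' * fst h + b' * snd h)) (at z within \<Omega>)"
    using assms(2) z unfolding holomorphic2_on_def by blast
  have "((\<lambda>z. f z + g z) has_derivative (\<lambda>h. (a + a') * fst h + (b + b') * snd h)) (at z within \<Omega>)"
    using has_derivative_add[OF f g] by (simp add: algebra_simps)
  then show "\<exists>a b. ((\<lambda>z. f z + g z) has_derivative (\<lambda>h. a * fst h + b * snd h)) (at z within \<Omega>)" by blast
qed

lemma holomorphic2_on_mult:
  assumes "holomorphic2_on f \<Omega>" "holomorphic2_on g \<Omega>"
  shows "holomorphic2_on (\<lambda>z. f z * g z) \<Omega>"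
  unfolding holomorphic2_on_def
proof
  fix z assume z: "z \<in> \<Omega>"
  obtain a b where f: "(f has_derivative (\<lambda>h. a * fst h + b * snd h)) (at z within \<Omega>)"
    using assms(1) z unfolding holomorphic2_on_def by blast
  obtain a' b' where g: "(g has_derivative (\<lambda>h. a' * fst h + b' * snd h)) (at z within \<Omega>)"
    using assms(2) z unfolding holomorphic2_on_def by blast
  have "((\<lambda>z. f z * g z) has_derivative (\<lambda>h. (f z * a' + a * g z) * fst h + (f z * b' + b * g z) * snd h)) (at z within \<Omega>)"
    using has_derivative_mult[OF f g] by (simp add: algebra_simps)
  then show "\<exists>a b. ((\<lambda>z. f z * g z) has_derivative (\<lambda>h. a * fst h + b * snd h)) (at z within \<Omega>)" by blast
qed

lemma holomorphic2_on_inverse: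
  assumes "holomorphic2_on f \<Omega>" "\<And>z. z \<in> \<Omega> \<Longrightarrow> f z \<noteq> 0"
  shows "holomorphic2_on (\<lambda>z. inverse (f z)) \<Omega>"
  unfolding holomorphic2_on_def
proof
  fix z assume z: "z \<in> \<Omega>"
  obtain a b where f: "(f has_derivative (\<lambda>h. a * fst h + b * snd h)) (at z within \<Omega>)"
    using assms(1) z unfolding holomorphic2_on_def by blast
  let ?i = "inverse (f z)"
  have "((\<lambda>z. inverse (f z)) has_derivative (\<lambda>h. (- (?i * a * ?i)) * fst h + (- (?i * b * ?i)) * snd h)) (at z within \<Omega>)"
    using Deriv.has_derivative_inverse[OF assms(2)[OF z] f] by (simp add: algebra_simps)
  then show "\<exists>a b. ((\<lambda>z. inverse (f z)) has_derivative (\<lambda>h. a * fst h + b * snd h)) (at z within \<Omega>)" by blast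
qed

lemma holomorphic2_on_diff:
  assumes "holomorphic2_on f \<Omega>" "holomorphic2_on g \<Omega>"
  shows "holomorphic2_on (\<lambda>z. f z - g z) \<Omega>"
  using holomorphic2_on_add[OF assms(1) holomorphic2_on_mult[OF holomorphic2_on_const[of "-1"] assms(2)]] by simp

lemma holomorphic2_on_divide:
  assumes "holomorphic2_on f \<Omega>" "holomorphic2_on g \<Omega>" "\<And>z. z \<in> \<Omega> \<Longrightarrow> g z \<noteq> 0"
  shows "holomorphic2_on (\<lambda>z. f z / g z) \<Omega>"
  unfolding divide_inverse by (intro holomorphic2_on_mult holomorphic2_on_inverse assms)

lemma holomorphic2_on_power: "holomorphic2_on f \<Omega> \<Longrightarrow> holomorphic2_on (\<lambda>z. f z ^ n) \<Omega>"
  by (induction n) (simp_all add: holomorphic2_on_const holomorphic2_on_mult)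

lemma holomorphic2_on_sum:
  "finite X \<Longrightarrow> (\<And>x. x \<in> X \<Longrightarrow> holomorphic2_on (f x) \<Omega>) \<Longrightarrow> holomorphic2_on (\<lambda>z. \<Sum>x\<in>X. f x z) \<Omega>"
  by (induction X rule: finite_induct) (simp_all add: holomorphic2_on_const holomorphic2_on_add)

lemmas holomorphic2_intros = holomorphic2_on_const holomorphic2_on_fst holomorphic2_on_snd
  holomorphic2_on_add holomorphic2_on_mult holomorphic2_on_diff holomorphic2_on_divide holomorphic2_on_power holomorphic2_on_sum

lemma holomorphic2_on_cong:
  assumes "holomorphic2_on f \<Omega>" "\<And>z. z \<in> \<Omega> \<Longrightarrow> g z = f z"
  shows "holomorphic2_on g \<Omega>"
  unfolding holomorphic2_on_def
proof
  fix z assume z: "z \<in> \<Omega>"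
  obtain a b where "(f has_derivative (\<lambda>h. a * fst h + b * snd h)) (at z within \<Omega>)"
    using assms(1) z unfolding holomorphic2_on_def by blast
  then have "(g has_derivative (\<lambda>h. a * fst h + b * snd h)) (at z within \<Omega>)"
    by (rule has_derivative_transform[OF z assms(2), rotated])
  then show "\<exists>a b. (g has_derivative (\<lambda>h. a * fst h + b * snd h)) (at z within \<Omega>)" by blast
qed

text \<open>
  Reproducing \<open>k' _ w\<close> by \<open>k\<close> and \<open>k _ z\<close> by \<open>k'\<close> leads to complex conjugate integrals, hence
  \<open>k' z w = cnj (k w z)\<close>. This holds for \<open>k' = k\<close> as well, and the two identities give \<open>k' = k\<close>.
\<close>

lemma reproducing_kernel_unique:
  assumes K: "reproducing_kernel \<Omega> K" and K': "reproducing_kernel \<Omega> K'" and z: "z \<in> \<Omega>" and w: "w \<in> \<Omega>"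
  shows "K z w = K' z w"
proof -
  have flip: "k' z w = cnj (k w z)" if k: "reproducing_kernel \<Omega> k" and k': "reproducing_kernel \<Omega> k'" for k k'
  proof -
    have mem: "(\<lambda>x. k x z) \<in> bergman_space \<Omega>" "(\<lambda>x. k' x w) \<in> bergman_space \<Omega>"
      using k k' z w unfolding reproducing_kernel_def by auto
    have rep: "\<forall>f\<in>bergman_space \<Omega>. f z = (LINT x:\<Omega>|lborel. f x * cnj (k x z))"
      "\<forall>f\<in>bergman_space \<Omega>. f w = (LINT x:\<Omega>|lborel. f x * cnj (k' x w))"
      using k k' z w unfolding reproducing_kernel_def by auto
    have "k' z w = (LINT x:\<Omega>|lborel. k' x w * cnj (k x z))" "k w z = (LINT x:\<Omega>|lborel. k x z * cnj (k' x w))"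
      using bspec[OF rep(1) mem(2)] bspec[OF rep(2) mem(1)] by simp_all
    moreover have "cnj (LINT x:\<Omega>|lborel. k x z * cnj (k' x w)) = (LINT x:\<Omega>|lborel. k' x w * cnj (k x z))"
    proof -
      have "cnj (LINT x|lborel. indicator \<Omega> x *\<^sub>R (k x z * cnj (k' x w)))
          = (LINT x|lborel. cnj (indicator \<Omega> x *\<^sub>R (k x z * cnj (k' x w))))"
        by (rule Bochner_Integration.integral_cnj[symmetric])
      also have "\<dots> = (LINT x|lborel. indicator \<Omega> x *\<^sub>R (k' x w * cnj (k x z)))"
        by (rule Bochner_Integration.integral_cong) (simp_all add: mult.commute)
      finally show ?thesis unfolding set_lebesgue_integral_def .
    qed
    ultimately show ?thesis by simp
  qed
  show ?thesis using flip[OF K K] flip[OF K K'] by simp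
qed

lemma suminf_cauchy_schwarz:
  fixes a b :: "nat \<Rightarrow> real"
  assumes a: "\<And>n. 0 \<le> a n" and sa: "summable a" and sab: "summable (\<lambda>n. a n * (b n)\<^sup>2)"
  shows "summable (\<lambda>n. a n * b n)" "(\<Sum>n. a n * b n)\<^sup>2 \<le> (\<Sum>n. a n) * (\<Sum>n. a n * (b n)\<^sup>2)"
proof -
  have "norm (a n * b n) \<le> a n + a n * (b n)\<^sup>2" for n
  proof -
    have "0 \<le> (\<bar>b n\<bar> - 1)\<^sup>2" by simp
    then have "2 * \<bar>b n\<bar> \<le> 1 + (b n)\<^sup>2" by (simp add: power2_diff)
    then have "\<bar>b n\<bar> \<le> 1 + (b n)\<^sup>2" using abs_ge_zero[of "b n"] by linarith
    from mult_left_mono[OF this a[of n]] show ?thesis using a[of n] by (simp add: abs_mult distrib_left)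
  qed
  then show s: "summable (\<lambda>n. a n * b n)"
    by (intro summable_comparison_test'[OF summable_add[OF sa sab], of 0])
  have "(\<lambda>n. (\<Sum>i<n. a i * b i)\<^sup>2) \<longlonglongrightarrow> (\<Sum>n. a n * b n)\<^sup>2"
    by (intro tendsto_power summable_LIMSEQ s)
  moreover have "(\<Sum>i<n. a i * b i)\<^sup>2 \<le> (\<Sum>n. a n) * (\<Sum>n. a n * (b n)\<^sup>2)" for n
  proof -
    have "(\<Sum>i<n. a i * b i)\<^sup>2 = (\<Sum>i<n. sqrt (a i) * (sqrt (a i) * b i))\<^sup>2"
      using a by (simp add: mult.assoc[symmetric])
    also have "\<dots> \<le> (\<Sum>i<n. (sqrt (a i))\<^sup>2) * (\<Sum>i<n. (sqrt (a i) * b i)\<^sup>2)"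
      by (rule Cauchy_Schwarz_ineq_sum)
    also have "\<dots> = (\<Sum>i<n. a i) * (\<Sum>i<n. a i * (b i)\<^sup>2)"
      using a by (simp add: power_mult_distrib)
    also have "\<dots> \<le> (\<Sum>n. a n) * (\<Sum>n. a n * (b n)\<^sup>2)"
      using a by (intro mult_mono sum_le_suminf sa sab suminf_nonneg sum_nonneg) auto
    finally show ?thesis .
  qed
  ultimately show "(\<Sum>n. a n * b n)\<^sup>2 \<le> (\<Sum>n. a n) * (\<Sum>n. a n * (b n)\<^sup>2)"
    by (intro LIMSEQ_le_const2) auto
qed

section \<open>The kernel of the domain\<close>

abbreviation cnj2 :: "complex \<times> complex \<Rightarrow> complex \<times> complex" where
  "cnj2 w \<equiv> (cnj (fst w), cnj (snd w))"

context monomial_domain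
begin

lemma cmul_U: "z \<in> U \<Longrightarrow> w \<in> U \<Longrightarrow> z \<odot> w \<in> U"
  by (auto simp: U_def norm_mult power_mult_distrib intro!: mult_strict_mono')

lemma cnj2_U: "w \<in> U \<Longrightarrow> cnj2 w \<in> U"
  by (simp add: U_def)

definition kernel :: "complex \<times> complex \<Rightarrow> complex \<times> complex \<Rightarrow> complex" where
  "kernel z w = (\<Sum>n. of_real (kcoef (lattice_enum n)) * zmonom (lattice_enum n) (z \<odot> cnj2 w))"

definition kernel_fraction :: "complex \<times> complex \<Rightarrow> complex" where
  "kernel_fraction t = 1 / (of_real (pi\<^sup>2) * of_int d) *
     (gpoly t / ((snd t ^ q - fst t ^ s)\<^sup>2 * (fst t ^ r - snd t ^ p)\<^sup>2))"

lemma kernel_sums: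
  assumes t: "t \<in> U"
  shows "(\<lambda>n. of_real (kcoef (lattice_enum n)) * zmonom (lattice_enum n) t) sums kernel_fraction t"
proof -
  have weight_nonneg: "0 \<le> weight \<alpha>" for \<alpha> by (simp add: weight_def)
  have "(\<lambda>\<alpha>. norm (of_int (weight \<alpha>) * zmonom \<alpha> t)) summable_on UNIV"
    using summable_weights[OF t] weight_nonneg by (simp add: norm_mult)
  then have "(\<lambda>\<alpha>. of_int (weight \<alpha>) * zmonom \<alpha> t) summable_on UNIV"
    by (rule abs_summable_summable)
  then obtain S where S: "((\<lambda>\<alpha>. of_int (weight \<alpha>) * zmonom \<alpha> t) has_sum S) UNIV"
    unfolding summable_on_def by blast
  have "(\<lambda>n. 1 / (of_real (pi\<^sup>2) * of_int d) * (of_int (weight (lattice_enum n)) * zmonom (lattice_enum n) t)) sums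
     (1 / (of_real (pi\<^sup>2) * of_int d) * S)"
    by (intro sums_mult has_sum_lattice_sums[OF S])
  then show ?thesis
    unfolding kernel_fraction_def weighted_series_closed_form[OF S t, symmetric]
    by (simp add: kcoef_def)
qed

lemma kernel_eq_fraction: "z \<in> U \<Longrightarrow> w \<in> U \<Longrightarrow> kernel z w = kernel_fraction (z \<odot> cnj2 w)"
  unfolding kernel_def by (rule sums_unique[symmetric, OF kernel_sums]) (intro cmul_U cnj2_U)

lemma kernel_fraction_holomorphic: "holomorphic2_on kernel_fraction U"
proof -
  let ?X = "{0..2 * int r + 2 * int s - 2} \<times> {0..2 * int p + 2 * int q - 2}"
  define h where "h t = (\<Sum>\<gamma>\<in>?X. of_int (gcoef \<gamma>) * (fst t ^ nat (fst \<gamma>) * snd t ^ nat (snd \<gamma>)))" for t :: "complex \<times> complex"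
  have "holomorphic2_on (\<lambda>t. 1 / (of_real (pi\<^sup>2) * of_int d) *
      (h t / ((snd t ^ q - fst t ^ s)\<^sup>2 * (fst t ^ r - snd t ^ p)\<^sup>2))) U"
    unfolding h_def by (intro holomorphic2_intros) (use denominators_nonzero in auto)
  moreover have "gpoly t = h t" for t
    unfolding gpoly_def h_def by (rule sum.cong) (auto simp: zmonom_def power_int_def)
  ultimately show ?thesis
    unfolding kernel_fraction_def by simp
qed

lemma kernel_holomorphic:
  assumes w: "w \<in> U" shows "holomorphic2_on (\<lambda>z. kernel z w) U"
proof -
  have "holomorphic2_on (\<lambda>z. kernel_fraction (z \<odot> cnj2 w)) U"
    unfolding holomorphic2_on_def
  proof
    fix z assume z: "z \<in> U"
    then have zw: "z \<odot> cnj2 w \<in> U" by (intro cmul_U cnj2_U w)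
    obtain a b where "(kernel_fraction has_derivative (\<lambda>h. a * fst h + b * snd h)) (at (z \<odot> cnj2 w) within U)"
      using kernel_fraction_holomorphic zw unfolding holomorphic2_on_def by blast
    then have "(kernel_fraction has_derivative (\<lambda>h. a * fst h + b * snd h)) (at (z \<odot> cnj2 w))"
      using at_within_open[OF zw open_U] by simp
    moreover have "((\<lambda>z. z \<odot> cnj2 w) has_derivative (\<lambda>h. h \<odot> cnj2 w)) (at z within U)"
      by (auto intro!: derivative_eq_intros)
    ultimately have "((\<lambda>z. kernel_fraction (z \<odot> cnj2 w)) has_derivative (\<lambda>h. a * fst (h \<odot> cnj2 w) + b * snd (h \<odot> cnj2 w))) (at z within U)"
      by (rule has_derivative_compose[rotated])
    then have "((\<lambda>z. kernel_fraction (z \<odot> cnj2 w)) has_derivative (\<lambda>h. (a * cnj (fst w)) * fst h + (b * cnj (snd w)) * snd h)) (at z within U)"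
      by (simp add: mult_ac)
    then show "\<exists>a b. ((\<lambda>z. kernel_fraction (z \<odot> cnj2 w)) has_derivative (\<lambda>h. a * fst h + b * snd h)) (at z within U)" by blast
  qed
  then show ?thesis by (rule holomorphic2_on_cong) (simp add: kernel_eq_fraction w)
qed

lemma summable_kcoef:
  assumes "z \<in> U" shows "summable (\<lambda>n. kcoef (lattice_enum n) * norm (zmonom (lattice_enum n) z))"
  using summable_mult[OF summable_weight[OF assms], of "1 / (pi\<^sup>2 * of_int d)"] by (simp add: kcoef_def)

lemma summable_norm_I:
  assumes "z \<in> U" shows "summable (\<lambda>n. if lattice_enum n \<in> I then norm (zmonom (lattice_enum n) z) else 0)" (is "summable ?x")
proof (rule summable_comparison_test'[OF summable_weight[OF assms], of 0])
  fix n
  show "norm (?x n) \<le>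
      real_of_int (weight (lattice_enum n)) * norm (zmonom (lattice_enum n) z)"
  proof (cases "lattice_enum n \<in> I")
    case True
    then have "1 \<le> weight (lattice_enum n)" by (simp add: weight_def I_def max_def) (smt (verit) mult_pos_pos)
    then have "1 * norm (zmonom (lattice_enum n) z) \<le> real_of_int (weight (lattice_enum n)) * norm (zmonom (lattice_enum n) z)"
      by (intro mult_right_mono) auto
    then show ?thesis using True by simp
  qed (simp add: weight_def)
qed

lemma zmonom_integrable:
  assumes "\<alpha> \<in> I"
  shows "integrable lborel (\<lambda>z. indicator U z * (norm (zmonom \<alpha> z))\<^sup>2)"
    and "(\<integral>z. indicator U z * (norm (zmonom \<alpha> z))\<^sup>2 \<partial>lborel) = sqnorm \<alpha>"
proof -
  have "(\<integral>\<^sup>+z. ennreal (indicator U z * (norm (zmonom \<alpha> z))\<^sup>2) \<partial>lborel) = ennreal (sqnorm \<alpha>)"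
    using nn_integral_zmonom[of \<alpha>] assms by (simp add: sqnorm_def ennreal_mult' ennreal_indicator)
  then have "integrable lborel (\<lambda>z. indicator U z * (norm (zmonom \<alpha> z))\<^sup>2) \<and>
     (\<integral>z. indicator U z * (norm (zmonom \<alpha> z))\<^sup>2 \<partial>lborel) = sqnorm \<alpha>"
    using kcoef_I[OF assms] by (subst (asm) nn_integral_eq_integrable) auto
  then show "integrable lborel (\<lambda>z. indicator U z * (norm (zmonom \<alpha> z))\<^sup>2)"
    and "(\<integral>z. indicator U z * (norm (zmonom \<alpha> z))\<^sup>2 \<partial>lborel) = sqnorm \<alpha>" by auto
qed

text \<open>
  The torus mean of the integrand is \<open>coeff f \<alpha> * \<bar>z\<^sup>\<alpha>\<bar>\<^sup>2\<close>.
\<close>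

lemma integral_against_zmonom:
  assumes fb: "f \<in> bergman_space U" and a: "\<alpha> \<in> I"
  shows "integrable lborel (\<lambda>z. zero_ext f z * cnj (zmonom \<alpha> z))"
    and "(\<integral>z. zero_ext f z * cnj (zmonom \<alpha> z) \<partial>lborel) = coeff f \<alpha> * of_real (sqnorm \<alpha>)"
    and "(\<integral>z. norm (zero_ext f z * cnj (zmonom \<alpha> z)) \<partial>lborel) \<le> energy f + sqnorm \<alpha>"
proof -
  let ?m = "\<lambda>z. indicator U z * (norm (zmonom \<alpha> z))\<^sup>2"
  note f = bergman_holomorphic[OF fb]
  note [measurable] = zero_ext_measurable[OF f]
  let ?H = "\<lambda>z. zero_ext f z * cnj (zmonom \<alpha> z)"
  have bound: "norm (?H z) \<le> (norm (zero_ext f z))\<^sup>2 + ?m z" for z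
  proof (cases "z \<in> U")
    case True
    have "0 \<le> (norm (zero_ext f z) - norm (zmonom \<alpha> z))\<^sup>2" by simp
    then have "2 * (norm (zero_ext f z) * norm (zmonom \<alpha> z)) \<le> (norm (zero_ext f z))\<^sup>2 + (norm (zmonom \<alpha> z))\<^sup>2"
      by (simp add: power2_diff)
    moreover have "0 \<le> norm (zero_ext f z) * norm (zmonom \<alpha> z)" by simp
    ultimately have "norm (zero_ext f z) * norm (zmonom \<alpha> z) \<le> (norm (zero_ext f z))\<^sup>2 + (norm (zmonom \<alpha> z))\<^sup>2"
      by linarith
    then show ?thesis using True by (simp add: norm_mult)
  qed (simp add: zero_ext_def)
  have ib: "integrable lborel (\<lambda>z. (norm (zero_ext f z))\<^sup>2 + ?m z)"
    by (intro Bochner_Integration.integrable_add bergman_integrable fb zmonom_integrable a)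
  show int: "integrable lborel ?H"
    by (rule Bochner_Integration.integrable_bound[OF ib]) (use bound in \<open>auto intro: order_trans\<close>)
  have "(\<integral>z. norm (?H z) \<partial>lborel) \<le> (\<integral>z. (norm (zero_ext f z))\<^sup>2 + ?m z \<partial>lborel)"
    by (rule integral_mono[OF integrable_norm[OF int] ib bound])
  also have "\<dots> = energy f + sqnorm \<alpha>"
    using bergman_integrable[OF fb] zmonom_integrable[OF a] by (simp add: energy_def)
  finally show "(\<integral>z. norm (?H z) \<partial>lborel) \<le> energy f + sqnorm \<alpha>" .
  have tm: "torus_mean ?H z = coeff f \<alpha> * of_real (?m z)"
    if z: "z \<in> U \<longrightarrow> z \<in> U'" for z
  proof (cases "z \<in> U")
    case True
    note [measurable] = zero_ext_rotate_measurable[OF f, of z]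
    have cm: "(\<lambda>\<zeta>. cnj (zmonom \<alpha> (\<zeta> \<odot> z))) \<in> borel_measurable borel"
      unfolding zmonom_cmul by measurable
    have "torus_mean ?H z = (\<integral>\<zeta>. cnj (zmonom \<alpha> z) * (zero_ext f (\<zeta> \<odot> z) * zmonom (- \<alpha>) \<zeta>) \<partial>torus_measure)"
      unfolding torus_mean_def
      by (rule integral_torus_cong) (use cm in \<open>auto simp: zmonom_cmul cnj_zmonom_torus mult_ac\<close>)
    also have "\<dots> = cnj (zmonom \<alpha> z) * (coeff f \<alpha> * zmonom \<alpha> z)"
      using fourier_coeff[OF f, of z \<alpha>] z True by simp
    also have "\<dots> = coeff f \<alpha> * of_real (?m z)"
      using True by (simp add: complex_norm_square[symmetric] mult_ac flip: of_real_power)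
    finally show ?thesis .
  next
    case False
    have "torus_mean ?H z = (\<integral>\<zeta>. 0 \<partial>torus_measure)"
      unfolding torus_mean_def
    proof (rule integral_cong_AE)
      show "AE \<zeta> in torus_measure. zero_ext f (\<zeta> \<odot> z) * cnj (zmonom \<alpha> (\<zeta> \<odot> z)) = 0"
        using AE_torus by eventually_elim (simp add: zero_ext_def torus_U_iff False)
      show "(\<lambda>\<zeta>. zero_ext f (\<zeta> \<odot> z) * cnj (zmonom \<alpha> (\<zeta> \<odot> z))) \<in> borel_measurable torus_measure"
        unfolding zmonom_cmul using zero_ext_rotate_measurable[OF f, of z] by measurable
    qed simp
    then show ?thesis using False by simp
  qed
  have "(\<integral>z. ?H z \<partial>lborel) = (\<integral>z. torus_mean ?H z \<partial>lborel)"
    by (rule integral_torus_average[OF int, symmetric])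
  also have "\<dots> = (\<integral>z. coeff f \<alpha> * of_real (?m z) \<partial>lborel)"
  proof (rule integral_cong_AE)
    show "AE z in lborel. torus_mean ?H z = coeff f \<alpha> * of_real (?m z)"
      using AE_U' by eventually_elim (rule tm)
    have "case_prod (\<lambda>z \<zeta>. ?H (\<zeta> \<odot> z)) \<in> borel_measurable (lborel \<Otimes>\<^sub>M torus_measure)"
      using measurable_cmul_pair[of ?H] by (simp add: case_prod_unfold)
    then show "torus_mean ?H \<in> borel_measurable lborel"
      unfolding torus_mean_def by (rule tor.borel_measurable_lebesgue_integral)
  qed measurable
  also have "\<dots> = coeff f \<alpha> * of_real (sqnorm \<alpha>)"
    using zmonom_integrable(2)[OF a] by (simp only: integral_mult_right_zero integral_complex_of_real)
  finally show "(\<integral>z. ?H z \<partial>lborel) = coeff f \<alpha> * of_real (sqnorm \<alpha>)" .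
qed

text \<open>
  Termwise integration against \<open>f\<close>: the factor \<open>kcoef \<alpha>\<close> cancels the squared norm of the monomial, and what
  remains is the Laurent expansion of \<open>f\<close> at \<open>w\<close>.
\<close>

lemma kernel_reproduces:
  assumes fb: "f \<in> bergman_space U" and w: "w \<in> U"
  shows "f w = (LINT z:U|lborel. f z * cnj (kernel z w))"
proof -
  let ?e = lattice_enum
  note f = bergman_holomorphic[OF fb]
  note [measurable] = zero_ext_measurable[OF f]
  define F where "F n z = of_real (kcoef (?e n)) * zmonom (?e n) w * (zero_ext f z * cnj (zmonom (?e n) z))" for n z
  have int: "integrable lborel (F n)" for n
    using integral_against_zmonom(1)[OF fb, of "?e n"] kcoef_not_I[of "?e n"]
    unfolding F_def by (cases "?e n \<in> I") auto
  have intF: "(\<integral>z. F n z \<partial>lborel) = coeff f (?e n) * zmonom (?e n) w" for n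
  proof (cases "?e n \<in> I")
    case True
    then show ?thesis
      using integral_against_zmonom(2)[OF fb True] kcoef_I[OF True] unfolding F_def by simp
  qed (simp add: F_def kcoef_not_I coeff_zero[OF fb])
  have "(\<integral>z. norm (F n z) \<partial>lborel) \<le> energy f * (kcoef (?e n) * norm (zmonom (?e n) w)) + (if ?e n \<in> I then norm (zmonom (?e n) w) else 0)" for n
  proof (cases "?e n \<in> I")
    case True
    have "(\<integral>z. norm (F n z) \<partial>lborel) = kcoef (?e n) * norm (zmonom (?e n) w) * (\<integral>z. norm (zero_ext f z * cnj (zmonom (?e n) z)) \<partial>lborel)"
      using kcoef_nonneg by (simp add: F_def norm_mult)
    also have "\<dots> \<le> kcoef (?e n) * norm (zmonom (?e n) w) * (energy f + sqnorm (?e n))"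
      by (intro mult_left_mono integral_against_zmonom(3)[OF fb True]) (simp add: kcoef_nonneg)
    also have "\<dots> = energy f * (kcoef (?e n) * norm (zmonom (?e n) w)) + norm (zmonom (?e n) w)"
      using kcoef_I[OF True] by (simp add: field_simps)
    finally show ?thesis using True by simp
  qed (simp add: F_def kcoef_not_I)
  then have sI: "summable (\<lambda>n. (\<integral>z. norm (F n z) \<partial>lborel))"
    by (intro summable_comparison_test'[OF summable_add[OF summable_mult[OF summable_kcoef[OF w], of "energy f"] summable_norm_I[OF w]], of 0]) auto
  have sz: "summable (\<lambda>n. norm (F n z))" for z
  proof (cases "z \<in> U")
    case True
    have "summable (\<lambda>n. norm (zero_ext f z) * (kcoef (?e n) * norm (zmonom (?e n) (w \<odot> z))))"
      by (intro summable_mult summable_kcoef cmul_U w True)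
    then show ?thesis
      unfolding F_def by (simp add: norm_mult zmonom_cmul kcoef_nonneg mult_ac)
  qed (simp add: F_def zero_ext_def)
  have pt: "indicator U z *\<^sub>R (f z * cnj (kernel z w)) = (\<Sum>n. F n z)" for z
  proof (cases "z \<in> U")
    case True
    have "(\<lambda>n. of_real (kcoef (?e n)) * zmonom (?e n) (z \<odot> cnj2 w)) sums kernel z w"
      unfolding kernel_eq_fraction[OF True w] by (intro kernel_sums cmul_U cnj2_U True w)
    then have "(\<lambda>n. f z * cnj (of_real (kcoef (?e n)) * zmonom (?e n) (z \<odot> cnj2 w))) sums (f z * cnj (kernel z w))"
      by (intro sums_mult) (simp only: sums_cnj)
    also have "(\<lambda>n. f z * cnj (of_real (kcoef (?e n)) * zmonom (?e n) (z \<odot> cnj2 w))) = (\<lambda>n. F n z)"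
    proof
      fix n
      have "cnj (zmonom (?e n) (cnj2 w)) = zmonom (?e n) w" by (simp add: cnj_zmonom)
      then show "f z * cnj (of_real (kcoef (?e n)) * zmonom (?e n) (z \<odot> cnj2 w)) = F n z"
        using True unfolding zmonom_cmul[of _ z "cnj2 w"] by (simp add: F_def zero_ext_def mult_ac)
    qed
    finally show ?thesis using True by (simp add: sums_unique)
  qed (simp add: F_def zero_ext_def)
  have "(LINT z:U|lborel. f z * cnj (kernel z w)) = (\<integral>z. (\<Sum>n. F n z) \<partial>lborel)"
    unfolding set_lebesgue_integral_def pt ..
  also have "\<dots> = (\<Sum>n. (\<integral>z. F n z \<partial>lborel))"
    by (rule integral_suminf[OF int _ sI]) (simp add: sz)
  also have "\<dots> = f w" unfolding intF by (rule expansion[OF fb w])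
  finally show ?thesis by simp
qed

text \<open>
  By Cauchy-Schwarz with weights \<open>a n = kcoef \<alpha> * \<bar>w\<^sup>\<alpha>\<bar>\<close>, the square of the kernel is at most
  \<open>suminf a\<close> times the sum of \<open>a n * \<bar>z\<^sup>\<alpha>\<bar>\<^sup>2\<close>. Integrated over \<open>z\<close>, the \<open>n\<close>-th term becomes \<open>\<bar>w\<^sup>\<alpha>\<bar>\<close>.
\<close>

lemma kernel_square_integrable:
  assumes w: "w \<in> U"
  shows "set_integrable lborel U (\<lambda>z. (norm (kernel z w))\<^sup>2)"
proof -
  let ?c = "\<lambda>n. if lattice_enum n \<in> I then norm (zmonom (lattice_enum n) w) else 0"
  let ?K = "\<lambda>z. ennreal (norm (indicator U z *\<^sub>R (norm (kernel z w))\<^sup>2))"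
  let ?N = "\<lambda>n z. indicator U z * ennreal ((norm (zmonom (lattice_enum n) z))\<^sup>2)"
  let ?e = lattice_enum
  define a where "a n = kcoef (?e n) * norm (zmonom (?e n) w)" for n
  have a0: "0 \<le> a n" for n by (simp add: a_def kcoef_nonneg)
  have sa: "summable a" unfolding a_def by (rule summable_kcoef[OF w])
  have pt: "summable (\<lambda>n. a n * (norm (zmonom (?e n) z))\<^sup>2)"
     "(norm (kernel z w))\<^sup>2 \<le> (\<Sum>n. a n) * (\<Sum>n. a n * (norm (zmonom (?e n) z))\<^sup>2)" if z: "z \<in> U" for z
  proof -
    have "summable (\<lambda>n. kcoef (?e n) * norm (zmonom (?e n) (w \<odot> (z \<odot> z))))"
      by (intro summable_kcoef cmul_U w z)
    moreover have "zmonom \<alpha> (w \<odot> (z \<odot> z)) = zmonom \<alpha> w * (zmonom \<alpha> z * zmonom \<alpha> z)" for \<alpha>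
      using zmonom_cmul[of \<alpha> w "z \<odot> z"] zmonom_cmul[of \<alpha> z z] by simp
    ultimately show s: "summable (\<lambda>n. a n * (norm (zmonom (?e n) z))\<^sup>2)"
      by (simp add: a_def norm_mult power2_eq_square mult_ac)
    note cs = suminf_cauchy_schwarz[OF a0 sa s]
    have t: "norm (of_real (kcoef (?e n)) * zmonom (?e n) (z \<odot> cnj2 w)) = a n * norm (zmonom (?e n) z)" for n
    proof -
      have "norm (zmonom (?e n) (cnj2 w)) = norm (zmonom (?e n) w)"
        using complex_mod_cnj[of "zmonom (?e n) w"] by (simp add: cnj_zmonom)
      moreover have "norm (zmonom (?e n) (z \<odot> cnj2 w)) = norm (zmonom (?e n) z) * norm (zmonom (?e n) (cnj2 w))"
        unfolding zmonom_cmul[of _ z "cnj2 w"] by (rule norm_mult)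
      ultimately show ?thesis by (simp only: a_def norm_mult norm_of_real abs_of_nonneg[OF kcoef_nonneg] mult_ac)
    qed
    have "norm (kernel z w) \<le> (\<Sum>n. a n * norm (zmonom (?e n) z))"
      unfolding kernel_def t[symmetric] by (rule summable_norm) (simp only: t cs(1))
    then have "(norm (kernel z w))\<^sup>2 \<le> (\<Sum>n. a n * norm (zmonom (?e n) z))\<^sup>2" by (rule power_mono) simp
    also note cs(2)
    finally show "(norm (kernel z w))\<^sup>2 \<le> (\<Sum>n. a n) * (\<Sum>n. a n * (norm (zmonom (?e n) z))\<^sup>2)" .
  qed
  have A0: "0 \<le> (\<Sum>n. a n)" by (intro suminf_nonneg sa a0)
  have "(\<integral>\<^sup>+z. ?K z \<partial>lborel) \<le>
     (\<integral>\<^sup>+z. ennreal (\<Sum>n. a n) * (\<Sum>n. ennreal (a n) * ?N n z) \<partial>lborel)"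
  proof (rule nn_integral_mono)
    fix z
    show "?K z \<le>
      ennreal (\<Sum>n. a n) * (\<Sum>n. ennreal (a n) * ?N n z)"
    proof (cases "z \<in> U")
      case True
      have "(\<Sum>n. ennreal (a n) * ?N n z) = (\<Sum>n. ennreal (a n * (norm (zmonom (?e n) z))\<^sup>2))"
        using True a0 by (simp add: ennreal_mult')
      also have "\<dots> = ennreal (\<Sum>n. a n * (norm (zmonom (?e n) z))\<^sup>2)"
        by (rule suminf_ennreal2) (use pt(1)[OF True] a0 in auto)
      finally show ?thesis
        using True pt(2)[OF True] A0 by (simp add: ennreal_mult'[symmetric] ennreal_leI)
    qed simp
  qed
  also have "\<dots> = ennreal (\<Sum>n. a n) * (\<Sum>n. ennreal (a n) * (\<integral>\<^sup>+z. ?N n z \<partial>lborel))"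
    by (simp add: nn_integral_cmult nn_integral_suminf)
  also have "\<dots> = ennreal (\<Sum>n. a n) * (\<Sum>n. ennreal (?c n))"
  proof -
    have "ennreal (a n) * (\<integral>\<^sup>+z. ?N n z \<partial>lborel) = ennreal (?c n)" for n
    proof (cases "?e n \<in> I")
      case True
      have "ennreal (a n) * (\<integral>\<^sup>+z. ?N n z \<partial>lborel) = ennreal (a n * sqnorm (?e n))"
        using a0 True by (simp only: nn_integral_zmonom if_True sqnorm_def[symmetric] ennreal_mult')
      also have "a n * sqnorm (?e n) = norm (zmonom (?e n) w)"
        using kcoef_I[OF True] by (simp add: a_def)
      finally show ?thesis using True by simp
    qed (simp add: a_def kcoef_not_I)
    then show ?thesis by simp
  qed
  also have "\<dots> = ennreal (\<Sum>n. a n) * ennreal (\<Sum>n. ?c n)"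
    by (subst suminf_ennreal2) (use summable_norm_I[OF w] in auto)
  also have "\<dots> < \<infinity>" by (simp add: ennreal_mult_less_top)
  finally have fin: "(\<integral>\<^sup>+z. ?K z \<partial>lborel) < \<infinity>" .
  have "continuous_on U (\<lambda>z. (norm (kernel z w))\<^sup>2)"
    using holomorphic2_continuous_on[OF kernel_holomorphic[OF w]] by (intro continuous_intros)
  from borel_measurable_continuous_on_indicator[OF U_borel this]
  have "(\<lambda>z. indicator U z *\<^sub>R (norm (kernel z w))\<^sup>2) \<in> borel_measurable lborel"
    unfolding measurable_lborel2 .
  then show ?thesis unfolding set_integrable_def by (rule integrableI_bounded) (rule fin)
qed

lemma reproducing_kernel_kernel: "reproducing_kernel U kernel"
  unfolding reproducing_kernel_def bergman_space_def
  using kernel_holomorphic kernel_square_integrable kernel_reproduces[unfolded bergman_space_def] by blast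

lemma bergman_kernel_eq:
  assumes "z \<in> U" "w \<in> U"
  shows "bergman_kernel U z w = kernel_fraction (z \<odot> cnj2 w)"
proof -
  have "reproducing_kernel U (bergman_kernel U)"
    unfolding bergman_kernel_def
    by (rule someI[of "reproducing_kernel U", OF reproducing_kernel_kernel])
  from reproducing_kernel_unique[OF this reproducing_kernel_kernel assms] show ?thesis
    by (simp add: kernel_eq_fraction assms)
qed

end

section \<open>From bounded monomial polyhedra to the normal form\<close>

lemma monomial_less_one_swap: "monomial_less_one m n (x, y) \<longleftrightarrow> monomial_less_one n m (y, x)"
  by (auto simp: monomial_less_one_def mult.commute)

lemma monomial_less_one_iff:
  fixes g k l :: nat
  assumes g: "g > 0" and k: "k > 0"
  shows "monomial_less_one (int g * int k) (- (int g * int l)) (x, y) \<longleftrightarrow> norm x ^ k < norm y ^ l"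
proof -
  have pw: "a ^ g < b ^ g \<longleftrightarrow> a < b" if "0 \<le> a" "0 \<le> b" for a b :: real
    using that g power_strict_mono[of a b g] power_less_imp_less_base[of a g b] by blast
  have "int g * int k = int (k * g)" by simp
  then have x: "norm x powi (int g * int k) = (norm x ^ k) ^ g"
    by (simp only: power_int_of_nat power_mult)
  have "int g * int l = int (l * g)" by simp
  then have y: "norm y powi (- (int g * int l)) = inverse ((norm y ^ l) ^ g)"
    by (simp only: power_int_minus power_int_of_nat power_mult)
  have gk: "\<not> int g * int k < 0" using g k by (simp add: not_less)
  show ?thesis
  proof (cases "y = 0 \<and> l \<noteq> 0")
    case True
    then show ?thesis using g by (simp add: monomial_less_one_def zero_power not_less)
  next
    case False
    then have ypos: "(norm y ^ l) ^ g > 0" and yl: "norm y ^ l > 0" by (auto simp: le_less)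
    \<comment> \<open>Now the exponent of y is zero or y is nonzero, so the negative power is an honest inverse.\<close>
    have "\<not> (y = 0 \<and> - (int g * int l) < 0)" using False by auto
    then have "monomial_less_one (int g * int k) (- (int g * int l)) (x, y) \<longleftrightarrow> (norm x ^ k) ^ g * inverse ((norm y ^ l) ^ g) < 1"
      unfolding monomial_less_one_def fst_conv snd_conv x y using gk by blast
    also have "\<dots> \<longleftrightarrow> (norm x ^ k) ^ g < (norm y ^ l) ^ g" using ypos by (simp add: field_simps)
    also have "\<dots> \<longleftrightarrow> norm x ^ k < norm y ^ l" by (rule pw) auto
    finally show ?thesis .
  qed
qed

text \<open>
  For negative \<open>y1\<close>, \<open>y2\<close> the adjugate of \<open>B\<close> applied to \<open>(y1, y2)\<close> consists of the logarithms of the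
  coordinates of a point of the polyhedron. An entry of the wrong sign makes one of them arbitrarily
  large when \<open>y1\<close> or \<open>y2\<close> tends to minus infinity.
\<close>

lemma bounded_monomial_polyhedron_signs:
  fixes B :: "int^2^2"
  assumes det: "det B > 0" and bd: "bounded (monomial_polyhedron B)"
  shows "0 \<le> B $ 2 $ 2" "B $ 1 $ 2 \<le> 0" "B $ 2 $ 1 \<le> 0" "0 \<le> B $ 1 $ 1"
proof -
  define a b c e where "a = B $ 1 $ 1" and "b = B $ 1 $ 2" and "c = B $ 2 $ 1" and "e = B $ 2 $ 2"
  have D: "a * e - b * c > 0" using det by (simp add: det_2 a_def b_def c_def e_def)
  obtain M where M: "\<And>z. z \<in> monomial_polyhedron B \<Longrightarrow> norm z \<le> M" using bd by (auto simp: bounded_iff)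
  have key: "e * y1 - b * y2 \<le> M \<and> a * y2 - c * y1 \<le> M" if y: "y1 < 0" "y2 < 0" for y1 y2 :: real
  proof -
    define x1 x2 where "x1 = e * y1 - b * y2" and "x2 = a * y2 - c * y1"
    have E: "exp x powi n = exp (n * x)" for x :: real and n :: int by (rule exp_power_int)
    have DR: "0 < real_of_int (a * e - b * c)" using D unfolding of_int_0_less_iff .
    have "a * x1 + b * x2 = (a * e - b * c) * y1" "c * x1 + e * x2 = (a * e - b * c) * y2"
      by (simp_all add: x1_def x2_def algebra_simps)
    then have "a * x1 + b * x2 < 0" "c * x1 + e * x2 < 0" using y DR by (simp_all add: mult_pos_neg)
    then have "(of_real (exp x1), of_real (exp x2)) \<in> monomial_polyhedron B"
      by (simp add: monomial_polyhedron_def monomial_less_one_def E exp_add[symmetric] a_def b_def c_def e_def)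
    from M[OF this] have "norm (complex_of_real (exp x1), complex_of_real (exp x2)) \<le> M" .
    moreover have "exp x1 \<le> norm (complex_of_real (exp x1), complex_of_real (exp x2))"
       "exp x2 \<le> norm (complex_of_real (exp x1), complex_of_real (exp x2))"
      using norm_fst_le[of "complex_of_real (exp x1)" "complex_of_real (exp x2)"]
        norm_snd_le[of "complex_of_real (exp x2)" "complex_of_real (exp x1)"] by simp_all
    moreover have "x1 \<le> exp x1" "x2 \<le> exp x2" using exp_ge_add_one_self[of x1] exp_ge_add_one_self[of x2] by linarith+
    ultimately show ?thesis unfolding x1_def x2_def by linarith
  qed
  have unb: "False" if "k > 0" "\<And>N::real. N > 0 \<Longrightarrow> of_int k * N + C \<le> M" for k :: int and C :: real
  proof -
    define X where "X = max 1 (M - C + 1)"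
    have X: "0 < X" "M - C + 1 \<le> X" by (auto simp: X_def)
    have "1 * X \<le> of_int k * X" using that(1) X by (intro mult_right_mono) auto
    then show False using that(2)[OF X(1)] X by linarith
  qed
  show "0 \<le> B $ 2 $ 2"
    by (rule ccontr, rule unb[of "- e" b]) (use key[of "- _" "- 1"] in \<open>auto simp: e_def\<close>)
  show "B $ 1 $ 2 \<le> 0"
    by (rule ccontr, rule unb[of "b" "- e"]) (use key[of "- 1" "- _"] in \<open>auto simp: b_def\<close>)
  show "B $ 2 $ 1 \<le> 0"
    by (rule ccontr, rule unb[of "c" "- a"]) (use key[of "- _" "- 1"] in \<open>auto simp: c_def\<close>)
  show "0 \<le> B $ 1 $ 1"
    by (rule ccontr, rule unb[of "- a" "c"]) (use key[of "- 1" "- _"] in \<open>auto simp: a_def\<close>)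
qed

context monomial_domain
begin

text \<open>
  Both sides index the tent function by the degrees of the exponent shifted by \<open>(2 r, 2 q)\<close>, the shift
  that clears the negative powers in the kernel series; \<open>AR\<close> is \<open>A\<close> with the columns exchanged.
\<close>

lemma coeff_g_eq:
  fixes A :: "int^2^2"
  assumes A: "A $ 1 $ 1 = int p" "A $ 1 $ 2 = int q" "A $ 2 $ 1 = int r" "A $ 2 $ 2 = int s"
  shows "det A = d" "coeff_g A \<gamma> = gcoef (int (fst \<gamma>), int (snd \<gamma>))"
proof -
  show dA: "det A = d" by (simp add: det_2 A d_def)
  have R: "(A ** matR) $ 1 $ 1 = int q" "(A ** matR) $ 1 $ 2 = int p" "(A ** matR) $ 2 $ 1 = int s" "(A ** matR) $ 2 $ 2 = int r"
    by (simp_all add: matrix_matrix_mult_def sum_2 matR_def A)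
  have dR: "det (A ** matR) = - d" by (simp add: det_2 R d_def)
  have "indexN A \<gamma> = deg1 (int (fst \<gamma>), int (snd \<gamma>)) - 2 * int q * int r - 2 * int p * int r - 1"
    using d_pos unfolding indexN_def dA by (simp add: A perm2_def deg1_def d_def algebra_simps)
  moreover have "indexN (A ** matR) \<gamma> = deg2 (int (fst \<gamma>), int (snd \<gamma>)) - 2 * int q * int r - 2 * int q * int s - 1"
    using d_pos unfolding indexN_def dR by (simp add: R perm2_def deg2_def d_def algebra_simps)
  ultimately show "coeff_g A \<gamma> = gcoef (int (fst \<gamma>), int (snd \<gamma>))"
    by (simp add: coeff_g_def gcoef_def dA)
qed

lemma poly_g_eq:
  fixes A :: "int^2^2"
  assumes A: "A $ 1 $ 1 = int p" "A $ 1 $ 2 = int q" "A $ 2 $ 1 = int r" "A $ 2 $ 2 = int s"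
  shows "poly_g A t1 t2 = gpoly (t1, t2)"
proof -
  let ?X = "{0..2 * int r + 2 * int s - 2} \<times> {0..2 * int p + 2 * int q - 2}"
  let ?Y = "{..nat (2 * int r + 2 * int s - 2)} \<times> {..nat (2 * int p + 2 * int q - 2)}"
  let ?g = "\<lambda>\<gamma>. of_int (coeff_g A \<gamma>) * t1 ^ fst \<gamma> * t2 ^ snd \<gamma>"
  have "(?g has_sum (\<Sum>\<gamma>\<in>?Y. ?g \<gamma>)) UNIV"
  proof (rule has_sum_finite_neutralI)
    fix \<gamma> assume \<gamma>: "\<gamma> \<in> UNIV - ?Y"
    have "coeff_g A \<gamma> = 0"
    proof (rule ccontr)
      assume "coeff_g A \<gamma> \<noteq> 0"
      then show False using gcoef_nonzero[of "(int (fst \<gamma>), int (snd \<gamma>))"] \<gamma>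
        by (auto simp: coeff_g_eq[OF A] mem_Times_iff nat_le_iff le_nat_iff)
    qed
    then show "?g \<gamma> = 0" by simp
  qed auto
  moreover have "(\<Sum>\<gamma>\<in>?Y. ?g \<gamma>) = gpoly (t1, t2)"
    unfolding gpoly_def using p_pos s_pos
    by (intro sum.reindex_bij_witness[where i="\<lambda>\<gamma>. (nat (fst \<gamma>), nat (snd \<gamma>))" and j="\<lambda>\<gamma>. (int (fst \<gamma>), int (snd \<gamma>))"])
       (auto simp: coeff_g_eq[OF A] zmonom_def le_nat_iff)
  ultimately show ?thesis unfolding poly_g_def by (simp add: infsumI)
qed

end

theorem theorem2:
  fixes B A :: "int^2^2"
  assumes "det B > 0"
    and "bounded (monomial_polyhedron B)"
    and "A = matA B"
  shows "(\<forall>z\<in>monomial_polyhedron B. \<forall>w\<in>monomial_polyhedron B.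
            let t1 = fst z * cnj (fst w); t2 = snd z * cnj (snd w) in
              bergman_kernel (monomial_polyhedron B) z w =
                1 / (of_real (pi\<^sup>2) * of_int (det A)) *
                (poly_g A t1 t2 /
                  ((t2 powi (A $ 1 $ 2) - t1 powi (A $ 2 $ 2))\<^sup>2 *
                   (t1 powi (A $ 2 $ 1) - t2 powi (A $ 1 $ 1))\<^sup>2)))
       \<and> finite {\<gamma>. coeff_g A \<gamma> \<noteq> 0}
       \<and> (\<forall>\<gamma>. coeff_g A \<gamma> \<noteq> 0 \<longrightarrow>
            0 \<le> int (fst \<gamma>) \<and> int (fst \<gamma>) \<le> 2 * A $ 2 $ 1 + 2 * A $ 2 $ 2 - 2 \<and>
            0 \<le> int (snd \<gamma>) \<and> int (snd \<gamma>) \<le> 2 * A $ 1 $ 1 + 2 * A $ 1 $ 2 - 2)"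
proof -
  note sg = bounded_monomial_polyhedron_signs[OF assms(1,2)]
  have detB: "B $ 1 $ 1 * B $ 2 $ 2 > B $ 1 $ 2 * B $ 2 $ 1" using assms(1) by (simp add: det_2)
  moreover have "0 \<le> B $ 1 $ 2 * B $ 2 $ 1" using sg by (simp add: mult_nonpos_nonpos)
  ultimately have "B $ 1 $ 1 * B $ 2 $ 2 \<noteq> 0" by linarith
  then have pos: "0 < B $ 1 $ 1" "0 < B $ 2 $ 2" using sg by (auto simp: le_less)
  \<comment> \<open>B consists of the rows (s, -q) and (-r, p) of the adjugate of A, multiplied by the two gcds.\<close>
  define g1 g2 where "g1 = nat (gcd (B $ 2 $ 2) (B $ 2 $ 1))" and "g2 = nat (gcd (B $ 1 $ 2) (B $ 1 $ 1))"
  have g: "int g1 = gcd (B $ 2 $ 2) (B $ 2 $ 1)" "int g2 = gcd (B $ 1 $ 2) (B $ 1 $ 1)" "g1 > 0" "g2 > 0"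
    using pos by (auto simp: g1_def g2_def)
  define p q r s where "p = nat (B $ 2 $ 2 div int g1)" and "q = nat (- (B $ 1 $ 2) div int g2)"
    and "r = nat (- (B $ 2 $ 1) div int g1)" and "s = nat (B $ 1 $ 1 div int g2)"
  have A: "A $ 1 $ 1 = int p" "A $ 1 $ 2 = int q" "A $ 2 $ 1 = int r" "A $ 2 $ 2 = int s"
    using sg unfolding assms(3) matA_def p_def q_def r_def s_def g(1,2)[symmetric]
    by (simp_all add: pos_imp_zdiv_nonneg_iff g(3,4))
  have B: "B $ 2 $ 2 = int g1 * int p" "B $ 1 $ 2 = - (int g2 * int q)" "B $ 2 $ 1 = - (int g1 * int r)" "B $ 1 $ 1 = int g2 * int s"
  proof -
    have "int g1 dvd B $ 2 $ 2" "int g2 dvd - (B $ 1 $ 2)" "int g1 dvd - (B $ 2 $ 1)" "int g2 dvd B $ 1 $ 1"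
      unfolding g(1,2) by simp_all
    moreover have "0 \<le> B $ 2 $ 2 div int g1" "0 \<le> - (B $ 1 $ 2) div int g2" "0 \<le> - (B $ 2 $ 1) div int g1" "0 \<le> B $ 1 $ 1 div int g2"
      using sg g(3,4) by (auto simp: pos_imp_zdiv_nonneg_iff)
    ultimately show "B $ 2 $ 2 = int g1 * int p" "B $ 1 $ 2 = - (int g2 * int q)" "B $ 2 $ 1 = - (int g1 * int r)" "B $ 1 $ 1 = int g2 * int s"
      unfolding p_def q_def r_def s_def by (simp_all add: dvd_mult_div_cancel)
  qed
  have ps: "p > 0" "s > 0" using pos B by (auto intro: Nat.gr0I)
  have "int g1 * int g2 * (int q * int r) < int g1 * int g2 * (int p * int s)"
    using detB unfolding B by (simp add: mult_ac)
  then have "int q * int r < int p * int s" using g(3,4) by (simp add: mult_less_cancel_left)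
  then have "q * r < p * s" by (simp flip: of_nat_mult)
  then interpret monomial_domain p q r s by unfold_locales
  have U: "monomial_polyhedron B = U"
  proof -
    have "monomial_less_one (B $ 1 $ 1) (B $ 1 $ 2) z \<longleftrightarrow> norm (fst z) ^ s < norm (snd z) ^ q" for z
      unfolding B using monomial_less_one_iff[OF g(4) ps(2), of q "fst z" "snd z"] by simp
    moreover have "monomial_less_one (B $ 2 $ 1) (B $ 2 $ 2) z \<longleftrightarrow> norm (snd z) ^ p < norm (fst z) ^ r" for z
      unfolding B using monomial_less_one_iff[OF g(3) ps(1), of r "snd z" "fst z"]
        monomial_less_one_swap[of _ _ "snd z" "fst z"] by simp
    ultimately show ?thesis by (simp add: monomial_polyhedron_def U_def)
  qed
  have supp: "0 \<le> int (fst \<gamma>) \<and> int (fst \<gamma>) \<le> 2 * A $ 2 $ 1 + 2 * A $ 2 $ 2 - 2 \<and>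
      0 \<le> int (snd \<gamma>) \<and> int (snd \<gamma>) \<le> 2 * A $ 1 $ 1 + 2 * A $ 1 $ 2 - 2" if "coeff_g A \<gamma> \<noteq> 0" for \<gamma>
    using that gcoef_nonzero[of "(int (fst \<gamma>), int (snd \<gamma>))"] by (simp add: coeff_g_eq[OF A] A)
  have fin: "finite {\<gamma>. coeff_g A \<gamma> \<noteq> 0}"
  proof (rule finite_subset)
    show "{\<gamma>. coeff_g A \<gamma> \<noteq> 0} \<subseteq> {..2 * r + 2 * s} \<times> {..2 * p + 2 * q}"
      using supp unfolding A by (fastforce simp: mem_Times_iff)
  qed simp
  have "bergman_kernel (monomial_polyhedron B) z w =
      1 / (of_real (pi\<^sup>2) * of_int (det A)) *
      (poly_g A (fst z * cnj (fst w)) (snd z * cnj (snd w)) /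
        (((snd z * cnj (snd w)) powi (A $ 1 $ 2) - (fst z * cnj (fst w)) powi (A $ 2 $ 2))\<^sup>2 *
         ((fst z * cnj (fst w)) powi (A $ 2 $ 1) - (snd z * cnj (snd w)) powi (A $ 1 $ 1))\<^sup>2))"
    if "z \<in> monomial_polyhedron B" "w \<in> monomial_polyhedron B" for z w
    using that unfolding U
    by (simp only: bergman_kernel_eq kernel_fraction_def poly_g_eq[OF A] coeff_g_eq(1)[OF A] A power_int_of_nat fst_conv snd_conv)
  then show ?thesis using fin supp unfolding Let_def by blast
qed

end
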